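(* There exist constants $C,\alpha_0>0$ such that the following holds for all $\alpha\in\mathbb{R}$ with $|\alpha|\ge\alpha_0$. For every $\lambda\in\mathbb{R}$ and every $l\in\mathbb{Z}\setminus\{0\}$, the operator $i\lambda+\mathbb{Q}_lL_{\alpha,l}$ in $Y_l$ is invertible and $$\|(i\lambda+\mathbb{Q}_lL_{\alpha,l})^{-1}\|_{Y_l\to Y_l}\le\begin{cases}\dfrac{C}{|\alpha l|\,\big(|\frac{\lambda}{\alpha l}|-1\big)} & \text{if } |\frac{\lambda}{\alpha l}|>1+\frac{1}{|\alpha l|^{1/2}},\\[2mm] \dfrac{C}{|\alpha l|^{1/2}} & \text{if } 1-\frac{1}{|\alpha l|^{1/2}}<|\frac{\lambda}{\alpha l}|\le 1+\frac{1}{|\alpha l|^{1/2}},\\[2mm] \dfrac{C}{|\alpha l|^{2/3}\big(1-|\frac{\lambda}{\alpha l}|\big)^{1/3}} & \text{if } |\frac{\lambda}{\alpha l}|\le 1-\frac{1}{|\alpha l|^{1/2}}.\end{cases}$$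
   Context: $\mathbb{T}=\mathbb{R}/2\pi\mathbb{Z}$ and $L^2(\mathbb{T})$ is the complex Hilbert space. For $l\in\mathbb{Z}\setminus\{0\}$ and $\alpha\in\mathbb{R}$: $A_l=\partial_y^2-l^2$ with domain $W^{2,2}(\mathbb{T})$; $M_g$ denotes multiplication by the function $g$; $\hat\Lambda_l=M_{\sin y}(I+A_l^{-1})$, a bounded operator on $L^2(\mathbb{T})$; $L_{\alpha,l}=A_l-i\alpha l\,\hat\Lambda_l$ with domain $W^{2,2}(\mathbb{T})$. $Y_l=L^2(\mathbb{T})$ if $|l|\ge2$ and $Y_l=\{f\in L^2(\mathbb{T}):\int_0^{2\pi}f\,dy=0\}$ if $|l|=1$; $\mathbb{Q}_l$ is the orthogonal projection of $L^2(\mathbb{T})$ onto $Y_l$ (so $\mathbb{Q}_lf=f$ for $|l|\ge 2$, and $\mathbb{Q}_lf=f-\frac1{2\pi}\int_0^{2\pi}f\,dy$ for $|l|=1$). $\mathbb{Q}_lL_{\alpha,l}$ is regarded as an operator in $Y_l$ with domain $W^{2,2}(\mathbb{T})\cap Y_l$. *)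

theory Defs
  imports "HOL-Analysis.Analysis"
begin

section \<open>The Hilbert space of square-integrable functions on the torus\<close>

text \<open>The torus is represented by the period \<open>[0, 2\<pi>]\<close> with Lebesgue measure; the identification
  of the two end points enters only through the periodic test functions below.\<close>

definition torus :: "real measure" where
  "torus = lebesgue_on {0..2*pi}"

definition sq_integrable :: "(real \<Rightarrow> complex) \<Rightarrow> bool" where
  "sq_integrable f \<longleftrightarrow> f \<in> borel_measurable torus \<and> integrable torus (\<lambda>x. (cmod (f x))\<^sup>2)"

definition ae_eq :: "(real \<Rightarrow> complex) \<Rightarrow> (real \<Rightarrow> complex) \<Rightarrow> bool" where
  "ae_eq f g \<longleftrightarrow> sq_integrable f \<and> sq_integrable g \<and> (AE x in torus. f x = g x)"

lemma sq_integrable_zero: "sq_integrable (\<lambda>x. 0)"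
  by (simp add: sq_integrable_def)

lemma ae_eq_part_equivp: "part_equivp ae_eq"
proof (rule part_equivpI)
  show "\<exists>x. ae_eq x x"
    by (rule exI[of _ "\<lambda>x. 0"]) (simp add: ae_eq_def sq_integrable_zero)
  show "symp ae_eq"
    by (auto simp: symp_def ae_eq_def elim: eventually_mono)
  show "transp ae_eq"
    by (auto simp: transp_def ae_eq_def elim: eventually_elim2)
qed

quotient_type l2 = "real \<Rightarrow> complex" / partial: ae_eq
  by (rule ae_eq_part_equivp)

lemma sq_integrable_bounded_mult:
  assumes "sq_integrable f" "g \<in> borel_measurable torus" "\<And>x. x \<in> {0..2*pi} \<Longrightarrow> cmod (g x) \<le> B"
  shows "sq_integrable (\<lambda>x. g x * f x)"
proof -
  have [measurable]: "f \<in> borel_measurable torus" "g \<in> borel_measurable torus"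
    using assms by (auto simp: sq_integrable_def)
  have i: "integrable torus (\<lambda>x. B\<^sup>2 * (cmod (f x))\<^sup>2)"
    using assms by (simp add: sq_integrable_def)
  have "integrable torus (\<lambda>x. (cmod (g x * f x))\<^sup>2)"
  proof (rule Bochner_Integration.integrable_bound[OF i])
    show "AE x in torus. norm ((cmod (g x * f x))\<^sup>2) \<le> norm (B\<^sup>2 * (cmod (f x))\<^sup>2)"
    proof (rule AE_I2)
      fix x assume "x \<in> space torus"
      then have "cmod (g x) \<le> B" using assms(3) by (simp add: torus_def)
      then have "(cmod (g x))\<^sup>2 \<le> B\<^sup>2" by (simp add: power_mono)
      then show "norm ((cmod (g x * f x))\<^sup>2) \<le> norm (B\<^sup>2 * (cmod (f x))\<^sup>2)"
        by (simp add: norm_mult power_mult_distrib mult_right_mono)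
    qed
  qed measurable
  then show ?thesis by (simp add: sq_integrable_def)
qed

lemma sq_integrable_cmult: "sq_integrable f \<Longrightarrow> sq_integrable (\<lambda>x. c * f x)"
  by (rule sq_integrable_bounded_mult[where B = "cmod c"]) auto

lemma sq_integrable_add:
  assumes "sq_integrable f" "sq_integrable g"
  shows "sq_integrable (\<lambda>x. f x + g x)"
proof -
  have [measurable]: "f \<in> borel_measurable torus" "g \<in> borel_measurable torus"
    using assms by (auto simp: sq_integrable_def)
  have i: "integrable torus (\<lambda>x. 2 * (cmod (f x))\<^sup>2 + 2 * (cmod (g x))\<^sup>2)"
    using assms by (simp add: sq_integrable_def)
  have "integrable torus (\<lambda>x. (cmod (f x + g x))\<^sup>2)"
  proof (rule Bochner_Integration.integrable_bound[OF i])
    show "AE x in torus. norm ((cmod (f x + g x))\<^sup>2) \<le> norm (2 * (cmod (f x))\<^sup>2 + 2 * (cmod (g x))\<^sup>2)"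
    proof (rule AE_I2)
      fix x
      have "(cmod (f x + g x))\<^sup>2 \<le> (cmod (f x) + cmod (g x))\<^sup>2"
        by (simp add: power_mono norm_triangle_ineq)
      also have "\<dots> \<le> 2 * (cmod (f x))\<^sup>2 + 2 * (cmod (g x))\<^sup>2"
        using sum_squares_bound[of "cmod (f x)" "cmod (g x)"] by (simp add: power2_sum)
      finally show "norm ((cmod (f x + g x))\<^sup>2) \<le> norm (2 * (cmod (f x))\<^sup>2 + 2 * (cmod (g x))\<^sup>2)"
        by simp
    qed
  qed measurable
  then show ?thesis by (simp add: sq_integrable_def)
qed

lemma integrable_mult_cnj:
  assumes "sq_integrable f" "sq_integrable g"
  shows "integrable torus (\<lambda>x. f x * cnj (g x))"
proof -
  have [measurable]: "f \<in> borel_measurable torus" "g \<in> borel_measurable torus"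
    using assms by (auto simp: sq_integrable_def)
  have [measurable]: "(\<lambda>x. cnj (g x)) \<in> borel_measurable torus"
    by (rule borel_measurable_continuous_on[OF _ \<open>g \<in> borel_measurable torus\<close>])
       (intro continuous_intros)
  have i: "integrable torus (\<lambda>x. (cmod (f x))\<^sup>2 + (cmod (g x))\<^sup>2)"
    using assms by (simp add: sq_integrable_def)
  show ?thesis
  proof (rule Bochner_Integration.integrable_bound[OF i])
    show "AE x in torus. norm (f x * cnj (g x)) \<le> norm ((cmod (f x))\<^sup>2 + (cmod (g x))\<^sup>2)"
    proof (rule AE_I2)
      fix x
      have "0 \<le> cmod (f x) * cmod (g x)" by simp
      then have "cmod (f x) * cmod (g x) \<le> (cmod (f x))\<^sup>2 + (cmod (g x))\<^sup>2"
        using sum_squares_bound[of "cmod (f x)" "cmod (g x)"] by linarith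
      then show "norm (f x * cnj (g x)) \<le> norm ((cmod (f x))\<^sup>2 + (cmod (g x))\<^sup>2)"
        by (simp add: norm_mult)
    qed
  qed measurable
qed

lift_definition scaleC :: "complex \<Rightarrow> l2 \<Rightarrow> l2" is "\<lambda>c f x. c * f x"
  by (auto simp: ae_eq_def intro: sq_integrable_cmult elim: eventually_mono)

lift_definition cinner :: "l2 \<Rightarrow> l2 \<Rightarrow> complex" is "\<lambda>f g. LINT x|torus. f x * cnj (g x)"
proof -
  fix f f' g g' assume "ae_eq f f'" "ae_eq g g'"
  then show "(LINT x|torus. f x * cnj (g x)) = (LINT x|torus. f' x * cnj (g' x))"
    by (intro integral_cong_AE borel_measurable_integrable integrable_mult_cnj)
       (auto simp: ae_eq_def elim: eventually_elim2)
qed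

lift_definition l2_integral :: "l2 \<Rightarrow> complex" is "\<lambda>f. LINT x|torus. f x"
  by (rule integral_cong_AE) (auto simp: ae_eq_def sq_integrable_def)

text \<open>The class of a square-integrable function (and \<open>0\<close> for any other function).\<close>

lift_definition to_l2 :: "(real \<Rightarrow> complex) \<Rightarrow> l2" is
  "\<lambda>f. if sq_integrable f then f else (\<lambda>x. 0)"
  by (auto simp: ae_eq_def sq_integrable_zero)

instantiation l2 :: real_inner
begin

lift_definition zero_l2 :: l2 is "\<lambda>x. 0"
  by (simp add: ae_eq_def sq_integrable_zero)

lift_definition plus_l2 :: "l2 \<Rightarrow> l2 \<Rightarrow> l2" is "\<lambda>f g x. f x + g x"
  by (auto simp: ae_eq_def intro: sq_integrable_add elim: eventually_elim2)

definition uminus_l2 :: "l2 \<Rightarrow> l2" where "- f = scaleC (-1) f"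
definition minus_l2 :: "l2 \<Rightarrow> l2 \<Rightarrow> l2" where "f - g = f + - (g :: l2)"
definition scaleR_l2 :: "real \<Rightarrow> l2 \<Rightarrow> l2" where "r *\<^sub>R f = scaleC (complex_of_real r) f"
definition inner_l2 :: "l2 \<Rightarrow> l2 \<Rightarrow> real" where "inner f g = Re (cinner f g)"
definition norm_l2 :: "l2 \<Rightarrow> real" where "norm (f :: l2) = sqrt (inner f f)"
definition sgn_l2 :: "l2 \<Rightarrow> l2" where "sgn f = inverse (norm f) *\<^sub>R (f :: l2)"
definition dist_l2 :: "l2 \<Rightarrow> l2 \<Rightarrow> real" where "dist (f :: l2) g = norm (f - g)"
definition uniformity_l2 :: "(l2 \<times> l2) filter" where
  "uniformity_l2 = (INF e\<in>{0 <..}. principal {(f, g). dist (f :: l2) g < e})"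
definition open_l2 :: "l2 set \<Rightarrow> bool" where
  "open_l2 U \<longleftrightarrow> (\<forall>f\<in>U. eventually (\<lambda>(f', g). f' = f \<longrightarrow> g \<in> U) uniformity)"

instance
proof
  fix f g h :: l2 and r s :: real
  show "f + g + h = f + (g + h)"
    by transfer (auto simp: ae_eq_def intro: sq_integrable_add simp: add.assoc)
  show "f + g = g + f"
    by transfer (auto simp: ae_eq_def intro: sq_integrable_add simp: add.commute)
  show "0 + f = f"
    by transfer (auto simp: ae_eq_def)
  show "- f + f = 0"
    unfolding uminus_l2_def
    by transfer (auto simp: ae_eq_def sq_integrable_zero)
  show "f - g = f + - g" by (simp add: minus_l2_def)
  show "r *\<^sub>R (f + g) = r *\<^sub>R f + r *\<^sub>R g" unfolding scaleR_l2_def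
    by transfer (auto simp: ae_eq_def distrib_left intro!: sq_integrable_add sq_integrable_cmult)
  show "(r + s) *\<^sub>R f = r *\<^sub>R f + s *\<^sub>R f" unfolding scaleR_l2_def
    by transfer (auto simp: ae_eq_def distrib_right intro!: sq_integrable_add sq_integrable_cmult)
  show "r *\<^sub>R s *\<^sub>R f = (r * s) *\<^sub>R f" unfolding scaleR_l2_def
    by transfer (auto simp: ae_eq_def mult.assoc intro!: sq_integrable_cmult)
  show "1 *\<^sub>R f = f" unfolding scaleR_l2_def
    by transfer (auto simp: ae_eq_def)
  show "inner f g = inner g f" unfolding inner_l2_def
  proof transfer
    fix f g assume "ae_eq f f" "ae_eq g g"
    have "(LINT x|torus. g x * cnj (f x)) = (LINT x|torus. cnj (f x * cnj (g x)))"
      by (simp add: mult.commute)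
    also have "\<dots> = cnj (LINT x|torus. f x * cnj (g x))"
      by (rule Bochner_Integration.integral_cnj)
    finally show "Re (LINT x|torus. f x * cnj (g x)) = Re (LINT x|torus. g x * cnj (f x))"
      by simp
  qed
  show "inner (f + g) h = inner f h + inner g h" unfolding inner_l2_def
    by transfer (simp add: ae_eq_def distrib_right integrable_mult_cnj)
  show "inner (r *\<^sub>R f) g = r * inner f g" unfolding inner_l2_def scaleR_l2_def
    by transfer (simp add: mult.assoc)
  have sq: "f x * cnj (f x) = complex_of_real ((cmod (f x))\<^sup>2)" for f :: "real \<Rightarrow> complex" and x
    by (simp only: complex_norm_square)
  show "0 \<le> inner f f" unfolding inner_l2_def
    by transfer (simp only: sq integral_complex_of_real Re_complex_of_real,
        simp add: integral_nonneg_AE)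
  show "(inner f f = 0) = (f = 0)" unfolding inner_l2_def
  proof transfer
    fix f assume f: "ae_eq f f"
    have "(Re (LINT x|torus. f x * cnj (f x)) = 0) \<longleftrightarrow> (LINT x|torus. (cmod (f x))\<^sup>2) = 0"
      by (simp only: sq integral_complex_of_real Re_complex_of_real)
    also have "\<dots> \<longleftrightarrow> (AE x in torus. (cmod (f x))\<^sup>2 = 0)"
      using f by (intro integral_nonneg_eq_0_iff_AE) (auto simp: ae_eq_def sq_integrable_def)
    also have "\<dots> \<longleftrightarrow> ae_eq f (\<lambda>x. 0)"
      using f by (simp add: ae_eq_def sq_integrable_zero)
    finally show "(Re (LINT x|torus. f x * cnj (f x)) = 0) = ae_eq f (\<lambda>x. 0)" .
  qed
qed (simp_all add: norm_l2_def sgn_l2_def dist_l2_def uniformity_l2_def open_l2_def)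

end


section \<open>Operators in a subspace\<close>

text \<open>An unbounded operator in \<open>Y\<close> is given by its domain \<open>D \<subseteq> Y\<close> and a map that is only
  relevant on \<open>D\<close>; its inverse is \<open>inv_into D T\<close>. Invertibility means a bounded inverse that is
  defined on all of \<open>Y\<close>.\<close>

definition bounded_on :: "l2 set \<Rightarrow> (l2 \<Rightarrow> l2) \<Rightarrow> bool" where
  "bounded_on Y S \<longleftrightarrow> (\<exists>K. \<forall>f\<in>Y. norm (S f) \<le> K * norm f)"

definition invertible_in :: "l2 set \<Rightarrow> l2 set \<Rightarrow> (l2 \<Rightarrow> l2) \<Rightarrow> bool" where
  "invertible_in Y D T \<longleftrightarrow> bij_betw T D Y \<and> bounded_on Y (inv_into D T)"

text \<open>As \<^const>\<open>onorm\<close>, with the supremum restricted to \<open>Y\<close>; meaningful for \<open>bounded_on Y S\<close>.\<close>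

definition onorm_on :: "l2 set \<Rightarrow> (l2 \<Rightarrow> l2) \<Rightarrow> real" where
  "onorm_on Y S = (SUP f\<in>Y. norm (S f) / norm f)"

definition orth_proj :: "l2 set \<Rightarrow> l2 \<Rightarrow> l2" where
  "orth_proj Y f = (THE p. p \<in> Y \<and> (\<forall>h\<in>Y. cinner (f - p) h = 0))"


section \<open>The Sobolev space and the second derivative\<close>

definition smooth_periodic :: "(real \<Rightarrow> complex) \<Rightarrow> bool" where
  "smooth_periodic \<phi> \<longleftrightarrow>
    (\<forall>n x. ((\<lambda>\<psi> y. vector_derivative \<psi> (at y)) ^^ n) \<phi> differentiable at x) \<and>
    (\<forall>x. \<phi> (x + 2*pi) = \<phi> x)"

text \<open>\<open>\<integral> f \<phi>' = - \<integral> g \<phi>\<close> for all test functions; the conjugation in \<open>cinner\<close> is harmless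
  as test functions are closed under conjugation.\<close>

definition has_weak_deriv :: "l2 \<Rightarrow> l2 \<Rightarrow> bool" where
  "has_weak_deriv f g \<longleftrightarrow> (\<forall>\<phi>. smooth_periodic \<phi> \<longrightarrow>
    cinner f (to_l2 (\<lambda>y. vector_derivative \<phi> (at y))) = - cinner g (to_l2 \<phi>))"

definition W22 :: "l2 set" where
  "W22 = {f. \<exists>g h. has_weak_deriv f g \<and> has_weak_deriv g h}"

definition weak_deriv :: "l2 \<Rightarrow> l2" where
  "weak_deriv f = (THE g. has_weak_deriv f g)"


section \<open>The operators of the linearised Kolmogorov flow\<close>

definition A_op :: "int \<Rightarrow> l2 \<Rightarrow> l2" where
  "A_op l f = weak_deriv (weak_deriv f) - (of_int l)\<^sup>2 *\<^sub>R f"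

definition bounded_multiplier :: "(real \<Rightarrow> complex) \<Rightarrow> bool" where
  "bounded_multiplier g \<longleftrightarrow> g \<in> borel_measurable torus \<and> bounded (g ` {0..2*pi})"

lift_definition mult_op :: "(real \<Rightarrow> complex) \<Rightarrow> l2 \<Rightarrow> l2" is
  "\<lambda>g f. if bounded_multiplier g then (\<lambda>x. g x * f x) else (\<lambda>x. 0)"
proof -
  fix g f f' assume ff: "ae_eq f f'"
  show "ae_eq (if bounded_multiplier g then (\<lambda>x. g x * f x) else (\<lambda>x. 0))
              (if bounded_multiplier g then (\<lambda>x. g x * f' x) else (\<lambda>x. 0))"
  proof (cases "bounded_multiplier g")
    case True
    then obtain B where "\<forall>x\<in>{0..2*pi}. cmod (g x) \<le> B"
      by (auto simp: bounded_multiplier_def bounded_iff)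
    moreover have "g \<in> borel_measurable torus"
      using True by (simp add: bounded_multiplier_def)
    ultimately show ?thesis
      using ff True sq_integrable_bounded_mult[of _ g B] by (auto simp: ae_eq_def)
  qed (simp add: ae_eq_def sq_integrable_zero)
qed

definition Lambda_op :: "int \<Rightarrow> l2 \<Rightarrow> l2" where
  "Lambda_op l f = mult_op (\<lambda>y. complex_of_real (sin y)) (f + inv_into W22 (A_op l) f)"

definition L_op :: "real \<Rightarrow> int \<Rightarrow> l2 \<Rightarrow> l2" where
  "L_op \<alpha> l f = A_op l f - scaleC (\<i> * of_real \<alpha> * of_int l) (Lambda_op l f)"

definition Y_space :: "int \<Rightarrow> l2 set" where
  "Y_space l = (if \<bar>l\<bar> = 1 then {f. l2_integral f = 0} else UNIV)"

definition Q_proj :: "int \<Rightarrow> l2 \<Rightarrow> l2" where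
  "Q_proj l = orth_proj (Y_space l)"

lemma cinner_add_left: "cinner (f + g) h = cinner f h + cinner g h"
  by transfer (simp add: ae_eq_def distrib_right integrable_mult_cnj)

lemma cinner_scaleC_left: "cinner (scaleC c f) h = c * cinner f h"
  by transfer (simp add: mult.assoc)

lemma cinner_diff_left: "cinner (f - g) h = cinner f h - cinner g h"
  by (simp add: minus_l2_def uminus_l2_def cinner_add_left cinner_scaleC_left)

lemma cinner_zero_left [simp]: "cinner 0 h = 0"
  using cinner_diff_left[of 0 0 h] by simp

lemma cinner_commute: "cinner f g = cnj (cinner g f)"
proof transfer
  fix f g :: "real \<Rightarrow> complex"
  have "cnj (LINT x|torus. g x * cnj (f x)) = (LINT x|torus. cnj (g x * cnj (f x)))"
    by (rule Bochner_Integration.integral_cnj[symmetric])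
  then show "(LINT x|torus. f x * cnj (g x)) = cnj (LINT x|torus. g x * cnj (f x))"
    by (simp add: mult.commute)
qed

lemma sq_integrable_const: "sq_integrable (\<lambda>x. c)"
proof -
  have "finite_measure torus"
    unfolding torus_def by (rule finite_measure_lebesgue_on) simp
  then show ?thesis
    by (simp add: sq_integrable_def finite_measure.integrable_const)
qed

lemma to_l2_const: "to_l2 (\<lambda>x. c) = scaleC c (to_l2 (\<lambda>x. 1))"
  by transfer (simp add: sq_integrable_const ae_eq_def)

lemma l2_integral_eq_cinner: "l2_integral f = cinner f (to_l2 (\<lambda>x. 1))"
  by transfer (simp add: sq_integrable_const)

lemma l2_integral_one: "l2_integral (to_l2 (\<lambda>x. 1)) = 2 * pi"
proof -
  have "measure torus (space torus) = 2 * pi"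
    by (simp add: torus_def measure_restrict_space)
  then show ?thesis
    by transfer (simp add: sq_integrable_const scaleR_conv_of_real)
qed

lemma Q_proj_eqI:
  assumes "p \<in> Y_space l" "\<And>h. h \<in> Y_space l \<Longrightarrow> cinner (f - p) h = 0"
  shows "Q_proj l f = p"
  unfolding Q_proj_def orth_proj_def
proof (rule the_equality)
  show "p \<in> Y_space l \<and> (\<forall>h\<in>Y_space l. cinner (f - p) h = 0)"
    using assms by blast
  fix q assume q: "q \<in> Y_space l \<and> (\<forall>h\<in>Y_space l. cinner (f - q) h = 0)"
  have Y: "q - p \<in> Y_space l"
    using q assms(1) by (auto simp: Y_space_def l2_integral_eq_cinner cinner_diff_left split: if_splits)
  have "cinner (q - p) (q - p) = cinner ((f - p) - (f - q)) (q - p)" by simp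
  also have "\<dots> = 0"
    using q Y assms(2) by (simp only: cinner_diff_left) simp
  finally have "inner (q - p) (q - p) = 0" by (simp add: inner_l2_def)
  then show "q = p" by simp
qed

lemma Q_proj_eq_self: "\<bar>l\<bar> \<noteq> 1 \<Longrightarrow> Q_proj l f = f"
  by (rule Q_proj_eqI) (auto simp: Y_space_def cinner_diff_left)

lemma Q_proj_eq_minus_mean:
  assumes "\<bar>l\<bar> = 1"
  shows "Q_proj l f = f - to_l2 (\<lambda>y. l2_integral f / (2 * pi))"
proof (rule Q_proj_eqI)
  let ?e = "to_l2 (\<lambda>x. 1)" and ?m = "l2_integral f / (2 * pi)"
  have "cinner ?e ?e = 2 * pi"
    using l2_integral_one by (simp add: l2_integral_eq_cinner)
  then have "cinner (to_l2 (\<lambda>y. ?m)) ?e = l2_integral f"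
    unfolding to_l2_const[of ?m] cinner_scaleC_left by simp
  then show "f - to_l2 (\<lambda>y. ?m) \<in> Y_space l"
    using assms by (simp add: Y_space_def l2_integral_eq_cinner cinner_diff_left)
  fix h assume "h \<in> Y_space l"
  then have "cinner ?e h = 0"
    using assms cinner_commute[of ?e h] by (simp add: Y_space_def l2_integral_eq_cinner)
  then show "cinner (f - (f - to_l2 (\<lambda>y. ?m))) h = 0"
    unfolding to_l2_const[of ?m] by (simp add: cinner_scaleC_left)
qed

end

theory Submission
  imports Defs
begin

text \<open>Put \<open>B = I + A\<^sup>-\<^sup>1\<close>, \<open>w = B u\<close> and \<open>\<psi> = A\<^sup>-\<^sup>1 u\<close>; the equation is \<open>A u - i b v = f\<close>
  with \<open>v = Q (sin w) - \<mu> u\<close> and \<open>\<mu> = \<lambda>/b\<close>. In the inner product \<open>\<langle>u, B u'\<rangle>\<close> the transport part is skew, so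
  the equation is dissipative (which gives invertibility by the method of continuity), and its imaginary
  part settles \<open>\<mu> > 1\<close>. For \<open>0 \<le> \<mu> \<le> 1\<close> the quadratic form
  \<open>Re \<langle>v, - cos w' + (3/2 sin - \<kappa>) w\<rangle>\<close> with suitable \<open>\<kappa> < 1\<close> controls
  \<open>(1 - \<mu>) \<bar>w\<bar>\<^sup>2 + \<bar>cos w\<bar>\<^sup>2 + \<bar>\<psi>'\<bar>\<^sup>2\<close> despite the nonlocal term. Testing the equation with this
  multiplier leaves the error \<open>\<bar>u''\<bar> \<bar>cos w'\<bar>\<close>. Here \<open>u''\<close> is bounded by testing with \<open>u''\<close>, and
  \<open>cos w'\<close> by testing with \<open>B (1 - sin B) u\<close>, which commutes with the transport part. If \<open>\<bar>f\<bar>\<close> were much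
  smaller than \<open>\<epsilon>\<^sup>-\<^sup>2 \<bar>u\<bar>\<close>, where \<open>\<epsilon>\<close> is the width of the critical layer, these bounds would contradict
  each other.\<close>

section \<open>Fourier uniqueness\<close>

text \<open>The three bounds reflect the shape of sin - \<mu> at its zeros. For \<mu> < 1 the slope
  there is comparable to \<delta> = sqrt (1 - \<mu>), and the balance 1/\<epsilon>^2 = |b| \<delta>
  \<epsilon> gives \<epsilon>^2 = |b|^(-2/3) (1 - \<mu>)^(-1/3). Once 1 - \<mu> drops below
  |b|^(-1/2), the two zeros share one layer around the maximum of the sine with \<delta> =
  \<epsilon> = |b|^(-1/4), and both rates agree at this threshold. The obstacle is the nonlocal
  part: multiplying by sine after \<open>B\<close> is not symmetric in L^2, and the pairing that
  repairs this controls \<open>w\<close> rather than \<open>u\<close>. Since \<open>B\<close> has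
  the symbol 1 - 1/(k^2 + l^2), \<open>u\<close> is recovered from \<open>w\<close> except for k = 0
  and |l| = 1, which is the mode that the space Y_l removes. The price is the mean \<open>p\<close>
  inside \<open>v\<close>, and a gap that comes from the Poincare inequality instead of from the
  size of l^2. The estimates use only a few identities between sine, cosine, the derivative and i.
  They are therefore derived in an abstract real inner product space; L^2 enters through Fourier
  coefficients. The numerical constants are not optimised.\<close>

lemma finite_measure_torus: "finite_measure torus"
  unfolding torus_def by (rule finite_measure_lebesgue_on) simp

lemma borel_measurable_torus_continuous:
  "continuous_on UNIV (g :: real \<Rightarrow> 'a::{metric_space,second_countable_topology}) \<Longrightarrow> g \<in> borel_measurable torus"
  unfolding torus_def
  by (rule measurable_restrict_space1) (metis borel_measurable_continuous_onI measurable_completion measurable_lborel2)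

lemma AE_torus_interior: "AE y in torus. 0 < y \<and> y < 2 * pi"
proof -
  have "AE y in lebesgue. y \<noteq> 0 \<and> y \<noteq> (2 * pi :: real)"
    by (intro AE_conjI AE_completion) (auto intro: AE_lborel_singleton)
  then have "AE y in lebesgue. y \<in> {0..2*pi} \<longrightarrow> 0 < y \<and> y < 2 * pi"
    by eventually_elim auto
  then show ?thesis
    unfolding torus_def by (subst AE_restrict_space_iff) auto
qed

inductive trig_poly :: "(real \<Rightarrow> complex) \<Rightarrow> bool" where
  monomial: "trig_poly (\<lambda>y. c * cis (of_int k * y))"
| add: "trig_poly p \<Longrightarrow> trig_poly q \<Longrightarrow> trig_poly (\<lambda>y. p y + q y)"

lemma trig_poly_mult_monomial: "trig_poly p \<Longrightarrow> trig_poly (\<lambda>y. p y * (c * cis (of_int k * y)))"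
proof (induction rule: trig_poly.induct)
  case (monomial d j)
  have "(\<lambda>y. d * cis (of_int j * y) * (c * cis (of_int k * y))) = (\<lambda>y. (d * c) * cis (of_int (j + k) * y))"
    by (auto simp: cis_mult[symmetric] algebra_simps)
  then show ?case by (metis trig_poly.monomial)
next
  case (add p q)
  then show ?case by (simp add: distrib_right trig_poly.add)
qed

lemma trig_poly_mult: "trig_poly q \<Longrightarrow> trig_poly p \<Longrightarrow> trig_poly (\<lambda>y. p y * q y)"
proof (induction rule: trig_poly.induct)
  case (monomial c k)
  then show ?case by (rule trig_poly_mult_monomial)
next
  case (add p q)
  then show ?case by (simp add: distrib_left trig_poly.add)
qed

lemma trig_poly_const: "trig_poly (\<lambda>y. c)"
  using trig_poly.monomial[of c 0] by simp

lemma trig_poly_cos: "trig_poly (\<lambda>y. of_real (cos y))"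
proof -
  have "(\<lambda>y. of_real (cos y)) = (\<lambda>y. (1/2) * cis (of_int 1 * y) + (1/2) * cis (of_int (-1) * y))"
    by (auto simp: complex_eq_iff)
  then show ?thesis by (metis trig_poly.intros)
qed

lemma trig_poly_sin: "trig_poly (\<lambda>y. of_real (sin y))"
proof -
  have "(\<lambda>y. of_real (sin y)) = (\<lambda>y. (-\<i>/2) * cis (of_int 1 * y) + (\<i>/2) * cis (of_int (-1) * y))"
    by (auto simp: complex_eq_iff)
  then show ?thesis by (metis trig_poly.intros)
qed

text \<open>A real-linear functional of \<open>cis y\<close> is a combination of cos y and sin y,
  and sums and products stay trigonometric. Thus polynomials in the plane, which are dense by
  Stone-Weierstrass, restrict to trigonometric polynomials on the circle.\<close>

lemma trig_poly_real_polynomial: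
  "real_polynomial_function p \<Longrightarrow> trig_poly (\<lambda>y. of_real (p (cis y)))"
proof (induction rule: real_polynomial_function.induct)
  case (linear f)
  interpret bounded_linear f by fact
  have "f (cis y) = cos y * f 1 + sin y * f \<i>" for y
  proof -
    have "cis y = cos y *\<^sub>R 1 + sin y *\<^sub>R \<i>" by (auto simp: complex_eq_iff)
    then show ?thesis by (simp only: add scaleR) simp
  qed
  then show ?case
    using trig_poly.add[OF trig_poly_mult[OF trig_poly_const trig_poly_cos]
        trig_poly_mult[OF trig_poly_const trig_poly_sin]] by simp
qed (auto intro: trig_poly_const trig_poly.add trig_poly_mult)

lemma trig_poly_bounded: "trig_poly p \<Longrightarrow> \<exists>B. \<forall>y. cmod (p y) \<le> B"
proof (induction rule: trig_poly.induct)
  case (monomial c k)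
  then show ?case by (auto simp: norm_mult)
next
  case (add p q)
  then obtain A B where "\<forall>y. cmod (p y) \<le> A" "\<forall>y. cmod (q y) \<le> B" by auto
  then show ?case by (meson norm_triangle_mono)
qed

lemma trig_poly_measurable: "trig_poly p \<Longrightarrow> p \<in> borel_measurable torus"
proof (induction rule: trig_poly.induct)
  case (monomial c k)
  then show ?case by (intro borel_measurable_torus_continuous continuous_intros)
qed simp

lemma integrable_torus_bounded_mult:
  fixes f g :: "real \<Rightarrow> complex"
  assumes f: "integrable torus f" and g: "g \<in> borel_measurable torus" and B: "\<And>y. cmod (g y) \<le> B"
  shows "integrable torus (\<lambda>y. f y * g y)"
proof (rule Bochner_Integration.integrable_bound)
  show "integrable torus (\<lambda>y. B * cmod (f y))" using f by simp
  show "(\<lambda>y. f y * g y) \<in> borel_measurable torus" using f g by simp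
  show "AE y in torus. norm (f y * g y) \<le> norm (B * cmod (f y))"
  proof (rule AE_I2)
    fix y show "norm (f y * g y) \<le> norm (B * cmod (f y))"
      using mult_right_mono[OF B[of y], of "cmod (f y)"] order_trans[OF norm_ge_zero B[of y]]
      by (simp add: norm_mult mult.commute abs_mult)
  qed
qed

lemma integral_trig_poly_zero:
  assumes f: "integrable torus f" and z: "\<And>k::int. (LINT y|torus. f y * cis (of_int k * y)) = 0"
  shows "trig_poly p \<Longrightarrow> (LINT y|torus. f y * p y) = 0"
proof (induction rule: trig_poly.induct)
  case (monomial c k)
  have "(LINT y|torus. f y * (c * cis (of_int k * y))) = (LINT y|torus. c * (f y * cis (of_int k * y)))"
    by (simp add: algebra_simps)
  then show ?case using z[of k] by simp
next
  case (add p q)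
  have "integrable torus (\<lambda>y. f y * p y)" "integrable torus (\<lambda>y. f y * q y)"
    using trig_poly_bounded trig_poly_measurable integrable_torus_bounded_mult[OF f] add by metis+
  then show ?case using add by (simp add: distrib_left)
qed

text \<open>Approximating \<open>g\<close> within \<open>e\<close> by a polynomial changes the
  integral by at most \<open>e\<close> times the L^1 norm of \<open>f\<close>. Taking
  \<open>g\<close> on the plane and composing with \<open>cis\<close> encodes periodicity without a
  side condition.\<close>

lemma integral_circle_continuous_zero:
  fixes g :: "complex \<Rightarrow> real"
  assumes f: "integrable torus f" and z: "\<And>k::int. (LINT y|torus. f y * cis (of_int k * y)) = 0"
    and g: "continuous_on UNIV g"
  shows "(LINT y|torus. f y * of_real (g (cis y))) = 0"
proof -
  have gs: "continuous_on (sphere 0 1) g" using g continuous_on_subset by blast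
  have [measurable]: "f \<in> borel_measurable torus" using f by auto
  obtain B where B: "\<forall>x\<in>sphere 0 1. \<bar>g x\<bar> \<le> B"
    using compact_imp_bounded[OF compact_continuous_image[OF gs compact_sphere]]
    by (fastforce simp: bounded_iff)
  have gm: "(\<lambda>y. complex_of_real (g (cis y))) \<in> borel_measurable torus"
    by (intro borel_measurable_torus_continuous continuous_intros continuous_on_compose2[OF g]) auto
  have gi: "integrable torus (\<lambda>y. f y * of_real (g (cis y)))"
    by (rule integrable_torus_bounded_mult[OF f gm, of B]) (simp add: B)
  have "cmod (LINT y|torus. f y * of_real (g (cis y))) \<le> e * (LINT y|torus. cmod (f y))" if e: "e > 0" for e
  proof -
    obtain p where p: "real_polynomial_function p" "\<And>x. x \<in> sphere 0 1 \<Longrightarrow> \<bar>g x - p x\<bar> < e"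
      using Stone_Weierstrass_real_polynomial_function[OF compact_sphere gs e] by metis
    have tp: "trig_poly (\<lambda>y. of_real (p (cis y)))" by (rule trig_poly_real_polynomial[OF p(1)])
    obtain A where A: "\<And>y. cmod (of_real (p (cis y))) \<le> A" using trig_poly_bounded[OF tp] by auto
    have pint: "integrable torus (\<lambda>y. f y * of_real (p (cis y)))"
      by (rule integrable_torus_bounded_mult[OF f trig_poly_measurable[OF tp] A])
    have "(LINT y|torus. f y * of_real (g (cis y))) = (LINT y|torus. f y * of_real (g (cis y)) - f y * of_real (p (cis y)))"
      using integral_trig_poly_zero[OF f z tp] gi pint by simp
    also have "cmod \<dots> \<le> (LINT y|torus. e * cmod (f y))"
    proof (rule Bochner_Integration.integral_norm_bound_integral)
      show "integrable torus (\<lambda>y. f y * of_real (g (cis y)) - f y * of_real (p (cis y)))"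
        using gi pint by simp
      show "integrable torus (\<lambda>y. e * cmod (f y))" using f by simp
      fix y
      have "cmod (of_real (g (cis y)) - of_real (p (cis y))) \<le> e"
        using p(2)[of "cis y"] by (simp flip: of_real_diff)
      then have "cmod (f y) * cmod (of_real (g (cis y)) - of_real (p (cis y))) \<le> cmod (f y) * e"
        by (rule mult_left_mono) simp
      then show "cmod (f y * of_real (g (cis y)) - f y * of_real (p (cis y))) \<le> e * cmod (f y)"
        by (simp add: norm_mult mult.commute flip: right_diff_distrib)
    qed
    finally show ?thesis by simp
  qed
  note * = this
  let ?I = "LINT y|torus. cmod (f y)"
  have "?I \<ge> 0" by simp
  have "cmod (LINT y|torus. f y * of_real (g (cis y))) \<le> 0"
  proof (rule field_le_epsilon)
    fix e :: real assume "e > 0"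
    \<comment> \<open>\<open>?I\<close> may be zero, hence the denominator
      \<open>?I + 1\<close>.\<close>
    then have "cmod (LINT y|torus. f y * of_real (g (cis y))) \<le> e / (?I + 1) * ?I"
      using \<open>?I \<ge> 0\<close> by (intro *) (simp add: add_nonneg_pos)
    also have "\<dots> = e * (?I / (?I + 1))" by simp
    also have "\<dots> \<le> e * 1" using \<open>?I \<ge> 0\<close> \<open>e > 0\<close> by (intro mult_left_mono) (simp_all add: divide_le_eq_1_pos[OF add_nonneg_pos[OF \<open>?I \<ge> 0\<close> zero_less_one]])
    finally show "cmod (LINT y|torus. f y * of_real (g (cis y))) \<le> 0 + e" by simp
  qed
  then show ?thesis by simp
qed

lemma set_integral_closed_zero:
  assumes f: "integrable torus f" and z: "\<And>k::int. (LINT y|torus. f y * cis (of_int k * y)) = 0"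
    and K: "closed K" "K \<subseteq> {0..2*pi}"
  shows "(LINT y:K|torus. f y) = 0"
proof (cases "K = {}")
  case True
  then show ?thesis by (simp add: set_lebesgue_integral_def)
next
  case False
  have [measurable]: "f \<in> borel_measurable torus" using f by auto
  have cK: "compact (cis ` K)"
    using K by (intro compact_continuous_image continuous_intros) (auto intro: compact_Int_closed simp: compact_eq_bounded_closed bounded_subset[OF bounded_closed_interval])
  have Ks: "K \<in> sets torus"
    using K by (auto simp: torus_def sets_restrict_space image_iff intro!: bexI[of _ K])
  define g where "g n x = max 0 (1 - real n * infdist x (cis ` K))" for n x
  have gc: "continuous_on UNIV (g n)" for n
    unfolding g_def by (intro continuous_intros)
  have lim: "(\<lambda>n. LINT y|torus. f y * of_real (g n (cis y))) \<longlonglongrightarrow> (LINT y|torus. indicator K y *\<^sub>R f y)"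
  proof (rule integral_dominated_convergence)
    show "(\<lambda>x. indicat_real K x *\<^sub>R f x) \<in> borel_measurable torus"
      using Ks by simp
    show "(\<lambda>x. f x * complex_of_real (g n (cis x))) \<in> borel_measurable torus" for n
      by (intro borel_measurable_times[OF \<open>f \<in> borel_measurable torus\<close>] borel_measurable_torus_continuous
          continuous_intros continuous_on_compose2[OF gc]) auto
    show "integrable torus (\<lambda>y. cmod (f y))" using f by simp
    show "AE x in torus. cmod (f x * complex_of_real (g n (cis x))) \<le> cmod (f x)" for n
      by (rule AE_I2) (auto simp: norm_mult g_def infdist_nonneg intro!: mult_left_le)
    show "AE y in torus. (\<lambda>n. f y * of_real (g n (cis y))) \<longlonglongrightarrow> indicat_real K y *\<^sub>R f y"
      using AE_torus_interior
    proof eventually_elim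
      case (elim y)
      have "(\<lambda>n. g n (cis y)) \<longlonglongrightarrow> indicat_real K y"
      proof (cases "y \<in> K")
        case True
        then show ?thesis by (simp add: g_def)
      next
        case False
        have "cis y \<notin> cis ` K"
        proof
          assume "cis y \<in> cis ` K"
          then obtain x where x: "x \<in> K" "cis y = cis x" by auto
          then have "sin y = sin x \<and> cos y = cos x" by (simp add: complex_eq_iff)
          then obtain n :: int where n: "y = x + 2 * pi * n"
            unfolding sin_cos_eq_iff by blast
          have x02: "0 \<le> x" "x \<le> 2 * pi" using x K by auto
          \<comment> \<open>\<open>y\<close> is interior and \<open>x\<close> lies in the closed
            period, so they differ by strictly less than one period.\<close>
          have "2 * pi * real_of_int n < 2 * pi * 1" "2 * pi * (-1) < 2 * pi * real_of_int n"
            using n elim x02 by linarith+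
          then have "real_of_int n < 1" "-1 < real_of_int n"
            by (simp_all only: mult_less_cancel_left_pos[OF pi_gt_zero[THEN mult_pos_pos[OF zero_less_numeral]]])
          then have "n = 0" by linarith
          then show False using n x False by simp
        qed
        then have d: "infdist (cis y) (cis ` K) > 0"
          using cK \<open>K \<noteq> {}\<close> infdist_pos_not_in_closed compact_imp_closed by blast
        have "eventually (\<lambda>n. g n (cis y) = 0) sequentially"
        proof -
          obtain N where N: "real N * infdist (cis y) (cis ` K) > 1"
            using d reals_Archimedean3 by blast
          show ?thesis
          proof (rule eventually_sequentiallyI[of N])
            fix n assume "N \<le> n"
            then have "real N * infdist (cis y) (cis ` K) \<le> real n * infdist (cis y) (cis ` K)"
              using d by (intro mult_right_mono) auto
            then show "g n (cis y) = 0" using N by (simp add: g_def)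
          qed
        qed
        then show ?thesis using False by (simp add: tendsto_eventually)
      qed
      then have "(\<lambda>n. f y * of_real (g n (cis y))) \<longlonglongrightarrow> f y * of_real (indicat_real K y)"
        by (intro tendsto_intros)
      then show ?case by (simp add: scaleR_conv_of_real mult.commute)
    qed
  qed
  have "(\<lambda>n::nat. 0) \<longlonglongrightarrow> (LINT y|torus. indicator K y *\<^sub>R f y)"
    using lim by (simp only: integral_circle_continuous_zero[OF f z gc])
  then show ?thesis
    unfolding set_lebesgue_integral_def LIMSEQ_const_iff by (rule sym)
qed

text \<open>Up to a null set a measurable set is a countable union of compact sets, so its integral
  is a limit of integrals over closed sets, all of which vanish. A density with zero integral over
  every measurable set is zero almost everywhere.\<close>

lemma torus_fourier_unique:
  assumes f: "integrable torus f" and z: "\<And>k::int. (LINT y|torus. f y * cis (of_int k * y)) = 0"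
  shows "AE y in torus. f y = 0"
proof (rule sigma_finite_measure.density_zero[OF _ f])
  show "sigma_finite_measure torus"
    using finite_measure_torus finite_measure.axioms(1) by blast
next
  fix A assume "A \<in> sets torus"
  then have A: "A \<in> sets lebesgue" "A \<subseteq> {0..2*pi}"
    by (auto simp: torus_def sets_restrict_space)
  have [measurable]: "f \<in> borel_measurable torus" using f by auto
  obtain C T where CT: "fsigma C" "T \<in> null_sets lebesgue" "C \<union> T = A"
    using lebesgue_set_almost_fsigma[OF A(1)] by (metis)
  obtain F :: "nat \<Rightarrow> real set" where F: "range F \<subseteq> Collect compact" "C = \<Union>(range F)"
    using CT(1) fsigma_Union_compact by metis
  define G where "G n = (\<Union>i\<le>n. F i)" for n
  have Fc: "closed (F i)" for i using F(1) by (auto intro: compact_imp_closed)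
  have G: "closed (G n)" "G n \<subseteq> {0..2*pi}" for n
    using Fc F(2) CT(3) A(2) by (auto simp: G_def)
  have Gs: "G n \<in> sets torus" for n
    using G by (auto simp: torus_def sets_restrict_space image_iff intro!: bexI[of _ "G n"])
  have lim: "(\<lambda>n. LINT y|torus. indicator (G n) y *\<^sub>R f y) \<longlonglongrightarrow> (LINT y|torus. indicator A y *\<^sub>R f y)"
  proof (rule integral_dominated_convergence)
    show "(\<lambda>x. indicat_real A x *\<^sub>R f x) \<in> borel_measurable torus"
      using \<open>A \<in> sets torus\<close> by simp
    show "(\<lambda>x. indicat_real (G n) x *\<^sub>R f x) \<in> borel_measurable torus" for n
      using Gs by simp
    show "integrable torus (\<lambda>y. cmod (f y))" using f by simp
    show "AE x in torus. cmod (indicat_real (G n) x *\<^sub>R f x) \<le> cmod (f x)" for n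
      by (rule AE_I2) (auto simp: indicator_def)
    have "AE y in lebesgue. y \<notin> T" using CT(2) by (rule AE_not_in)
    then have "AE y in torus. y \<notin> T"
      unfolding torus_def by (subst AE_restrict_space_iff) auto
    then show "AE y in torus. (\<lambda>n. indicat_real (G n) y *\<^sub>R f y) \<longlonglongrightarrow> indicat_real A y *\<^sub>R f y"
    proof eventually_elim
      case (elim y)
      have "eventually (\<lambda>n. indicat_real (G n) y = indicat_real A y) sequentially"
      proof (cases "y \<in> A")
        case True
        then obtain i where "y \<in> F i" using elim CT(3) F(2) by auto
        then show ?thesis using True
          by (intro eventually_sequentiallyI[of i]) (auto simp: G_def indicator_def)
      next
        case False
        then show ?thesis using CT(3) F(2) by (auto simp: G_def indicator_def)
      qed
      then show ?case by (intro tendsto_scaleR tendsto_eventually tendsto_const)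
    qed
  qed
  have "(\<lambda>n::nat. 0) \<longlonglongrightarrow> (LINT y|torus. indicator A y *\<^sub>R f y)"
    using lim by (simp only: set_integral_closed_zero[OF f z G, unfolded set_lebesgue_integral_def])
  then show "(LINT y:A|torus. f y) = 0"
    unfolding set_lebesgue_integral_def LIMSEQ_const_iff by (rule sym)
qed

section \<open>Completeness\<close>

lemma l2_exhaust: obtains g where "sq_integrable g" "f = to_l2 g"
proof -
  have "\<exists>g. sq_integrable g \<and> f = to_l2 g"
    by transfer (auto simp: ae_eq_def)
  then show thesis using that by blast
qed

lemma to_l2_add: "sq_integrable f \<Longrightarrow> sq_integrable g \<Longrightarrow> to_l2 (\<lambda>x. f x + g x) = to_l2 f + to_l2 g"
  by transfer (auto simp: ae_eq_def sq_integrable_add)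

lemma to_l2_scaleC: "sq_integrable f \<Longrightarrow> to_l2 (\<lambda>x. c * f x) = scaleC c (to_l2 f)"
  by transfer (auto simp: ae_eq_def sq_integrable_cmult)

lemma to_l2_diff: "sq_integrable f \<Longrightarrow> sq_integrable g \<Longrightarrow> to_l2 (\<lambda>x. f x - g x) = to_l2 f - to_l2 g"
  using to_l2_add[of f "\<lambda>x. - 1 * g x"] sq_integrable_cmult[of g "-1"] to_l2_scaleC[of g "-1"]
  by (simp add: minus_l2_def uminus_l2_def)

lemma sq_integrable_diff: "sq_integrable f \<Longrightarrow> sq_integrable g \<Longrightarrow> sq_integrable (\<lambda>x. f x - g x)"
  using sq_integrable_add[of f "\<lambda>x. - 1 * g x"] sq_integrable_cmult[of g "-1"] by simp

lemma cinner_to_l2: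
  "sq_integrable f \<Longrightarrow> sq_integrable g \<Longrightarrow> cinner (to_l2 f) (to_l2 g) = (LINT x|torus. f x * cnj (g x))"
  by transfer simp

lemma norm_to_l2_square: "sq_integrable f \<Longrightarrow> (norm (to_l2 f))\<^sup>2 = (LINT x|torus. (cmod (f x))\<^sup>2)"
  by (simp only: power2_norm_eq_inner inner_l2_def cinner_to_l2 complex_norm_square[symmetric]
      integral_complex_of_real Re_complex_of_real)

lemma to_l2_eq_iff: "sq_integrable f \<Longrightarrow> sq_integrable g \<Longrightarrow> to_l2 f = to_l2 g \<longleftrightarrow> (AE x in torus. f x = g x)"
  by transfer (simp add: ae_eq_def)

lemma nn_integral_norm_to_l2:
  assumes "sq_integrable f"
  shows "(\<integral>\<^sup>+x. ennreal ((cmod (f x))\<^sup>2) \<partial>torus) = ennreal ((norm (to_l2 f))\<^sup>2)"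
  using assms nn_integral_eq_integral[of torus "\<lambda>x. (cmod (f x))\<^sup>2"]
  by (simp add: norm_to_l2_square sq_integrable_def)

lemma sq_integrable_iff_nn_integral:
  "sq_integrable f \<longleftrightarrow> f \<in> borel_measurable torus \<and> (\<integral>\<^sup>+x. ennreal ((cmod (f x))\<^sup>2) \<partial>torus) < \<infinity>"
  by (auto simp: sq_integrable_def integrable_iff_bounded)

lemma sq_integrable_sum: "(\<And>i. i \<in> A \<Longrightarrow> sq_integrable (f i)) \<Longrightarrow> sq_integrable (\<lambda>x. \<Sum>i\<in>A. f i x)"
  by (induction A rule: infinite_finite_induct) (auto intro: sq_integrable_add sq_integrable_zero)

lemma sq_integrable_abs: "sq_integrable f \<Longrightarrow> sq_integrable (\<lambda>x. of_real (cmod (f x)))"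
  by (auto simp: sq_integrable_def)

lemma norm_to_l2_abs: "sq_integrable f \<Longrightarrow> norm (to_l2 (\<lambda>x. of_real (cmod (f x)))) = norm (to_l2 f)"
  by (rule power2_eq_imp_eq) (simp_all add: norm_to_l2_square sq_integrable_abs)

lemma to_l2_sum: "finite A \<Longrightarrow> (\<And>i. i \<in> A \<Longrightarrow> sq_integrable (f i)) \<Longrightarrow> to_l2 (\<lambda>x. \<Sum>i\<in>A. f i x) = (\<Sum>i\<in>A. to_l2 (f i))"
proof (induction A rule: finite_induct)
  case empty
  have "to_l2 (\<lambda>x. 0) = 0" by transfer (simp add: ae_eq_def sq_integrable_zero)
  then show ?case by simp
qed (simp add: to_l2_add sq_integrable_sum)

text \<open>A rapidly converging subsequence converges almost everywhere, because the sum of the absolute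
  values of its increments is square-integrable; by Fatou's lemma it also converges in norm.\<close>

lemma l2_Cauchy_fast_limit:
  fixes h :: "nat \<Rightarrow> real \<Rightarrow> complex"
  assumes h: "\<And>n. sq_integrable (h n)"
    and fast: "\<And>n. norm (to_l2 (h (Suc n)) - to_l2 (h n)) \<le> (1/2)^n"
  shows "\<exists>g. sq_integrable g \<and> (\<lambda>n. to_l2 (h n)) \<longlonglongrightarrow> to_l2 g"
proof -
  have [measurable]: "h n \<in> borel_measurable torus" for n using h by (simp add: sq_integrable_def)
  define d where "d n x = h (Suc n) x - h n x" for n x
  have d: "sq_integrable (d n)" "norm (to_l2 (d n)) \<le> (1/2)^n" for n
    using h fast unfolding d_def by (auto intro: sq_integrable_diff simp: to_l2_diff)
  have [measurable]: "d n \<in> borel_measurable torus" for n using d by (simp add: sq_integrable_def)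
  define G where "G n x = (\<Sum>i<n. cmod (d i x))" for n x
  have Gsq: "sq_integrable (\<lambda>x. of_real (G n x))" for n
    unfolding G_def of_real_sum using d by (intro sq_integrable_sum sq_integrable_abs) auto
  have geo: "(\<Sum>i<n. (1/2::real)^i) \<le> 2" for n
    by (subst geometric_sum) (auto simp: field_simps)
  have Gn: "norm (to_l2 (\<lambda>x. of_real (G n x))) \<le> 2" for n
  proof -
    have "to_l2 (\<lambda>x. of_real (G n x)) = (\<Sum>i<n. to_l2 (\<lambda>x. of_real (cmod (d i x))))"
      unfolding G_def of_real_sum using d by (intro to_l2_sum sq_integrable_abs) auto
    also have "norm \<dots> \<le> (\<Sum>i<n. (1/2)^i)"
      using d by (intro order_trans[OF norm_sum] sum_mono) (simp add: norm_to_l2_abs)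
    finally show ?thesis using geo[of n] by linarith
  qed
  have [measurable]: "(\<lambda>x. G n x) \<in> borel_measurable torus" for n unfolding G_def by measurable
  have Gnn: "(\<integral>\<^sup>+x. ennreal ((G n x)\<^sup>2) \<partial>torus) \<le> ennreal 4" for n
  proof -
    have "(norm (to_l2 (\<lambda>x. of_real (G n x))))\<^sup>2 \<le> 2\<^sup>2" using Gn by (intro power_mono) auto
    then have "ennreal ((norm (to_l2 (\<lambda>x. of_real (G n x))))\<^sup>2) \<le> ennreal 4"
      by (intro ennreal_leI) simp
    then show ?thesis using nn_integral_norm_to_l2[OF Gsq[of n]] by simp
  qed
  have G0: "0 \<le> G n x" for n x unfolding G_def by (simp add: sum_nonneg)
  have Ginc: "incseq (\<lambda>n x. ennreal ((G n x)\<^sup>2))"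
    unfolding incseq_def le_fun_def
    by (auto intro!: ennreal_leI power_mono G0) (auto simp: G_def intro!: sum_mono2)
  have "(\<integral>\<^sup>+x. (SUP n. ennreal ((G n x)\<^sup>2)) \<partial>torus) = (SUP n. \<integral>\<^sup>+x. ennreal ((G n x)\<^sup>2) \<partial>torus)"
    by (rule nn_integral_monotone_convergence_SUP[OF Ginc]) measurable
  also have "\<dots> \<le> ennreal 4" using Gnn by (rule SUP_least)
  finally have "(\<integral>\<^sup>+x. (SUP n. ennreal ((G n x)\<^sup>2)) \<partial>torus) \<noteq> \<infinity>"
    by (metis ennreal_less_top infinity_ennreal_def leD)
  then have AEfin: "AE x in torus. (SUP n. ennreal ((G n x)\<^sup>2)) \<noteq> \<infinity>"
    by (intro nn_integral_noteq_infinite) measurable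
  \<comment> \<open>On the null set of divergence \<open>lim\<close> is an unspecified value;
    measurability holds everywhere and convergence is claimed only almost everywhere.\<close>
  define g where "g x = lim (\<lambda>n. h n x)" for x
  have [measurable]: "g \<in> borel_measurable torus"
    unfolding g_def by (rule borel_measurable_lim_metric) simp
  have conv: "AE x in torus. (\<lambda>n. h n x) \<longlonglongrightarrow> g x"
    using AEfin
  proof eventually_elim
    case (elim x)
    then obtain r where r: "0 \<le> r" "(SUP n. ennreal ((G n x)\<^sup>2)) = ennreal r"
      by (metis ennreal_cases infinity_ennreal_def)
    have "(G n x)\<^sup>2 \<le> r" for n
    proof -
      have "ennreal ((G n x)\<^sup>2) \<le> ennreal r" unfolding r(2)[symmetric] by (rule SUP_upper) simp
      then show ?thesis using r by simp
    qed
    then have "G n x \<le> sqrt r" for n by (simp add: real_le_rsqrt)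
    then have "summable (\<lambda>n. norm (d n x))"
      by (intro summableI_nonneg_bounded) (auto simp: G_def)
    then have "summable (\<lambda>n. d n x)" by (rule summable_norm_cancel)
    then have "convergent (\<lambda>n. h 0 x + (\<Sum>i<n. d i x))"
      by (intro convergent_add convergent_const) (simp add: summable_iff_convergent)
    moreover have "h 0 x + (\<Sum>i<n. d i x) = h n x" for n
      using sum_lessThan_telescope[of "\<lambda>i. h i x" n] by (simp add: d_def)
    ultimately show ?case by (simp add: g_def convergent_LIMSEQ_iff)
  qed
  have dist: "norm (to_l2 (h (n + m)) - to_l2 (h m)) \<le> 2 * (1/2)^m" for n m
  proof -
    have "to_l2 (h (n + m)) - to_l2 (h m) = (\<Sum>i<n. to_l2 (h (Suc i + m)) - to_l2 (h (i + m)))"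
      using sum_lessThan_telescope[of "\<lambda>i. to_l2 (h (i + m))" n] by simp
    also have "norm \<dots> \<le> (\<Sum>i<n. (1/2)^(i + m))"
      by (intro order_trans[OF norm_sum] sum_mono) (use fast in simp)
    also have "\<dots> = (1/2)^m * (\<Sum>i<n. (1/2)^i)" by (simp add: power_add sum_distrib_left mult.commute)
    also have "\<dots> \<le> (1/2)^m * 2" using geo by (intro mult_left_mono) auto
    finally show ?thesis by (simp add: mult.commute)
  qed
  have Fatou: "(\<integral>\<^sup>+x. ennreal ((cmod (g x - h m x))\<^sup>2) \<partial>torus) \<le> ennreal ((2 * (1/2)^m)\<^sup>2)" for m
  proof -
    have "(\<integral>\<^sup>+x. ennreal ((cmod (g x - h m x))\<^sup>2) \<partial>torus) =
        (\<integral>\<^sup>+x. liminf (\<lambda>n. ennreal ((cmod (h (n + m) x - h m x))\<^sup>2)) \<partial>torus)"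
    proof (rule nn_integral_cong_AE, use conv in eventually_elim)
      case (elim x)
      have "(\<lambda>n. ennreal ((cmod (h (n + m) x - h m x))\<^sup>2)) \<longlonglongrightarrow> ennreal ((cmod (g x - h m x))\<^sup>2)"
        by (intro tendsto_intros tendsto_ennrealI LIMSEQ_ignore_initial_segment elim)
      then show ?case by (rule lim_imp_Liminf[OF sequentially_bot, symmetric])
    qed
    also have "\<dots> \<le> liminf (\<lambda>n. \<integral>\<^sup>+x. ennreal ((cmod (h (n + m) x - h m x))\<^sup>2) \<partial>torus)"
      by (rule nn_integral_liminf) measurable
    also have "\<dots> \<le> liminf (\<lambda>n. ennreal ((2 * (1/2)^m)\<^sup>2))"
    proof (intro Liminf_mono always_eventually allI)
      fix n
      have "(\<integral>\<^sup>+x. ennreal ((cmod (h (n + m) x - h m x))\<^sup>2) \<partial>torus) = ennreal ((norm (to_l2 (h (n + m)) - to_l2 (h m)))\<^sup>2)"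
        using nn_integral_norm_to_l2[OF sq_integrable_diff[OF h h]] by (simp add: to_l2_diff h)
      also have "\<dots> \<le> ennreal ((2 * (1/2)^m)\<^sup>2)"
        by (intro ennreal_leI power_mono dist) simp
      finally show "(\<integral>\<^sup>+x. ennreal ((cmod (h (n + m) x - h m x))\<^sup>2) \<partial>torus) \<le> ennreal ((2 * (1/2)^m)\<^sup>2)" .
    qed
    also have "\<dots> = ennreal ((2 * (1/2)^m)\<^sup>2)" by (simp add: Liminf_const)
    finally show ?thesis .
  qed
  have sgh: "sq_integrable (\<lambda>x. g x - h m x)" for m
    using Fatou[of m] by (auto simp: sq_integrable_iff_nn_integral intro: le_less_trans[OF _ ennreal_less_top])
  have sg: "sq_integrable g"
    using sq_integrable_add[OF sgh[of 0] h[of 0]] by simp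
  have "norm (to_l2 g - to_l2 (h m)) \<le> 2 * (1/2)^m" for m
  proof -
    have "ennreal ((norm (to_l2 g - to_l2 (h m)))\<^sup>2) \<le> ennreal ((2 * (1/2)^m)\<^sup>2)"
      using Fatou[of m] nn_integral_norm_to_l2[OF sgh[of m]] by (simp add: to_l2_diff sg h)
    then have "(norm (to_l2 g - to_l2 (h m)))\<^sup>2 \<le> (2 * (1/2)^m)\<^sup>2"
      by (subst (asm) ennreal_le_iff) auto
    then show ?thesis by (rule power2_le_imp_le) simp
  qed
  then have "norm (to_l2 (h m) - to_l2 g) \<le> 2 * (1/2) ^ m" for m
    by (metis norm_minus_commute)
  moreover have "(\<lambda>m. 2 * (1/2::real)^m) \<longlonglongrightarrow> 0"
    by (intro tendsto_mult_right_zero LIMSEQ_power_zero) simp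
  ultimately have "(\<lambda>m. to_l2 (h m) - to_l2 g) \<longlonglongrightarrow> 0"
    by (intro Lim_null_comparison[of "\<lambda>m. to_l2 (h m) - to_l2 g"] always_eventually allI)
  then have "(\<lambda>m. to_l2 (h m)) \<longlonglongrightarrow> to_l2 g"
    by (rule LIM_zero_cancel)
  then show ?thesis using sg by blast
qed

lemma l2_Cauchy_convergent:
  fixes X :: "nat \<Rightarrow> l2"
  assumes "Cauchy X"
  shows "convergent X"
proof -
  have "\<exists>M. \<forall>m\<ge>M. \<forall>n\<ge>M. norm (X m - X n) < (1/2)^j" for j :: nat
    by (rule CauchyD[OF assms]) simp
  then obtain M where M: "\<And>j m n. m \<ge> M j \<Longrightarrow> n \<ge> M j \<Longrightarrow> norm (X m - X n) < (1/2)^j"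
    by metis
  \<comment> \<open>Partial sums make the index both monotone and at least \<open>M n\<close>, so
    that \<open>r n\<close> and \<open>r (Suc n)\<close> lie beyond \<open>M n\<close>
    together.\<close>
  define r where "r n = (\<Sum>i\<le>n. M i)" for n
  have r: "r n \<ge> M n" for n unfolding r_def by (rule member_le_sum) auto
  have r': "r (Suc n) \<ge> M n" for n
    using r[of n] by (simp add: r_def)
  have "\<exists>g. sq_integrable g \<and> X (r n) = to_l2 g" for n
    by (rule l2_exhaust[of "X (r n)"]) blast
  then obtain h where h: "\<And>n. sq_integrable (h n)" "\<And>n. X (r n) = to_l2 (h n)"
    by metis
  have "norm (to_l2 (h (Suc n)) - to_l2 (h n)) \<le> (1/2)^n" for n
    using M[OF r' r, of n] by (simp only: h less_imp_le)
  then obtain g where g: "(\<lambda>n. X (r n)) \<longlonglongrightarrow> to_l2 g"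
    using l2_Cauchy_fast_limit[of h] h by auto
  have "X \<longlonglongrightarrow> to_l2 g"
  proof (rule metric_LIMSEQ_I)
    fix e :: real assume "e > 0"
    obtain j where j: "(1/2)^j < e / 2"
      using real_arch_pow_inv[of "e/2" "1/2"] \<open>e > 0\<close> by auto
    obtain N where N: "\<And>n. n \<ge> N \<Longrightarrow> dist (X (r n)) (to_l2 g) < e / 2"
      using metric_LIMSEQ_D[OF g] \<open>e > 0\<close> by (meson half_gt_zero)
    define n where "n = max N j"
    have rn: "r n \<ge> M j"
      using r[of j] sum_mono2[of "{..n}" "{..j}" M] by (simp add: r_def n_def)
    show "\<exists>no. \<forall>m\<ge>no. dist (X m) (to_l2 g) < e"
    proof (intro exI allI impI)
      fix m assume "m \<ge> M j"
      then have "dist (X m) (X (r n)) < e / 2"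
        using M[OF _ rn, of m] j by (simp add: dist_norm)
      then show "dist (X m) (to_l2 g) < e"
        using N[of n] dist_triangle[of "X m" "to_l2 g" "X (r n)"] by (simp add: n_def)
    qed
  qed
  then show ?thesis unfolding convergent_def by blast
qed

instance l2 :: complete_space
  by standard (rule l2_Cauchy_convergent)

instance l2 :: banach ..

section \<open>Fourier series\<close>

lemma cinner_scaleC_right: "cinner f (scaleC c g) = cnj c * cinner f g"
  using cinner_commute[of f "scaleC c g"] cinner_commute[of g f] by (simp add: cinner_scaleC_left)

lemma cinner_add_right: "cinner f (g + h) = cinner f g + cinner f h"
  using cinner_commute[of f "g + h"] cinner_commute[of g f] cinner_commute[of h f]
  by (simp add: cinner_add_left)

lemma cinner_eq_Complex: "cinner f g = Complex (inner f g) (inner f (scaleC \<i> g))"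
  by (simp add: inner_l2_def cinner_scaleC_right complex_eq_iff)

lemma tendsto_cinner_left: "X \<longlonglongrightarrow> f \<Longrightarrow> (\<lambda>n. cinner (X n) g) \<longlonglongrightarrow> cinner f g"
  unfolding cinner_eq_Complex by (intro tendsto_Complex tendsto_inner tendsto_const)

lemma cinner_sum_left: "cinner (sum F A) g = (\<Sum>i\<in>A. cinner (F i) g)"
  by (induction A rule: infinite_finite_induct) (simp_all add: cinner_add_left)

lemma cinner_self: "cinner f f = of_real ((norm f)\<^sup>2)"
proof -
  have "cinner f f = cnj (cinner f f)" by (rule cinner_commute)
  then have "Im (cinner f f) = 0" by (simp add: complex_eq_iff)
  then show ?thesis by (simp add: complex_eq_iff power2_norm_eq_inner inner_l2_def)
qed

lemma integral_torus_FTC: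
  fixes F :: "real \<Rightarrow> complex"
  assumes F: "\<And>x. (F has_vector_derivative f x) (at x)" and f: "continuous_on UNIV f"
  shows "(LINT x|torus. f x) = F (2 * pi) - F 0"
proof -
  have c: "continuous_on {0..2*pi} f" using f continuous_on_subset by blast
  have "(f has_integral (F (2 * pi) - F 0)) {0..2*pi}"
    by (rule fundamental_theorem_of_calculus) (auto intro: has_vector_derivative_at_within F)
  moreover have "integrable torus f"
    unfolding torus_def using c by (rule continuous_imp_integrable_real)
  ultimately show ?thesis
    unfolding torus_def by (simp add: lebesgue_integral_eq_integral integral_unique)
qed

lemma cis_mult_has_vector_derivative:
  "((\<lambda>y. cis (a * y)) has_vector_derivative \<i> * of_real a * cis (a * y)) (at y)"
proof -
  have "((\<lambda>y. exp (\<i> * of_real a * of_real y)) has_vector_derivative \<i> * of_real a * exp (\<i> * of_real a * of_real y)) (at y)"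
    by (rule has_vector_derivative_real_field) (auto intro!: derivative_eq_intros)
  then show ?thesis by (simp add: cis_conv_exp mult.assoc)
qed

lemma integral_torus_cis: "(LINT y|torus. cis (of_int k * y)) = (if k = 0 then 2 * pi else 0)"
proof (cases "k = 0")
  case True
  have "measure torus (space torus) = 2 * pi"
    by (simp add: torus_def measure_restrict_space)
  then show ?thesis using True by (simp add: scaleR_conv_of_real)
next
  case False
  have "((\<lambda>y. cis (of_int k * y) / (\<i> * of_int k)) has_vector_derivative cis (of_int k * y)) (at y)" for y
    using has_vector_derivative_divide[OF cis_mult_has_vector_derivative[of "of_int k" y], of "\<i> * of_int k"] False
    by simp
  then have "(LINT y|torus. cis (of_int k * y)) = cis (of_int k * (2 * pi)) / (\<i> * of_int k) - cis (of_int k * 0) / (\<i> * of_int k)"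
    by (rule integral_torus_FTC) (intro continuous_intros)
  also have "cis (of_int k * (2 * pi)) = 1"
    by (metis cis_multiple_2pi Ints_of_int mult.commute)
  finally show ?thesis using False by simp
qed

section \<open>The orthonormal basis, Riesz-Fischer and Parseval\<close>

definition fourier_basis :: "int \<Rightarrow> l2" where
  "fourier_basis k = to_l2 (\<lambda>y. of_real (1 / sqrt (2 * pi)) * cis (of_int k * y))"

definition fourier_coeff :: "l2 \<Rightarrow> int \<Rightarrow> complex" where
  "fourier_coeff f k = cinner f (fourier_basis k)"

lemma sq_integrable_continuous:
  assumes "continuous_on UNIV f" shows "sq_integrable f"
proof -
  have m: "f \<in> borel_measurable torus" by (rule borel_measurable_torus_continuous[OF assms])
  have "bounded (f ` {0..2*pi})"
    by (intro compact_imp_bounded compact_continuous_image continuous_on_subset[OF assms]) auto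
  then obtain B where "\<forall>x\<in>{0..2*pi}. cmod (f x) \<le> B" by (auto simp: bounded_iff)
  then have B: "\<And>x. x \<in> {0..2*pi} \<Longrightarrow> cmod (f x) \<le> B" by blast
  show ?thesis
    using sq_integrable_bounded_mult[OF sq_integrable_const[of 1] m B] by simp
qed

lemma sq_integrable_cis: "sq_integrable (\<lambda>y. c * cis (of_int k * y))"
  by (intro sq_integrable_continuous continuous_intros)

lemma fourier_coeff_basis: "fourier_coeff (fourier_basis j) k = (if j = k then 1 else 0)"
proof -
  have "fourier_coeff (fourier_basis j) k =
      (LINT y|torus. (1 / of_real (2 * pi)) * cis (of_int (j - k) * y))"
    unfolding fourier_coeff_def fourier_basis_def
    by (subst cinner_to_l2[OF sq_integrable_cis sq_integrable_cis], intro Bochner_Integration.integral_cong)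
      (simp_all add: cis_cnj cis_mult algebra_simps flip: of_real_mult)
  then show ?thesis using integral_torus_cis[of "j - k"] by simp
qed

lemma fourier_coeff_add: "fourier_coeff (f + g) k = fourier_coeff f k + fourier_coeff g k"
  and fourier_coeff_diff: "fourier_coeff (f - g) k = fourier_coeff f k - fourier_coeff g k"
  and fourier_coeff_scaleC: "fourier_coeff (scaleC c f) k = c * fourier_coeff f k"
  and fourier_coeff_scaleR: "fourier_coeff (r *\<^sub>R f) k = of_real r * fourier_coeff f k"
  and fourier_coeff_zero: "fourier_coeff 0 k = 0"
  by (simp_all add: fourier_coeff_def cinner_add_left cinner_diff_left cinner_scaleC_left scaleR_l2_def)

lemma fourier_coeff_to_l2:
  "sq_integrable f \<Longrightarrow> fourier_coeff (to_l2 f) k = of_real (1 / sqrt (2 * pi)) * (LINT y|torus. f y * cis (of_int (- k) * y))"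
  unfolding fourier_coeff_def fourier_basis_def
  by (subst cinner_to_l2[OF _ sq_integrable_cis], simp, subst integral_mult_right_zero[symmetric],
      intro Bochner_Integration.integral_cong) (simp_all add: cis_cnj algebra_simps)

lemma sq_integrable_imp_integrable: "sq_integrable f \<Longrightarrow> integrable torus f"
  using integrable_mult_cnj[OF _ sq_integrable_const[of 1]] by simp

lemma fourier_coeff_eq_zeroD:
  assumes "\<And>k. fourier_coeff f k = 0"
  shows "f = 0"
proof -
  obtain g where g: "sq_integrable g" "f = to_l2 g" by (rule l2_exhaust)
  have "AE y in torus. g y = 0"
  proof (rule torus_fourier_unique)
    show "integrable torus g" by (rule sq_integrable_imp_integrable[OF g(1)])
    fix k :: int
    show "(LINT y|torus. g y * cis (of_int k * y)) = 0"
      using assms[of "- k"] fourier_coeff_to_l2[OF g(1), of "- k"] g(2) by simp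
  qed
  then have "to_l2 g = to_l2 (\<lambda>x. 0)" using to_l2_eq_iff[OF g(1) sq_integrable_zero] by simp
  also have "\<dots> = 0" by transfer (simp add: ae_eq_def sq_integrable_zero)
  finally show ?thesis using g by simp
qed

lemma fourier_coeff_eqI: "(\<And>k. fourier_coeff f k = fourier_coeff g k) \<Longrightarrow> f = g"
  using fourier_coeff_eq_zeroD[of "f - g"] by (simp add: fourier_coeff_diff)

definition fourier_sum :: "(int \<Rightarrow> complex) \<Rightarrow> int set \<Rightarrow> l2" where
  "fourier_sum c A = (\<Sum>k\<in>A. scaleC (c k) (fourier_basis k))"

lemma fourier_coeff_sum:
  "finite A \<Longrightarrow> fourier_coeff (fourier_sum c A) k = (if k \<in> A then c k else 0)"
proof -
  assume A: "finite A"
  have "fourier_coeff (fourier_sum c A) k = (\<Sum>j\<in>A. c j * fourier_coeff (fourier_basis j) k)"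
    by (simp add: fourier_sum_def fourier_coeff_def cinner_sum_left cinner_scaleC_left)
  also have "\<dots> = (if k \<in> A then c k else 0)" using A by (simp add: fourier_coeff_basis if_distrib[of "times _"] cong: if_cong)
  finally show ?thesis .
qed

lemma cinner_fourier_sum:
  "finite A \<Longrightarrow> cinner (fourier_sum c A) f = (\<Sum>k\<in>A. c k * cnj (fourier_coeff f k))"
  unfolding fourier_sum_def cinner_sum_left cinner_scaleC_left fourier_coeff_def
  by (metis cinner_commute)

lemma norm_fourier_sum: "finite A \<Longrightarrow> (norm (fourier_sum c A))\<^sup>2 = (\<Sum>k\<in>A. (cmod (c k))\<^sup>2)"
proof -
  assume A: "finite A"
  have "of_real ((norm (fourier_sum c A))\<^sup>2) = (\<Sum>k\<in>A. c k * cnj (c k))"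
    unfolding cinner_self[symmetric] cinner_fourier_sum[OF A] using A by (simp add: fourier_coeff_sum)
  also have "\<dots> = of_real (\<Sum>k\<in>A. (cmod (c k))\<^sup>2)"
    by (simp only: complex_norm_square of_real_sum)
  finally show ?thesis by (simp only: of_real_eq_iff)
qed

lemma bessel: "finite A \<Longrightarrow> (\<Sum>k\<in>A. (cmod (fourier_coeff f k))\<^sup>2) \<le> (norm f)\<^sup>2"
proof -
  assume A: "finite A"
  let ?s = "fourier_sum (fourier_coeff f) A" and ?S = "\<Sum>k\<in>A. (cmod (fourier_coeff f k))\<^sup>2"
  have "cinner ?s f = of_real ?S"
    unfolding cinner_fourier_sum[OF A] by (simp only: complex_norm_square of_real_sum)
  then have i: "inner ?s f = ?S" by (simp add: inner_l2_def)
  have "0 \<le> (norm (f - ?s))\<^sup>2" by simp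
  also have "\<dots> = (norm f)\<^sup>2 - ?S"
    using norm_fourier_sum[OF A, of "fourier_coeff f"] i
    by (simp add: power2_norm_eq_inner inner_diff_left inner_diff_right inner_commute)
  finally show ?thesis by simp
qed

text \<open>Series over the integers are read as limits along these symmetric finite sets, so that
  limits of sequences suffice.\<close>

definition sym_int :: "nat \<Rightarrow> int set" where "sym_int n = {- int n..int n}"

lemma finite_sym_int [simp]: "finite (sym_int n)" by (simp add: sym_int_def)

lemma sym_int_mono: "m \<le> n \<Longrightarrow> sym_int m \<subseteq> sym_int n" by (auto simp: sym_int_def)

text \<open>By orthonormality the squared distance of two partial sums is a difference of the
  partial sums of |c k|^2, which increase and are bounded. Hence the series is Cauchy. Each
  coefficient passes to the limit because it is eventually constant along the partial sums.\<close>

lemma riesz_fischer: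
  assumes M: "\<And>n. (\<Sum>k\<in>sym_int n. (cmod (c k))\<^sup>2) \<le> M"
  shows "\<exists>f. (\<forall>k. fourier_coeff f k = c k) \<and> (\<lambda>n. fourier_sum c (sym_int n)) \<longlonglongrightarrow> f"
proof -
  define S where "S n = (\<Sum>k\<in>sym_int n. (cmod (c k))\<^sup>2)" for n
  have "incseq S" unfolding incseq_def S_def by (auto intro!: sum_mono2 sym_int_mono)
  then have "convergent S"
    using M incseq_convergent[of S M] unfolding S_def convergent_def by blast
  then have CS: "Cauchy S" by (rule convergent_Cauchy)
  have d: "(norm (fourier_sum c (sym_int m) - fourier_sum c (sym_int n)))\<^sup>2 = S m - S n" if "n \<le> m" for m n
  proof -
    have "fourier_sum c (sym_int m) - fourier_sum c (sym_int n) = fourier_sum c (sym_int m - sym_int n)"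
      unfolding fourier_sum_def using sym_int_mono[OF that] by (subst sum_diff) auto
    then show ?thesis using sym_int_mono[OF that] by (simp add: norm_fourier_sum S_def sum_diff)
  qed
  have "Cauchy (\<lambda>n. fourier_sum c (sym_int n))"
  proof (rule CauchyI')
    fix e :: real assume "e > 0"
    then obtain N where N: "\<forall>m\<ge>N. \<forall>n\<ge>N. norm (S m - S n) < e\<^sup>2"
      using CauchyD[OF CS, of "e\<^sup>2"] by auto
    show "\<exists>N. \<forall>m\<ge>N. \<forall>n>m. dist (fourier_sum c (sym_int m)) (fourier_sum c (sym_int n)) < e"
    proof (intro exI allI impI)
      fix m n assume "N \<le> m" "m < n"
      then have "(norm (fourier_sum c (sym_int n) - fourier_sum c (sym_int m)))\<^sup>2 < e\<^sup>2"
        using N d[of m n] by (smt (verit) le_trans less_imp_le real_norm_def)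
      then show "dist (fourier_sum c (sym_int m)) (fourier_sum c (sym_int n)) < e"
        using \<open>e > 0\<close> by (metis dist_norm norm_minus_commute power2_less_imp_less less_imp_le)
    qed
  qed
  then obtain f where f: "(\<lambda>n. fourier_sum c (sym_int n)) \<longlonglongrightarrow> f"
    using Cauchy_convergent convergent_def by blast
  have "fourier_coeff f k = c k" for k
  proof -
    have "(\<lambda>n. fourier_coeff (fourier_sum c (sym_int n)) k) \<longlonglongrightarrow> fourier_coeff f k"
      unfolding fourier_coeff_def by (rule tendsto_cinner_left[OF f])
    moreover have "(\<lambda>n. fourier_coeff (fourier_sum c (sym_int n)) k) \<longlonglongrightarrow> c k"
      by (rule tendsto_eventually, rule eventually_sequentiallyI[of "nat \<bar>k\<bar>"]) (auto simp: fourier_coeff_sum sym_int_def)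
    ultimately show ?thesis by (rule LIMSEQ_unique)
  qed
  then show ?thesis using f by blast
qed

lemma fourier_series: "(\<lambda>n. fourier_sum (fourier_coeff f) (sym_int n)) \<longlonglongrightarrow> f"
  using riesz_fischer[of "fourier_coeff f"] bessel[OF finite_sym_int] fourier_coeff_eqI by metis

lemma parseval: "(\<lambda>n. \<Sum>k\<in>sym_int n. fourier_coeff f k * cnj (fourier_coeff g k)) \<longlonglongrightarrow> cinner f g"
  using tendsto_cinner_left[OF fourier_series, of f g] by (simp add: cinner_fourier_sum)

lemma parseval_norm: "(\<lambda>n. \<Sum>k\<in>sym_int n. (cmod (fourier_coeff f k))\<^sup>2) \<longlonglongrightarrow> (norm f)\<^sup>2"
  using tendsto_power[OF tendsto_norm[OF fourier_series], of f 2] by (simp add: norm_fourier_sum)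

text \<open>Bounded symbols act on L^2. The inverse of A_l and its first derivative are obtained in
  this way.\<close>

lemma fourier_multiplier:
  assumes B: "\<And>k. cmod (c k) \<le> B"
  shows "\<exists>g. \<forall>k. fourier_coeff g k = c k * fourier_coeff f k"
proof -
  have "(\<Sum>k\<in>sym_int n. (cmod (c k * fourier_coeff f k))\<^sup>2) \<le> B\<^sup>2 * (norm f)\<^sup>2" for n
  proof -
    have "(\<Sum>k\<in>sym_int n. (cmod (c k * fourier_coeff f k))\<^sup>2) \<le> (\<Sum>k\<in>sym_int n. B\<^sup>2 * (cmod (fourier_coeff f k))\<^sup>2)"
      by (intro sum_mono) (auto simp: norm_mult power_mult_distrib intro!: mult_right_mono power_mono B)
    also have "\<dots> = B\<^sup>2 * (\<Sum>k\<in>sym_int n. (cmod (fourier_coeff f k))\<^sup>2)" by (simp add: sum_distrib_left)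
    also have "\<dots> \<le> B\<^sup>2 * (norm f)\<^sup>2" by (intro mult_left_mono bessel) auto
    finally show ?thesis .
  qed
  then show ?thesis using riesz_fischer[of "\<lambda>k. c k * fourier_coeff f k"] by blast
qed

section \<open>Weak derivatives and multiplication operators\<close>

lemma iterated_vector_derivative_cis:
  "((\<lambda>\<psi> y. vector_derivative \<psi> (at y)) ^^ n) (\<lambda>y. c * cis (a * y)) = (\<lambda>y. ((\<i> * of_real a)^n * c) * cis (a * y))"
proof (induction n)
  case (Suc n)
  have "((\<lambda>y. d * cis (a * y)) has_vector_derivative d * (\<i> * of_real a * cis (a * y))) (at y)" for d y
    by (rule has_vector_derivative_mult_right[OF cis_mult_has_vector_derivative])
  then have eq: "vector_derivative (\<lambda>y. d * cis (a * y)) (at y) = d * (\<i> * of_real a * cis (a * y))" for d y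
    by (rule vector_derivative_at)
  show ?case unfolding funpow.simps comp_def Suc.IH eq by (simp add: algebra_simps)
qed simp

lemma smooth_periodic_cis: "smooth_periodic (\<lambda>y. c * cis (of_int k * y))"
  unfolding smooth_periodic_def iterated_vector_derivative_cis
proof (intro conjI allI)
  fix n x
  have "((\<lambda>y. d * cis (of_int k * y)) has_vector_derivative d * (\<i> * of_real (of_int k) * cis (of_int k * x))) (at x)" for d
    by (rule has_vector_derivative_mult_right[OF cis_mult_has_vector_derivative])
  then show "(\<lambda>y. ((\<i> * of_real (of_int k))^n * c) * cis (of_int k * y)) differentiable at x"
    using differentiableI_vector by blast
next
  fix x
  have "cis (of_int k * (x + 2 * pi)) = cis (of_int k * x) * cis (2 * pi * of_int k)"
    by (simp add: cis_mult algebra_simps)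
  also have "cis (2 * pi * of_int k) = 1" by (rule cis_multiple_2pi) simp
  finally show "c * cis (of_int k * (x + 2 * pi)) = c * cis (of_int k * x)" by simp
qed

lemma smooth_periodic_deriv:
  assumes "smooth_periodic \<phi>"
  shows "(\<phi> has_vector_derivative vector_derivative \<phi> (at y)) (at y)"
    and "continuous_on UNIV \<phi>"
    and "continuous_on UNIV (\<lambda>y. vector_derivative \<phi> (at y))"
proof -
  have d: "((\<lambda>\<psi> y. vector_derivative \<psi> (at y)) ^^ n) \<phi> differentiable at x" for n x
    using assms by (simp add: smooth_periodic_def)
  show "(\<phi> has_vector_derivative vector_derivative \<phi> (at y)) (at y)"
    using d[of 0] by (simp add: vector_derivative_works)
  show "continuous_on UNIV \<phi>"
    using d[of 0] by (auto simp: continuous_on_eq_continuous_at differentiable_imp_continuous_within)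
  show "continuous_on UNIV (\<lambda>y. vector_derivative \<phi> (at y))"
    using d[of "Suc 0"] by (auto simp: continuous_on_eq_continuous_at differentiable_imp_continuous_within)
qed

lemma fourier_coeff_smooth_deriv:
  assumes "smooth_periodic \<phi>"
  shows "fourier_coeff (to_l2 (\<lambda>y. vector_derivative \<phi> (at y))) k = \<i> * of_int k * fourier_coeff (to_l2 \<phi>) k"
proof -
  let ?d = "\<lambda>y. vector_derivative \<phi> (at y)"
  note sd = smooth_periodic_deriv[OF assms]
  have e: "((\<lambda>y. cis (of_int (- k) * y)) has_vector_derivative \<i> * of_real (of_int (- k)) * cis (of_int (- k) * y)) (at y)" for y
    by (rule cis_mult_has_vector_derivative)
  have "(LINT y|torus. \<phi> y * (\<i> * of_real (of_int (- k)) * cis (of_int (- k) * y)) + ?d y * cis (of_int (- k) * y)) =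
      \<phi> (2 * pi) * cis (of_int (- k) * (2 * pi)) - \<phi> 0 * cis (of_int (- k) * 0)"
    by (rule integral_torus_FTC[OF has_vector_derivative_mult[OF sd(1) e]]) (intro continuous_intros sd)
  also have "\<phi> (2 * pi) = \<phi> 0" using assms unfolding smooth_periodic_def by (metis add_0)
  also have "cis (of_int (- k) * (2 * pi)) = 1"
    by (metis cis_multiple_2pi Ints_of_int mult.commute)
  finally have 0: "(LINT y|torus. \<phi> y * (\<i> * of_real (of_int (- k)) * cis (of_int (- k) * y)) + ?d y * cis (of_int (- k) * y)) = 0"
    by simp
  have i: "integrable torus (\<lambda>y. (\<i> * of_real (of_int (- k))) * (\<phi> y * cis (of_int (- k) * y)))"
     "integrable torus (\<lambda>y. ?d y * cis (of_int (- k) * y))"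
    by (intro sq_integrable_imp_integrable sq_integrable_continuous continuous_intros sd)+
  have "(LINT y|torus. (\<i> * of_real (of_int (- k))) * (\<phi> y * cis (of_int (- k) * y)) + ?d y * cis (of_int (- k) * y)) = 0"
    using 0 by (simp add: algebra_simps)
  then have "(\<i> * of_real (of_int (- k))) * (LINT y|torus. \<phi> y * cis (of_int (- k) * y)) + (LINT y|torus. ?d y * cis (of_int (- k) * y)) = 0"
    using Bochner_Integration.integral_add[OF i] by simp
  then show ?thesis
    using sd by (simp add: fourier_coeff_to_l2 sq_integrable_continuous eq_neg_iff_add_eq_0 algebra_simps)
qed

text \<open>Testing with a basis function gives one direction; Parseval together with integration by
  parts for the coefficients of a smooth test function gives the other. From here on identities for
  derivatives are checked coefficient by coefficient.\<close>

lemma has_weak_deriv_iff: "has_weak_deriv f g \<longleftrightarrow> (\<forall>k. fourier_coeff g k = \<i> * of_int k * fourier_coeff f k)"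
proof
  assume w: "has_weak_deriv f g"
  show "\<forall>k. fourier_coeff g k = \<i> * of_int k * fourier_coeff f k"
  proof
    fix k :: int
    let ?c = "complex_of_real (1 / sqrt (2 * pi))"
    have 1: "(\<lambda>y. vector_derivative (\<lambda>y. ?c * cis (of_int k * y)) (at y)) = (\<lambda>y. (\<i> * of_int k) * (?c * cis (of_int k * y)))"
      using iterated_vector_derivative_cis[of 1 ?c "of_int k"] by (simp add: mult.assoc)
    have "cinner f (to_l2 (\<lambda>y. vector_derivative (\<lambda>y. ?c * cis (of_int k * y)) (at y))) = - fourier_coeff g k"
      using w smooth_periodic_cis[of ?c k] unfolding has_weak_deriv_def fourier_coeff_def fourier_basis_def by blast
    then show "fourier_coeff g k = \<i> * of_int k * fourier_coeff f k"
      unfolding 1 to_l2_scaleC[OF sq_integrable_cis] cinner_scaleC_right fourier_basis_def[symmetric] fourier_coeff_def[symmetric]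
      by simp
  qed
next
  assume w: "\<forall>k. fourier_coeff g k = \<i> * of_int k * fourier_coeff f k"
  show "has_weak_deriv f g"
    unfolding has_weak_deriv_def
  proof (intro allI impI)
    fix \<phi> assume s: "smooth_periodic \<phi>"
    let ?F = "\<lambda>n. \<Sum>k\<in>sym_int n. fourier_coeff f k * cnj (fourier_coeff (to_l2 (\<lambda>y. vector_derivative \<phi> (at y))) k)"
    let ?G = "\<lambda>n. - (\<Sum>k\<in>sym_int n. fourier_coeff g k * cnj (fourier_coeff (to_l2 \<phi>) k))"
    have "?F = ?G"
      by (simp add: fun_eq_iff fourier_coeff_smooth_deriv[OF s] w algebra_simps flip: sum_negf)
    moreover have "?G \<longlonglongrightarrow> - cinner g (to_l2 \<phi>)" by (intro tendsto_minus parseval)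
    ultimately have "?F \<longlonglongrightarrow> - cinner g (to_l2 \<phi>)" by (simp only:)
    then show "cinner f (to_l2 (\<lambda>y. vector_derivative \<phi> (at y))) = - cinner g (to_l2 \<phi>)"
      by (rule LIMSEQ_unique[OF parseval])
  qed
qed

lemma has_weak_deriv_unique: "has_weak_deriv f g \<Longrightarrow> has_weak_deriv f h \<Longrightarrow> g = h"
  by (rule fourier_coeff_eqI) (simp add: has_weak_deriv_iff)

lemma weak_deriv_eqI: "has_weak_deriv f g \<Longrightarrow> weak_deriv f = g"
  unfolding weak_deriv_def using has_weak_deriv_unique by blast

lemma has_weak_deriv_add: "has_weak_deriv f g \<Longrightarrow> has_weak_deriv f' g' \<Longrightarrow> has_weak_deriv (f + f') (g + g')"
  and has_weak_deriv_scaleC: "has_weak_deriv f g \<Longrightarrow> has_weak_deriv (scaleC c f) (scaleC c g)"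
  and has_weak_deriv_scaleR: "has_weak_deriv f g \<Longrightarrow> has_weak_deriv (r *\<^sub>R f) (r *\<^sub>R g)"
  by (simp_all add: has_weak_deriv_iff fourier_coeff_add fourier_coeff_scaleC fourier_coeff_scaleR algebra_simps)

lemma has_weak_deriv_ibp:
  assumes "has_weak_deriv f g" "has_weak_deriv h k"
  shows "inner g h = - inner f k"
proof -
  let ?F = "\<lambda>n. \<Sum>j\<in>sym_int n. fourier_coeff g j * cnj (fourier_coeff h j)"
  let ?G = "\<lambda>n. - (\<Sum>j\<in>sym_int n. fourier_coeff f j * cnj (fourier_coeff k j))"
  have "?F = ?G"
    using assms by (simp add: fun_eq_iff has_weak_deriv_iff algebra_simps flip: sum_negf)
  moreover have "?G \<longlonglongrightarrow> - cinner f k" by (intro tendsto_minus parseval)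
  ultimately have "?F \<longlonglongrightarrow> - cinner f k" by (simp only:)
  then have "cinner g h = - cinner f k" by (rule LIMSEQ_unique[OF parseval])
  then show ?thesis by (simp add: inner_l2_def)
qed

lemma A_op_eq: "has_weak_deriv f g \<Longrightarrow> has_weak_deriv g h \<Longrightarrow> A_op l f = h - (of_int l)\<^sup>2 *\<^sub>R f"
  by (simp add: A_op_def weak_deriv_eqI)

lemma W22E:
  assumes "f \<in> W22"
  obtains g h where "has_weak_deriv f g" "has_weak_deriv g h" "A_op l f = h - (of_int l)\<^sup>2 *\<^sub>R f"
  using assms A_op_eq unfolding W22_def by blast

lemma fourier_coeff_A_op:
  assumes "f \<in> W22"
  shows "fourier_coeff (A_op l f) k = - ((of_int k)\<^sup>2 + (of_int l)\<^sup>2) * fourier_coeff f k"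
proof -
  obtain g h where gh: "has_weak_deriv f g" "has_weak_deriv g h" "A_op l f = h - (of_int l)\<^sup>2 *\<^sub>R f"
    by (rule W22E[OF assms])
  show ?thesis
    unfolding gh(3) using gh(1,2)
    by (simp add: has_weak_deriv_iff fourier_coeff_diff fourier_coeff_scaleR algebra_simps power2_eq_square)
qed

lemma symbol_ge:
  assumes "l \<noteq> 0"
  shows "1 \<le> (real_of_int k)\<^sup>2 + (real_of_int l)\<^sup>2" and "\<bar>real_of_int k\<bar> \<le> (real_of_int k)\<^sup>2 + (real_of_int l)\<^sup>2"
proof -
  have "1 \<le> \<bar>l\<bar>" using assms by simp
  then have "1 \<le> (real_of_int l)\<^sup>2"
    by (metis of_int_1_le_iff of_int_abs one_le_power power2_abs)
  moreover have "2 * \<bar>real_of_int k\<bar> \<le> (real_of_int k)\<^sup>2 + 1"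
    using sum_squares_bound[of "\<bar>real_of_int k\<bar>" 1] by simp
  ultimately show "1 \<le> (real_of_int k)\<^sup>2 + (real_of_int l)\<^sup>2"
    and "\<bar>real_of_int k\<bar> \<le> (real_of_int k)\<^sup>2 + (real_of_int l)\<^sup>2"
    using zero_le_power2[of "real_of_int k"] by linarith+
qed

text \<open>The symbol -(k^2 + l^2) is at most -1, which gives injectivity. Both 1/(k^2 + l^2) and
  |k|/(k^2 + l^2) are bounded by 1, so the preimage and its first derivative exist in L^2; the
  second derivative is then given by the equation itself.\<close>

lemma A_op_bij:
  assumes l: "l \<noteq> 0"
  shows "bij_betw (A_op l) W22 UNIV"
proof -
  have sym: "complex_of_int k ^ 2 + complex_of_int l ^ 2 = of_real ((real_of_int k)\<^sup>2 + (real_of_int l)\<^sup>2)" for k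
    by simp
  have nz: "complex_of_int k ^ 2 + complex_of_int l ^ 2 \<noteq> 0" for k
    unfolding sym of_real_eq_0_iff using symbol_ge(1)[OF l, of k] by linarith
  have "inj_on (A_op l) W22"
  proof (rule inj_onI, rule fourier_coeff_eqI)
    fix f g k assume "f \<in> W22" "g \<in> W22" "A_op l f = A_op l g"
    then have "- ((of_int k)\<^sup>2 + (of_int l)\<^sup>2) * fourier_coeff f k = - ((of_int k)\<^sup>2 + (of_int l)\<^sup>2) * fourier_coeff g k"
      by (metis fourier_coeff_A_op)
    then show "fourier_coeff f k = fourier_coeff g k"
      using nz[of k] by (metis mult_cancel_left neg_equal_0_iff_equal)
  qed
  moreover have "\<exists>f\<in>W22. A_op l f = u" for u
  proof -
    let ?s = "\<lambda>k. complex_of_int k ^ 2 + complex_of_int l ^ 2"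
    have b: "cmod (- 1 / ?s k) \<le> 1" "cmod (- (\<i> * of_int k) / ?s k) \<le> 1" for k
      using symbol_ge[OF l, of k] unfolding sym
      by (simp_all add: norm_divide norm_mult divide_le_eq_1 del: of_real_add of_real_power)
    obtain f where f: "\<And>k. fourier_coeff f k = - 1 / ?s k * fourier_coeff u k"
      using fourier_multiplier[where c = "\<lambda>k. - 1 / ?s k" and f = u, OF b(1)] by blast
    obtain g where g: "\<And>k. fourier_coeff g k = - (\<i> * of_int k) / ?s k * fourier_coeff u k"
      using fourier_multiplier[where c = "\<lambda>k. - (\<i> * of_int k) / ?s k" and f = u, OF b(2)] by blast
    have fg: "has_weak_deriv f g" by (simp add: has_weak_deriv_iff f g)
    have gh: "has_weak_deriv g (u + (of_int l)\<^sup>2 *\<^sub>R f)"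
      using nz by (simp add: has_weak_deriv_iff f g fourier_coeff_add fourier_coeff_scaleR field_simps power2_eq_square)
    have "f \<in> W22" using fg gh by (auto simp: W22_def)
    moreover have "A_op l f = u" using A_op_eq[OF fg gh] by simp
    ultimately show ?thesis by blast
  qed
  ultimately show ?thesis by (auto simp: bij_betw_def surj_def image_iff) (metis)
qed

section \<open>Multiplication by sine and cosine\<close>

abbreviation sin_op :: "l2 \<Rightarrow> l2" where "sin_op \<equiv> mult_op (\<lambda>y. of_real (sin y))"
abbreviation cos_op :: "l2 \<Rightarrow> l2" where "cos_op \<equiv> mult_op (\<lambda>y. of_real (cos y))"

lemma bounded_multiplier_sin: "bounded_multiplier (\<lambda>y. of_real (sin y))"
  and bounded_multiplier_cos: "bounded_multiplier (\<lambda>y. of_real (cos y))"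
  by (auto simp: bounded_multiplier_def bounded_iff intro!: borel_measurable_torus_continuous continuous_intros exI[of _ 1])

lemma mult_op_to_l2:
  assumes "bounded_multiplier g" "sq_integrable f"
  shows "mult_op g (to_l2 f) = to_l2 (\<lambda>x. g x * f x)" and "sq_integrable (\<lambda>x. g x * f x)"
proof -
  obtain B where "\<forall>x\<in>{0..2*pi}. cmod (g x) \<le> B"
    using assms(1) by (auto simp: bounded_multiplier_def bounded_iff)
  then show s: "sq_integrable (\<lambda>x. g x * f x)"
    using sq_integrable_bounded_mult[OF assms(2), of g B] assms(1) by (auto simp: bounded_multiplier_def)
  show "mult_op g (to_l2 f) = to_l2 (\<lambda>x. g x * f x)"
    using assms s by transfer (simp add: ae_eq_def)
qed

lemma cinner_mult_op: "bounded_multiplier (\<lambda>x. of_real (g x)) \<Longrightarrow>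
  cinner (mult_op (\<lambda>x. of_real (g x)) f) h = cinner f (mult_op (\<lambda>x. of_real (g x)) h)"
  by transfer (simp add: algebra_simps)

lemma sin_cos_op: "sin_op (cos_op f) = cos_op (sin_op f)" "sin_op (sin_op f) + cos_op (cos_op f) = f"
proof -
  obtain g where g: "sq_integrable g" "f = to_l2 g" by (rule l2_exhaust)
  note s = mult_op_to_l2[OF bounded_multiplier_sin] and c = mult_op_to_l2[OF bounded_multiplier_cos]
  show "sin_op (cos_op f) = cos_op (sin_op f)"
    by (simp add: g s c mult.left_commute)
  have "sin_op (sin_op f) + cos_op (cos_op f) =
      to_l2 (\<lambda>x. of_real (sin x) * (of_real (sin x) * g x) + of_real (cos x) * (of_real (cos x) * g x))"
    by (simp add: g s c to_l2_add)
  also have "(\<lambda>x. of_real (sin x) * (of_real (sin x) * g x) + of_real (cos x) * (of_real (cos x) * g x)) = g"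
  proof
    fix x
    have "of_real (sin x) * (of_real (sin x) * g x) + of_real (cos x) * (of_real (cos x) * g x) =
        of_real (cos x * cos x + sin x * sin x) * g x"
      unfolding of_real_add of_real_mult by (simp only: algebra_simps)
    then show "of_real (sin x) * (of_real (sin x) * g x) + of_real (cos x) * (of_real (cos x) * g x) = g x"
      unfolding sin_cos_squared_add3 by simp
  qed
  finally show "sin_op (sin_op f) + cos_op (cos_op f) = f" by (simp add: g)
qed

text \<open>Sine and cosine shift frequencies by one. The operator is symmetric, so it may be moved
  onto the basis function, where the shift is explicit. The product rules below become identities
  between neighbouring coefficients.\<close>

lemma fourier_coeff_sin_op: "fourier_coeff (sin_op f) k = (fourier_coeff f (k - 1) - fourier_coeff f (k + 1)) / (2 * \<i>)"
  and fourier_coeff_cos_op: "fourier_coeff (cos_op f) k = (fourier_coeff f (k - 1) + fourier_coeff f (k + 1)) / 2"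
proof -
  let ?b = "\<lambda>k y. complex_of_real (1 / sqrt (2 * pi)) * cis (of_int k * y)"
  have cis1: "cis (of_int (k - 1) * y) = cis (of_int k * y) * cis (- y)"
    "cis (of_int (k + 1) * y) = cis (of_int k * y) * cis y" for y
    by (simp_all add: cis_mult algebra_simps)
  have trig: "of_real (sin y) = (\<i>/2) * (cis (- y) - cis y)" "of_real (cos y) = (1/2) * (cis (- y) + cis y)" for y
    by (auto simp: complex_eq_iff)
  have "sin_op (fourier_basis k) = to_l2 (\<lambda>y. (\<i>/2) * ?b (k - 1) y + (- \<i>/2) * ?b (k + 1) y)"
    unfolding fourier_basis_def mult_op_to_l2(1)[OF bounded_multiplier_sin sq_integrable_cis]
    unfolding cis1 trig
    by (rule arg_cong[where f = to_l2]) (simp add: fun_eq_iff algebra_simps)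
  also have "\<dots> = scaleC (\<i>/2) (fourier_basis (k - 1)) + scaleC (- \<i>/2) (fourier_basis (k + 1))"
    unfolding fourier_basis_def by (subst to_l2_add) (simp_all only: to_l2_scaleC sq_integrable_cmult sq_integrable_cis)
  finally show "fourier_coeff (sin_op f) k = (fourier_coeff f (k - 1) - fourier_coeff f (k + 1)) / (2 * \<i>)"
    unfolding fourier_coeff_def cinner_mult_op[OF bounded_multiplier_sin]
    by (simp add: cinner_add_right cinner_scaleC_right field_simps)
  have "cos_op (fourier_basis k) = to_l2 (\<lambda>y. (1/2) * ?b (k - 1) y + (1/2) * ?b (k + 1) y)"
    unfolding fourier_basis_def mult_op_to_l2(1)[OF bounded_multiplier_cos sq_integrable_cis]
    unfolding cis1 trig
    by (rule arg_cong[where f = to_l2]) (simp add: fun_eq_iff algebra_simps)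
  also have "\<dots> = scaleC (1/2) (fourier_basis (k - 1)) + scaleC (1/2) (fourier_basis (k + 1))"
    unfolding fourier_basis_def by (subst to_l2_add) (simp_all only: to_l2_scaleC sq_integrable_cmult sq_integrable_cis)
  finally show "fourier_coeff (cos_op f) k = (fourier_coeff f (k - 1) + fourier_coeff f (k + 1)) / 2"
    unfolding fourier_coeff_def cinner_mult_op[OF bounded_multiplier_cos]
    by (simp add: cinner_add_right cinner_scaleC_right field_simps)
qed

lemma has_weak_deriv_sin_op:
  assumes "has_weak_deriv f g" shows "has_weak_deriv (sin_op f) (cos_op f + sin_op g)"
  using assms by (simp add: has_weak_deriv_iff fourier_coeff_add fourier_coeff_sin_op fourier_coeff_cos_op field_simps)

lemma has_weak_deriv_cos_op:
  assumes "has_weak_deriv f g" shows "has_weak_deriv (cos_op f) (- sin_op f + cos_op g)"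
proof -
  have "- sin_op f = 0 - sin_op f" by simp
  then show ?thesis
    using assms by (simp add: has_weak_deriv_iff fourier_coeff_add fourier_coeff_diff fourier_coeff_zero
        fourier_coeff_sin_op fourier_coeff_cos_op field_simps del: diff_0)
qed

text \<open>Without the mean every frequency satisfies |k| >= 1. This replaces the largeness of l^2
  when |l| = 1.\<close>

lemma poincare:
  assumes D: "has_weak_deriv f g" and 0: "fourier_coeff f 0 = 0"
  shows "norm f \<le> norm g"
proof -
  have "(norm f)\<^sup>2 \<le> (norm g)\<^sup>2"
  proof (rule LIMSEQ_le[OF parseval_norm parseval_norm], intro exI allI impI sum_mono)
    fix k :: int
    have "cmod (fourier_coeff f k) \<le> cmod (fourier_coeff g k)"
    proof (cases "k = 0")
      case False
      then have "1 * cmod (fourier_coeff f k) \<le> \<bar>of_int k\<bar> * cmod (fourier_coeff f k)"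
        by (intro mult_right_mono) auto
      then show ?thesis using D by (simp add: has_weak_deriv_iff norm_mult)
    qed (simp add: 0)
    then show "(cmod (fourier_coeff f k))\<^sup>2 \<le> (cmod (fourier_coeff g k))\<^sup>2" by simp
  qed
  then show ?thesis by (rule power2_le_imp_le) simp
qed

section \<open>The mean, the space Y_l and its projection in Fourier terms\<close>

lemma fourier_basis_0: "fourier_basis 0 = scaleC (of_real (1 / sqrt (2 * pi))) (to_l2 (\<lambda>x. 1))"
  unfolding fourier_basis_def using to_l2_const[of "of_real (1 / sqrt (2 * pi))"] by simp

lemma fourier_coeff_0: "fourier_coeff f 0 = of_real (1 / sqrt (2 * pi)) * l2_integral f"
  by (simp add: fourier_coeff_def fourier_basis_0 cinner_scaleC_right l2_integral_eq_cinner)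

lemma Y_space_iff: "f \<in> Y_space l \<longleftrightarrow> (\<bar>l\<bar> = 1 \<longrightarrow> fourier_coeff f 0 = 0)"
  by (auto simp: Y_space_def fourier_coeff_0)

lemma Q_proj_eq:
  assumes "\<bar>l\<bar> = 1"
  shows "Q_proj l f = f - scaleC (fourier_coeff f 0) (fourier_basis 0)"
proof -
  have "to_l2 (\<lambda>y. l2_integral f / (2 * pi)) = scaleC (fourier_coeff f 0) (fourier_basis 0)"
    unfolding to_l2_const[of "l2_integral f / (2 * pi)"] fourier_basis_0 fourier_coeff_0
    by transfer (auto simp: ae_eq_def sq_integrable_const simp flip: of_real_mult)
  then show ?thesis using Q_proj_eq_minus_mean[OF assms] by simp
qed

section \<open>Absorption of the error terms\<close>

text \<open>The variables \<open>g\<close>, \<open>y\<close>, \<open>k\<close>, \<open>t\<close>,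
  \<open>h\<close> are the rescaled sizes of \<open>f\<close>, \<open>u''\<close>,
  \<open>cos w'\<close>, the root of the layer energy, and \<open>u'\<close>. If \<open>g\<close>
  were tiny, then \<open>h\<close> and \<open>y\<close> would be small relative to 1 + t and
  \<open>k\<close> at most 4 + t. The bound for t^2 would then carry a small factor in front of a
  quadratic in \<open>t\<close>, while \<open>t0\<close> keeps \<open>t\<close> away from 0.\<close>

lemma absorption_constant:
  fixes g y k t h :: real
  assumes nn: "0 \<le> g" "0 \<le> y" "0 \<le> k" "0 \<le> t" "0 \<le> h"
    and h: "h\<^sup>2 \<le> g"
    and y: "y\<^sup>2 \<le> g * y + 2 * t * h"
    and k: "k\<^sup>2 \<le> 2 * g * (1 + 3 * g + y)"
    and t: "t\<^sup>2 \<le> 80 * ((3 * g + y) * (k + 3))"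
    and t0: "1/2 \<le> t \<or> 1/4 \<le> 2 * t\<^sup>2 + 2 * t * (h + 1)"
  shows "1 / 10^24 \<le> g"
proof (rule ccontr)
  \<comment> \<open>The threshold for \<open>g\<close> is \<theta>^4 because two square roots are
    lost: \<open>h\<close> is of order \<theta>^2 and \<open>y\<close> of order \<theta>. The value
    is chosen so that 80 * 61 * 85 * \<theta> < 1 in the last step.\<close>
  define \<theta> :: real where "\<theta> = 1 / 10^6"
  assume "\<not> 1 / 10^24 \<le> g"
  then have g: "g \<le> \<theta>^4" by (simp add: \<theta>_def power_divide)
  have \<theta>: "0 < \<theta>" "\<theta> \<le> 1" by (simp_all add: \<theta>_def)
  have \<theta>4: "\<theta>^4 = (\<theta>\<^sup>2)\<^sup>2" by (simp add: power_mult[symmetric])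
  have \<theta>2: "\<theta>\<^sup>2 \<le> \<theta>" "\<theta>^4 \<le> \<theta>" "\<theta>^4 \<le> \<theta>\<^sup>2" "\<theta>^4 \<le> 1" "\<theta>\<^sup>2 \<le> 1"
    using \<theta> by (simp_all add: \<theta>_def power_divide)
  have "h\<^sup>2 \<le> (\<theta>\<^sup>2)\<^sup>2" by (rule order_trans[OF h g[unfolded \<theta>4]])
  then have h2: "h \<le> \<theta>\<^sup>2" by (rule power2_le_imp_le) simp
  have y2: "y \<le> \<theta> * (2 + t)"
  proof (rule ccontr)
    assume "\<not> y \<le> \<theta> * (2 + t)"
    then have less: "\<theta> * (2 + t) < y" by simp
    have "g * y \<le> \<theta> * y" using g \<theta>2 nn by (intro mult_right_mono) auto
    moreover have "2 * t * h \<le> \<theta> * (\<theta> * (2 * t))"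
      using mult_left_mono[OF h2, of "2 * t"] nn by (simp add: power2_eq_square mult_ac)
    moreover have "\<theta> * (\<theta> * (2 * t)) \<le> \<theta> * (\<theta> * ((1 + t) * (2 + t)))"
      using \<theta> nn by (intro mult_left_mono) (auto simp: algebra_simps)
    moreover have "\<theta> * (\<theta> * ((1 + t) * (2 + t))) \<le> \<theta> * (1 + t) * y"
      using mult_left_mono[OF less_imp_le[OF less], of "\<theta> * (1 + t)"] \<theta> nn by (simp add: mult_ac)
    ultimately have "y\<^sup>2 \<le> \<theta> * (2 + t) * y" using y by (simp add: algebra_simps)
    moreover have "\<theta> * (2 + t) * y < y * y"
      using less \<theta> nn by (intro mult_strict_right_mono) (auto intro: le_less_trans[rotated])
    ultimately show False by (simp add: power2_eq_square)
  qed
  have y3: "y \<le> 2 + t" using y2 nn \<theta>(2) by (intro order_trans[OF y2] order_trans[OF mult_right_mono[OF \<theta>(2)]]) auto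
  have "k\<^sup>2 \<le> 2 * g * (1 + 3 * g + y)" by (rule k)
  also have "\<dots> \<le> 2 * 1 * (1 + 3 * 1 + (2 + t))"
    using g \<theta>2 y3 nn by (intro mult_mono add_mono) auto
  also have "\<dots> \<le> (4 + t)\<^sup>2" using nn by (simp add: power2_eq_square algebra_simps)
  finally have k2: "k \<le> 4 + t" using nn by (intro power2_le_imp_le[of k]) auto
  have t112: "1/12 \<le> t"
  proof (rule ccontr)
    assume a: "\<not> 1/12 \<le> t"
    then have "t\<^sup>2 \<le> (1/12)\<^sup>2" using nn by (intro power_mono) auto
    moreover have "t * (h + 1) \<le> 1/12 * (1/100 + 1)"
      using a h2 nn \<theta>_def by (intro mult_mono) (auto simp: power_divide)
    ultimately show False using t0 a by (simp add: power2_eq_square)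
  qed
  have "3 * g + y \<le> \<theta> * (5 + t)" using g \<theta>2 y2 by (simp add: algebra_simps)
  then have "t\<^sup>2 \<le> 80 * (\<theta> * (5 + t) * (7 + t))"
    using k2 nn \<theta> by (intro order_trans[OF t] mult_left_mono mult_mono) auto
  \<comment> \<open>Since 12 t >= 1, the constants obey 5 <= 60 t and 7 <= 84 t.\<close>
  also have "\<dots> \<le> 80 * (\<theta> * (61 * t) * (85 * t))"
    using t112 \<theta> by (intro mult_left_mono mult_mono) auto
  also have "\<dots> = 80 * 61 * 85 * \<theta> * t\<^sup>2" by (simp add: power2_eq_square)
  also have "\<dots> < 1 * t\<^sup>2"
    using t112 by (intro mult_strict_right_mono) (auto simp: \<theta>_def)
  finally show False by simp
qed

text \<open>All quantities are measured in units of the critical layer, which has width \<open>\<epsilon>\<close> and on which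
  \<open>\<bar>cos\<bar>\<close> has size \<open>\<delta>\<close>.\<close>

lemma absorption:
  fixes N F U V T K H \<beta> \<delta> \<epsilon> m :: real
  assumes N: "0 < N" and nn: "0 \<le> F" "0 \<le> U" "0 \<le> V" "0 \<le> T" "0 \<le> K" "0 \<le> H"
    and \<epsilon>: "0 < \<epsilon>" "\<epsilon> \<le> \<delta>" "\<delta> \<le> 1" and \<beta>: "\<beta> * (\<epsilon>^3 * \<delta>) = 1" and m: "m \<le> \<delta>\<^sup>2"
    and H: "H\<^sup>2 \<le> F * N"
    and U: "U\<^sup>2 \<le> F * U + \<beta> * (2 * T) * H"
    and K: "K\<^sup>2 \<le> 2 * F * (m * N + V)"
    and V: "\<beta> * V \<le> 3 * F + U"
    and T: "\<beta> * T\<^sup>2 \<le> 80 * ((3 * F + U) * (K + 3 * N))"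
    and NT: "N * \<delta> / 2 \<le> T \<or> \<delta> = \<epsilon> \<and> N\<^sup>2 / 4 \<le> 2 * T\<^sup>2 + 2 * T * (H + N)"
  shows "N \<le> 10^24 * \<epsilon>\<^sup>2 * F"
proof -
  define g y k t h where "g = \<epsilon>\<^sup>2 * F / N" and "y = \<epsilon>\<^sup>2 * U / N" and "k = \<epsilon> * K / (\<delta> * N)"
    and "t = T / (\<delta> * N)" and "h = \<epsilon> * H / N"
  note defs = g_def y_def k_def t_def h_def
  have \<delta>: "0 < \<delta>" using \<epsilon> by linarith
  have \<beta>_eq: "\<beta> = 1 / (\<epsilon>^3 * \<delta>)" using \<beta> \<epsilon>(1) \<delta> by (simp add: field_simps)
  have r: "\<epsilon> / \<delta> \<le> 1" using \<epsilon> \<delta> by simp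
  have nn': "0 \<le> g" "0 \<le> y" "0 \<le> k" "0 \<le> t" "0 \<le> h"
    using N nn \<epsilon>(1) \<delta> by (simp_all add: defs)
  have "1 / 10^24 \<le> g"
  proof (rule absorption_constant[OF nn'])
    have "h\<^sup>2 = (\<epsilon>\<^sup>2 / N\<^sup>2) * H\<^sup>2" by (simp add: defs power_divide power_mult_distrib)
    also have "\<dots> \<le> (\<epsilon>\<^sup>2 / N\<^sup>2) * (F * N)" by (intro mult_left_mono H) simp
    also have "\<dots> = g" using N by (simp add: defs power2_eq_square)
    finally show "h\<^sup>2 \<le> g" .
    have "y\<^sup>2 = (\<epsilon>^4 / N\<^sup>2) * U\<^sup>2" by (simp add: defs power_divide power_mult_distrib)
    also have "\<dots> \<le> (\<epsilon>^4 / N\<^sup>2) * (F * U + \<beta> * (2 * T) * H)" by (intro mult_left_mono U) simp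
    also have "\<dots> = g * y + 2 * t * h"
      using N \<epsilon>(1) \<delta> by (simp add: defs \<beta>_eq field_simps eval_nat_numeral)
    finally show "y\<^sup>2 \<le> g * y + 2 * t * h" .
    have V': "V \<le> (3 * F + U) * (\<epsilon>^3 * \<delta>)"
      using V \<epsilon>(1) \<delta> by (simp add: \<beta>_eq field_simps)
    have "m * N + V \<le> \<delta>\<^sup>2 * N + (3 * F + U) * (\<epsilon>^3 * \<delta>)"
      using m N V' by (intro add_mono mult_right_mono) auto
    then have "2 * F * (m * N + V) \<le> 2 * F * (\<delta>\<^sup>2 * N + (3 * F + U) * (\<epsilon>^3 * \<delta>))"
      using nn by (intro mult_left_mono) auto
    then have K': "K\<^sup>2 \<le> 2 * F * (\<delta>\<^sup>2 * N + (3 * F + U) * (\<epsilon>^3 * \<delta>))" using K by linarith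
    have "k\<^sup>2 = (\<epsilon>\<^sup>2 / (\<delta>\<^sup>2 * N\<^sup>2)) * K\<^sup>2" by (simp add: defs power_divide power_mult_distrib)
    also have "\<dots> \<le> (\<epsilon>\<^sup>2 / (\<delta>\<^sup>2 * N\<^sup>2)) * (2 * F * (\<delta>\<^sup>2 * N + (3 * F + U) * (\<epsilon>^3 * \<delta>)))"
      by (intro mult_left_mono K') simp
    also have "\<dots> = 2 * g * (1 + (3 * g + y) * (\<epsilon> / \<delta>))"
      using N \<delta> by (simp add: defs field_simps eval_nat_numeral)
    also have "\<dots> \<le> 2 * g * (1 + (3 * g + y) * 1)"
      using nn' r by (intro mult_left_mono add_left_mono) auto
    finally show "k\<^sup>2 \<le> 2 * g * (1 + 3 * g + y)" by (simp add: add.assoc)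
    have "t\<^sup>2 = (\<epsilon>^3 / (\<delta> * N\<^sup>2)) * (\<beta> * T\<^sup>2)"
      using N \<epsilon>(1) \<delta> by (simp add: defs \<beta>_eq power2_eq_square)
    also have "\<dots> \<le> (\<epsilon>^3 / (\<delta> * N\<^sup>2)) * (80 * ((3 * F + U) * (K + 3 * N)))"
      using \<epsilon>(1) \<delta> by (intro mult_left_mono T) simp
    also have "\<dots> = 80 * ((3 * g + y) * (k + 3 * (\<epsilon> / \<delta>)))"
      using N \<delta> \<epsilon>(1) by (simp add: defs field_simps eval_nat_numeral)
    also have "\<dots> \<le> 80 * ((3 * g + y) * (k + 3 * 1))"
      using nn' r by (intro mult_left_mono add_left_mono) auto
    finally show "t\<^sup>2 \<le> 80 * ((3 * g + y) * (k + 3))" by simp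
    show "1/2 \<le> t \<or> 1/4 \<le> 2 * t\<^sup>2 + 2 * t * (h + 1)"
      using NT
    proof
      assume "N * \<delta> / 2 \<le> T"
      then show ?thesis using N \<delta> by (simp add: defs field_simps)
    next
      assume a: "\<delta> = \<epsilon> \<and> N\<^sup>2 / 4 \<le> 2 * T\<^sup>2 + 2 * T * (H + N)"
      have "1/4 = (1 / N\<^sup>2) * (N\<^sup>2 / 4)" using N by simp
      also have "\<dots> \<le> (1 / N\<^sup>2) * (2 * T\<^sup>2 + 2 * T * (H + N))" using a by (intro mult_left_mono) auto
      also have "\<dots> = 2 * (\<delta>\<^sup>2 * t\<^sup>2) + 2 * t * (h + \<delta>)"
        using N \<delta> a by (simp add: defs field_simps power2_eq_square)
      also have "\<dots> \<le> 2 * (1 * t\<^sup>2) + 2 * t * (h + 1)"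
        using nn' \<epsilon> \<delta> by (intro add_mono mult_left_mono mult_right_mono) (auto simp: power_le_one)
      finally show ?thesis by simp
    qed
  qed
  then have "N * (1 / 10^24) \<le> N * g" using N by (intro mult_left_mono) auto
  also have "N * g = \<epsilon>\<^sup>2 * F" using N by (simp add: defs)
  finally show ?thesis by simp
qed

section \<open>Resolvent estimates\<close>

text \<open>\<open>S\<close> and \<open>C\<close> model multiplication by sine and cosine up to a
  common sign, \<open>J\<close> models multiplication by i, and \<open>D\<close> is the graph of the
  derivative. A relation instead of a function carries the domain along. Only the real inner product
  is kept: the imaginary part of a complex pairing is a pairing with \<open>J\<close>.\<close>

locale shear_calculus =
  fixes S C J :: "'a::real_inner \<Rightarrow> 'a" and D :: "'a \<Rightarrow> 'a \<Rightarrow> bool"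
  assumes linear_S: "linear S" and linear_C: "linear C" and linear_J: "linear J"
    and S_sym: "inner (S x) y = inner x (S y)" and C_sym: "inner (C x) y = inner x (C y)"
    and J_skew: "inner (J x) y = - inner x (J y)" and J_J: "J (J x) = - x"
    and J_S: "J (S x) = S (J x)"
    and S_C: "S (C x) = C (S x)" and S_S: "S (S x) + C (C x) = x"
    and D_add: "D f g \<Longrightarrow> D f' g' \<Longrightarrow> D (f + f') (g + g')"
    and D_scale: "D f g \<Longrightarrow> D (r *\<^sub>R f) (r *\<^sub>R g)"
    and D_J: "D f g \<Longrightarrow> D (J f) (J g)"
    and D_S: "D f g \<Longrightarrow> D (S f) (C f + S g)"
    and D_C: "D f g \<Longrightarrow> D (C f) (C g - S f)"
    and ibp: "D f g \<Longrightarrow> D h k \<Longrightarrow> inner g h = - inner f k"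
begin

lemma D_diff: "D f g \<Longrightarrow> D f' g' \<Longrightarrow> D (f - f') (g - g')"
  using D_add[of f g "(- 1) *\<^sub>R f'" "(- 1) *\<^sub>R g'"] D_scale[of f' g' "- 1"] by simp

lemmas S_simps = linear_add[OF linear_S] linear_diff[OF linear_S] linear_scale[OF linear_S]
lemmas J_simps = linear_add[OF linear_J] linear_diff[OF linear_J] linear_scale[OF linear_J]
lemmas ip_simps = inner_add_left inner_add_right inner_diff_left inner_diff_right
  inner_scaleR_left inner_scaleR_right

lemma inner_J_self: "inner (J x) x = 0"
  using J_skew[of x x] by (simp add: inner_commute)

lemma inner_J_S: "inner (J (S x)) x = 0"
  using J_skew[of "S x" x] S_sym[of x "J x"] by (simp add: J_S inner_commute)

lemma norm_J: "norm (J x) = norm x"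
proof -
  have "inner (J x) (J x) = inner x x" by (simp add: J_skew[of x "J x"] J_J)
  then show ?thesis by (simp add: norm_eq_sqrt_inner)
qed

lemma norm_S_C: "(norm (S x))\<^sup>2 + (norm (C x))\<^sup>2 = (norm x)\<^sup>2"
proof -
  have "(norm (S x))\<^sup>2 + (norm (C x))\<^sup>2 = inner x (S (S x) + C (C x))"
    by (simp add: power2_norm_eq_inner S_sym C_sym inner_add_right)
  then show ?thesis by (simp add: S_S power2_norm_eq_inner)
qed

lemma norm_S_le: "norm (S x) \<le> norm x" and norm_C_le: "norm (C x) \<le> norm x"
proof -
  have "(norm (S x))\<^sup>2 \<le> (norm x)\<^sup>2" "(norm (C x))\<^sup>2 \<le> (norm x)\<^sup>2"
    using norm_S_C[of x] zero_le_power2[of "norm (S x)"] zero_le_power2[of "norm (C x)"] by linarith+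
  then show "norm (S x) \<le> norm x" "norm (C x) \<le> norm x"
    using power2_le_imp_le norm_ge_zero by blast+
qed

lemma inner_S_le: "\<bar>inner (S x) x\<bar> \<le> (norm x)\<^sup>2"
  using order_trans[OF Cauchy_Schwarz_ineq2 mult_right_mono[OF norm_S_le norm_ge_zero]]
  by (simp add: power2_eq_square)

text \<open>Operator form of \<open>cos\<^sup>2 \<le> 2 (1 - sin)\<close>.\<close>

lemma norm_C_le_gap: "(norm (C x))\<^sup>2 \<le> 2 * ((norm x)\<^sup>2 - inner (S x) x)"
proof -
  have "0 \<le> (norm (x - S x))\<^sup>2" by simp
  also have "\<dots> = (norm x)\<^sup>2 - 2 * inner (S x) x + (norm (S x))\<^sup>2"
    by (simp add: power2_norm_eq_inner ip_simps inner_commute)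
  finally show ?thesis using norm_S_C[of x] by simp
qed

text \<open>Operator form of integrating cos (|x|^2)'/2 by parts.\<close>

lemma ibp_C:
  assumes "D x x1" shows "inner (C x) x1 = inner (S x) x / 2"
  using ibp[OF D_C[OF assms] assms] C_sym[of x1 x] by (simp add: ip_simps inner_commute)

text \<open>The same with the weight sin cos, whose derivative is cos^2 - sin^2.\<close>

lemma ibp_S_C:
  assumes "D x x1" shows "inner (S x) (C x1) = ((norm (S x))\<^sup>2 - (norm (C x))\<^sup>2) / 2"
proof -
  have "inner (C (C x) - S (S x) + S (C x1)) x = - inner (S (C x)) x1"
    using ibp[OF D_S[OF D_C[OF assms]] assms] by (simp add: S_simps algebra_simps)
  moreover have "inner (S (C x)) x1 = inner (S x) (C x1)" by (simp add: S_C C_sym)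
  moreover have "inner (S (C x1)) x = inner (S x) (C x1)" by (metis S_sym inner_commute)
  moreover have "inner (C (C x)) x = (norm (C x))\<^sup>2" "inner (S (S x)) x = (norm (S x))\<^sup>2"
    by (simp_all add: power2_norm_eq_inner S_sym C_sym)
  ultimately show ?thesis by (simp add: ip_simps)
qed

text \<open>\<open>\<phi>\<close> is the inverse of A_l applied to \<open>x\<close>, with n = l^2.
  Its two derivatives are carried as witnesses, so that integration by parts can refer to
  them.\<close>

definition helmholtz :: "real \<Rightarrow> 'a \<Rightarrow> 'a \<Rightarrow> 'a \<Rightarrow> 'a \<Rightarrow> bool" where
  "helmholtz n x \<phi> \<phi>1 \<phi>2 \<longleftrightarrow> D \<phi> \<phi>1 \<and> D \<phi>1 \<phi>2 \<and> x = \<phi>2 - n *\<^sub>R \<phi>"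

lemma helmholtz_inner:
  assumes "helmholtz n x \<phi> \<phi>1 \<phi>2" shows "inner x \<phi> = - (norm \<phi>1)\<^sup>2 - n * (norm \<phi>)\<^sup>2"
  using assms ibp[of \<phi>1 \<phi>2 \<phi> \<phi>1] by (simp add: helmholtz_def ip_simps power2_norm_eq_inner)

lemma helmholtz_J:
  assumes "helmholtz n x \<phi> \<phi>1 \<phi>2" shows "inner (J x) \<phi> = 0"
  using assms ibp[OF D_J[of \<phi>1 \<phi>2], of \<phi> \<phi>1] by (simp add: helmholtz_def J_simps ip_simps inner_J_self)

text \<open>The symbol 1 - 1/(k^2 + n) of \<open>B\<close> lies in [0, 1], hence
  \<open>B^2 <= B <= I\<close>. Only the pairing of \<open>x\<close> with \<open>\<phi>\<close> is
  used for this.\<close>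

lemma helmholtz_le:
  assumes h: "helmholtz n x \<phi> \<phi>1 \<phi>2" and n: "1 \<le> n"
  shows "(norm (x + \<phi>))\<^sup>2 \<le> inner x (x + \<phi>)" and "inner x (x + \<phi>) \<le> (norm x)\<^sup>2"
    and "norm (x + \<phi>) \<le> norm x"
proof -
  have "(norm \<phi>)\<^sup>2 \<le> n * (norm \<phi>)\<^sup>2" using n mult_right_mono[of 1 n "(norm \<phi>)\<^sup>2"] by simp
  moreover have "inner x (x + \<phi>) = (norm x)\<^sup>2 + inner x \<phi>" by (simp add: ip_simps power2_norm_eq_inner)
  moreover have "(norm (x + \<phi>))\<^sup>2 = (norm x)\<^sup>2 + 2 * inner x \<phi> + (norm \<phi>)\<^sup>2"
    by (simp add: ip_simps power2_norm_eq_inner inner_commute)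
  ultimately show 1: "(norm (x + \<phi>))\<^sup>2 \<le> inner x (x + \<phi>)" and 2: "inner x (x + \<phi>) \<le> (norm x)\<^sup>2"
    using helmholtz_inner[OF h] zero_le_power2[of "norm \<phi>1"] zero_le_power2[of "norm \<phi>"] by linarith+
  show "norm (x + \<phi>) \<le> norm x" by (rule power2_le_imp_le[OF order_trans[OF 1 2]]) simp
qed

text \<open>The gap \<open>1 - 1/(k\<^sup>2 + n) \<ge> 1/2\<close> of the symbol of \<open>I + A\<^sup>-\<^sup>1\<close>.\<close>

lemma helmholtz_gap:
  assumes h: "helmholtz n x \<phi> \<phi>1 \<phi>2" and n: "4 \<le> n \<or> n = 1 \<and> norm \<phi> \<le> norm \<phi>1"
  shows "(norm \<phi>1)\<^sup>2 + n * (norm \<phi>)\<^sup>2 \<le> (norm x)\<^sup>2 / 2" and "(norm x)\<^sup>2 / 2 \<le> inner x (x + \<phi>)"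
    and "norm x \<le> 2 * norm (x + \<phi>)" and "norm \<phi> \<le> norm x" and "norm \<phi>1 \<le> norm x"
proof -
  let ?X = "norm x" and ?c = "norm \<phi>" and ?d = "norm \<phi>1"
  have e: "?d\<^sup>2 + n * ?c\<^sup>2 \<le> ?X * ?c"
    using helmholtz_inner[OF h] Cauchy_Schwarz_ineq2[of x \<phi>] by linarith
  \<comment> \<open>The symbol k^2 + n is at least 2 on the relevant modes: either n >= 4, or n = 1
    and the Poincare inequality supplies k^2 >= 1.\<close>
  have "2 * ?c\<^sup>2 \<le> ?d\<^sup>2 + n * ?c\<^sup>2"
  proof (cases "4 \<le> n")
    case True
    then have "4 * ?c\<^sup>2 \<le> n * ?c\<^sup>2" by (intro mult_right_mono) auto
    then show ?thesis using zero_le_power2[of ?c] zero_le_power2[of ?d] by linarith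
  next
    case False
    then have "n = 1" "?c\<^sup>2 \<le> ?d\<^sup>2" using n by (auto intro: power_mono)
    then show ?thesis by simp
  qed
  then have "2 * ?c * ?c \<le> ?X * ?c" using e by (simp add: power2_eq_square)
  then have c: "2 * ?c \<le> ?X"
    by (cases "?c = 0") (auto simp: mult_le_cancel_right)
  then have "?X * ?c \<le> ?X * (?X / 2)" by (intro mult_left_mono) auto
  then show 1: "?d\<^sup>2 + n * ?c\<^sup>2 \<le> ?X\<^sup>2 / 2" using e by (simp add: power2_eq_square)
  have "inner x (x + \<phi>) = ?X\<^sup>2 + inner x \<phi>" by (simp add: ip_simps power2_norm_eq_inner)
  then show 2: "?X\<^sup>2 / 2 \<le> inner x (x + \<phi>)" using helmholtz_inner[OF h] 1 by linarith
  have "?X * ?X / 2 \<le> ?X * norm (x + \<phi>)"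
    using order_trans[OF 2 order_trans[OF abs_ge_self Cauchy_Schwarz_ineq2]] by (simp add: power2_eq_square)
  then show "?X \<le> 2 * norm (x + \<phi>)" by (cases "?X = 0") (auto simp: mult_le_cancel_left)
  show "?c \<le> ?X" using c norm_ge_zero[of \<phi>] by linarith
  have "0 \<le> n * ?c\<^sup>2" using n by auto
  then have "?d\<^sup>2 \<le> ?X\<^sup>2" using 1 zero_le_power2[of ?X] by linarith
  then show "?d \<le> ?X" by (rule power2_le_imp_le) simp
qed

end

text \<open>In the application \<open>n = l\<^sup>2\<close>, \<open>w = (I + A\<^sup>-\<^sup>1) u\<close>, \<open>p\<close> is the mean of \<open>S w\<close> if \<open>n = 1\<close>, and
  the resolvent equation reads \<open>A u - i b v = f\<close>.\<close>

locale resolvent_equation = shear_calculus +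
  fixes u u1 u2 \<psi> \<psi>1 \<psi>2 p w w1 v f :: 'a and n b \<mu> :: real
  assumes Du: "D u u1" "D u1 u2"
    and h\<psi>: "helmholtz n u \<psi> \<psi>1 \<psi>2"
    and w: "w = u + \<psi>" and w1: "w1 = u1 + \<psi>1"
    and Dp: "D p 0" and p_S: "inner p (S w) = inner p p"
    and p_u: "inner p u = 0" "inner p \<psi> = 0" "inner (J p) u = 0" "inner (J p) \<psi> = 0"
    and v: "v = S w - p - \<mu> *\<^sub>R u"
    and f: "f = u2 - n *\<^sub>R u - b *\<^sub>R J v"
    and n: "4 \<le> n \<and> p = 0 \<or> n = 1 \<and> norm \<psi> \<le> norm \<psi>1 \<and> norm u \<le> norm u1"
begin

section \<open>Energy, supercritical and elliptic estimates\<close>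

lemma n1: "1 \<le> n" using n by auto

lemmas w_le = helmholtz_le[OF h\<psi> n1, folded w]
lemma w_gap: "(norm \<psi>1)\<^sup>2 + n * (norm \<psi>)\<^sup>2 \<le> (norm u)\<^sup>2 / 2" "(norm u)\<^sup>2 / 2 \<le> inner u w"
    "norm u \<le> 2 * norm w" "norm \<psi> \<le> norm u" "norm \<psi>1 \<le> norm u"
  using helmholtz_gap[OF h\<psi>] n w by auto

lemma D\<psi>: "D \<psi> \<psi>1" "D \<psi>1 \<psi>2" and u_eq: "u = \<psi>2 - n *\<^sub>R \<psi>"
  using h\<psi> by (auto simp: helmholtz_def)

lemma Dw: "D w w1" unfolding w w1 by (intro D_add Du D\<psi>)

lemma Dv: "D v (C w + S w1 - \<mu> *\<^sub>R u1)"
  using D_diff[OF D_diff[OF D_S[OF Dw] Dp] D_scale[OF Du(1), of \<mu>]] by (simp add: v)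

text \<open>Each part of \<open>v\<close> drops out separately: \<open>S\<close> is symmetric and
  commutes with \<open>J\<close>, \<open>p\<close> is orthogonal to \<open>w\<close> even after
  applying \<open>J\<close>, and \<open>u\<close> pairs with \<open>B u\<close> through a symmetric
  operator.\<close>

lemma inner_Jv_w: "inner (J v) w = 0"
  using inner_J_S[of w] p_u helmholtz_J[OF h\<psi>]
  by (simp add: v J_simps ip_simps w inner_J_self)

lemma inner_Au_\<psi>: "inner (u2 - n *\<^sub>R u) \<psi> = (norm u)\<^sup>2"
proof -
  have "inner u2 \<psi> = - inner u1 \<psi>1" using ibp Du D\<psi> by blast
  also have "\<dots> = inner u \<psi>2" using ibp[of u u1 \<psi>1 \<psi>2] Du D\<psi> by simp
  finally have "inner (u2 - n *\<^sub>R u) \<psi> = inner u (\<psi>2 - n *\<^sub>R \<psi>)" by (simp add: ip_simps)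
  then show ?thesis by (simp add: u_eq[symmetric] power2_norm_eq_inner)
qed

text \<open>Pairing with \<open>w\<close> removes the transport part, and the inverse of A inside
  \<open>w\<close> returns |u|^2. Hence the factor n - 1, which vanishes for |l| = 1; there the
  Poincare inequality has to supply the coercivity.\<close>

lemma energy: "(norm u1)\<^sup>2 + (n - 1) * (norm u)\<^sup>2 = - inner f w"
proof -
  have "inner f w = inner (u2 - n *\<^sub>R u) w" using inner_Jv_w by (simp add: f ip_simps)
  also have "\<dots> = inner (u2 - n *\<^sub>R u) u + (norm u)\<^sup>2" by (simp add: w inner_add_right inner_Au_\<psi>)
  also have "inner u2 u = - (norm u1)\<^sup>2" using ibp[OF Du(2) Du(1)] by (simp add: power2_norm_eq_inner)
  ultimately show ?thesis
    using ibp[OF Du(2) Du(1)] by (simp add: ip_simps power2_norm_eq_inner algebra_simps)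
qed

lemma energy_bound: "(norm u1)\<^sup>2 \<le> norm f * norm u" "n * norm u \<le> 2 * norm f"
proof -
  have "- inner f w \<le> norm f * norm w" using Cauchy_Schwarz_ineq2[of f w] by linarith
  also have "\<dots> \<le> norm f * norm u" using w_le(3) by (intro mult_left_mono) auto
  finally have e: "(norm u1)\<^sup>2 + (n - 1) * (norm u)\<^sup>2 \<le> norm f * norm u" by (simp add: energy)
  moreover have "0 \<le> (n - 1) * (norm u)\<^sup>2" using n1 by simp
  ultimately show "(norm u1)\<^sup>2 \<le> norm f * norm u" by linarith
  have "n * (norm u)\<^sup>2 \<le> 2 * ((norm u1)\<^sup>2 + (n - 1) * (norm u)\<^sup>2)"
  proof (cases "4 \<le> n")
    case True
    then have "2 * (norm u)\<^sup>2 \<le> n * (norm u)\<^sup>2" by (intro mult_right_mono) auto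
    then have "n * (norm u)\<^sup>2 \<le> 2 * (norm u1)\<^sup>2 + 2 * (n * (norm u)\<^sup>2) - 2 * (norm u)\<^sup>2"
      using zero_le_power2[of "norm u1"] by linarith
    also have "\<dots> = 2 * ((norm u1)\<^sup>2 + (n - 1) * (norm u)\<^sup>2)" by (simp add: algebra_simps)
    finally show ?thesis .
  next
    case False
    then have "n = 1" "(norm u)\<^sup>2 \<le> (norm u1)\<^sup>2" using n by (auto intro: power_mono)
    moreover from this have "(norm u)\<^sup>2 \<le> 2 * (norm u1)\<^sup>2"
      using zero_le_power2[of "norm u1"] by linarith
    ultimately show ?thesis by simp
  qed
  then have "(n * norm u) * norm u \<le> (2 * norm f) * norm u" using e by (simp add: power2_eq_square)
  then show "n * norm u \<le> 2 * norm f"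
    by (cases "norm u = 0") (auto simp: mult_le_cancel_right)
qed

lemma norm_u_le: "norm u \<le> 2 * norm f"
  using energy_bound(2) n1 mult_right_mono[of 1 n "norm u"] by simp

text \<open>Pair \<open>J f\<close> with \<open>w\<close>. A and \<open>B\<close> commute and are
  symmetric, so the elliptic part vanishes. In the rest \<open>S <= I\<close> and
  \<open>|w|^2 <= <u, w>\<close> give the sign of \<open>(1 - \<mu>) <u, w>\<close>, and the gap of
  \<open>B\<close> bounds \<open><u, w>\<close> below by \<open>|u|^2 / 2\<close>.\<close>

lemma supercritical_bound:
  assumes "\<mu> \<ge> 1"
  shows "\<bar>b\<bar> * (\<mu> - 1) * norm u \<le> 2 * norm f"
proof -
  have JA: "inner (J (u2 - n *\<^sub>R u)) w = 0"
  proof -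
    have "inner (J u2) u = 0"
      using ibp[OF D_J[OF Du(2)] Du(1)] inner_J_self[of u1] by simp
    moreover have "inner (J u2) \<psi> = inner (J u) \<psi>2"
      using ibp[OF D_J[OF Du(2)] D\<psi>(1)] ibp[OF D_J[OF Du(1)] D\<psi>(2)] by simp
    ultimately have "inner (J (u2 - n *\<^sub>R u)) w = inner (J u) (\<psi>2 - n *\<^sub>R \<psi>)"
      by (simp add: w J_simps ip_simps inner_J_self)
    then show ?thesis by (simp add: u_eq[symmetric] inner_J_self)
  qed
  have "inner (J f) w = b * inner v w"
    using JA by (simp add: f J_simps J_J ip_simps)
  moreover have "inner v w = inner (S w) w - \<mu> * inner u w"
    using p_u by (simp add: v ip_simps w algebra_simps)
  moreover have "inner (S w) w - \<mu> * inner u w \<le> - ((\<mu> - 1) * inner u w)"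
    using inner_S_le[of w] w_le(1) by (simp add: algebra_simps)
  moreover have "0 \<le> (\<mu> - 1) * inner u w"
    using assms order_trans[OF _ w_le(1), of 0] by simp
  ultimately have "\<bar>inner (J f) w\<bar> = \<bar>b\<bar> * \<bar>inner v w\<bar>" "(\<mu> - 1) * inner u w \<le> \<bar>inner v w\<bar>"
    by (simp only: abs_mult, linarith)
  then have "\<bar>b\<bar> * ((\<mu> - 1) * inner u w) \<le> \<bar>inner (J f) w\<bar>"
    using mult_left_mono[of "(\<mu> - 1) * inner u w" "\<bar>inner v w\<bar>" "\<bar>b\<bar>"] by simp
  also have "\<dots> \<le> norm f * norm u"
    using Cauchy_Schwarz_ineq2[of "J f" w] mult_left_mono[OF w_le(3), of "norm f"] by (simp add: norm_J)
  finally have "\<bar>b\<bar> * ((\<mu> - 1) * inner u w) \<le> norm f * norm u" .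
  moreover have "\<bar>b\<bar> * ((\<mu> - 1) * ((norm u)\<^sup>2 / 2)) \<le> \<bar>b\<bar> * ((\<mu> - 1) * inner u w)"
    using assms w_gap(2) by (intro mult_left_mono) auto
  moreover have "\<bar>b\<bar> * ((\<mu> - 1) * ((norm u)\<^sup>2 / 2)) = (\<bar>b\<bar> * (\<mu> - 1) * norm u) * norm u / 2"
    by (simp add: power2_eq_square)
  ultimately have "(\<bar>b\<bar> * (\<mu> - 1) * norm u) * norm u \<le> (2 * norm f) * norm u"
    by linarith
  then show ?thesis by (cases "norm u = 0") (auto simp: mult_le_cancel_right)
qed

text \<open>Integrating by parts puts one derivative on \<open>v\<close>. The terms
  \<open>S u1\<close> and \<open>\<mu> u1\<close> pair with \<open>u1\<close> to zero after applying
  \<open>J\<close>, and \<open>p\<close> is constant. Only the derivative of the sine and the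
  nonlocal \<open>S \<psi>1\<close> survive.\<close>

lemma elliptic_bound: "(norm u2)\<^sup>2 \<le> norm f * norm u2 + \<bar>b\<bar> * (norm (C w) + norm \<psi>1) * norm u1"
proof -
  have "inner (J v) u2 = - inner (J (C w + S w1 - \<mu> *\<^sub>R u1)) u1"
    using ibp[OF D_J[OF Dv] Du(2)] by simp
  also have "\<dots> = - inner (J (C w + S \<psi>1)) u1"
    by (simp add: w1 S_simps J_simps ip_simps inner_J_self inner_J_S)
  also have "\<bar>\<dots>\<bar> \<le> norm (C w + S \<psi>1) * norm u1"
    using Cauchy_Schwarz_ineq2[of "J (C w + S \<psi>1)" u1] by (simp add: norm_J)
  also have "\<dots> \<le> (norm (C w) + norm \<psi>1) * norm u1"
    by (intro mult_right_mono norm_triangle_le) (simp_all add: norm_S_le)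
  finally have "\<bar>b\<bar> * \<bar>inner (J v) u2\<bar> \<le> \<bar>b\<bar> * ((norm (C w) + norm \<psi>1) * norm u1)"
    by (rule mult_left_mono) simp
  then have "b * inner (J v) u2 \<le> \<bar>b\<bar> * (norm (C w) + norm \<psi>1) * norm u1"
    using abs_ge_self[of "b * inner (J v) u2"] by (simp add: abs_mult mult.assoc)
  moreover have "inner f u2 = (norm u2)\<^sup>2 + n * (norm u1)\<^sup>2 - b * inner (J v) u2"
    using ibp[OF Du(1) Du(2)] by (simp add: f ip_simps power2_norm_eq_inner)
  moreover have "0 \<le> n * (norm u1)\<^sup>2" using n1 by simp
  moreover have "inner f u2 \<le> norm f * norm u2" using Cauchy_Schwarz_ineq2[of f u2] by linarith
  ultimately show ?thesis by linarith
qed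

section \<open>Estimates in the critical layer\<close>

lemma v_bound: "\<bar>b\<bar> * norm v \<le> norm f + norm u2 + n * norm u"
proof -
  have "\<bar>b\<bar> * norm v = norm (u2 - n *\<^sub>R u - f)" by (simp add: f norm_J)
  also have "\<dots> \<le> norm u2 + norm (n *\<^sub>R u) + norm f"
    using norm_triangle_ineq4[of "u2 - n *\<^sub>R u" f] norm_triangle_ineq4[of u2 "n *\<^sub>R u"] by linarith
  finally show ?thesis using n1 by simp
qed

text \<open>The equation is tested with \<open>B y\<close> where \<open>B = I + A\<^sup>-\<^sup>1\<close> and \<open>y = (1 - \<mu>) u - v\<close>, that is
  \<open>y = (1 - S B) u\<close> up to the mean; this symmetric multiplier of the transport part keeps the dissipation
  with the weight \<open>1 - sin\<close>, which vanishes quadratically at the critical point.\<close>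

lemma weighted_dissipation:
  assumes h\<phi>: "helmholtz n v \<phi> \<phi>1 \<phi>2" and \<mu>: "\<mu> \<le> 1"
  shows "(norm (C w1))\<^sup>2 \<le> 2 * norm f * ((1 - \<mu>) * norm u + norm v)"
proof -
  define y where "y = (1 - \<mu>) *\<^sub>R u - v"
  define By where "By = y + ((1 - \<mu>) *\<^sub>R \<psi> - \<phi>)"
  have D\<phi>: "D \<phi> \<phi>1" "D \<phi>1 \<phi>2" and v_eq: "v = \<phi>2 - n *\<^sub>R \<phi>"
    using h\<phi> by (auto simp: helmholtz_def)
  have "helmholtz n y ((1 - \<mu>) *\<^sub>R \<psi> - \<phi>) ((1 - \<mu>) *\<^sub>R \<psi>1 - \<phi>1) ((1 - \<mu>) *\<^sub>R \<psi>2 - \<phi>2)"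
    unfolding helmholtz_def
    by (intro conjI D_diff D_scale D\<psi> D\<phi>) (simp only: y_def u_eq v_eq, simp add: algebra_simps)
  then have nBy: "norm By \<le> norm y" unfolding By_def using helmholtz_le(3) n1 by blast
  have ny: "norm y \<le> (1 - \<mu>) * norm u + norm v"
    using norm_triangle_ineq4[of "(1 - \<mu>) *\<^sub>R u" v] \<mu> by (simp add: y_def)
  have By: "By = (1 - \<mu>) *\<^sub>R w - v - \<phi>" by (simp add: By_def y_def w algebra_simps)
  \<comment> \<open>All three terms of \<open>By\<close> are harmless: \<open>w\<close> by skewness
    of the transport part, \<open>v\<close> because \<open>J\<close> is skew, and
    \<open>\<phi>\<close> because the inverse of A is symmetric and commutes with
    \<open>J\<close>.\<close>
  have Jv: "inner (J v) By = 0"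
    using helmholtz_J[OF h\<phi>] by (simp add: By ip_simps inner_Jv_w inner_J_self)
  let ?Au = "u2 - n *\<^sub>R u"
  have "inner u2 \<phi> = inner u \<phi>2" using ibp[OF Du(2) D\<phi>(1)] ibp[OF Du(1) D\<phi>(2)] by simp
  then have A\<phi>: "inner ?Au \<phi> = inner u v" by (simp add: v_eq ip_simps)
  have p0: "inner ?Au p = 0" using ibp[OF Du(2) Dp] p_u by (simp add: ip_simps inner_commute)
  have Dw1: "D w1 (u2 + \<psi>2)" unfolding w1 by (intro D_add Du D\<psi>)
  have w1C: "inner (C w) w1 = inner (S w) w / 2" by (rule ibp_C[OF Dw])
  have "inner (u2 + \<psi>2) (S w) = - inner w1 (C w + S w1)" by (rule ibp[OF Dw1 D_S[OF Dw]])
  then have w2S: "inner (u2 + \<psi>2) (S w) = - inner (S w) w / 2 - inner (S w1) w1"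
    using w1C by (simp add: ip_simps inner_commute)
  have w2w: "inner (u2 + \<psi>2) w = - (norm w1)\<^sup>2" using ibp[OF Dw1 Dw] by (simp add: power2_norm_eq_inner)
  have Au: "?Au = (u2 + \<psi>2) - n *\<^sub>R w - u" by (simp add: w u_eq algebra_simps)
  have Auw: "inner ?Au w = - (norm w1)\<^sup>2 - n * (norm w)\<^sup>2 - inner u w"
    unfolding Au using w2w by (simp add: ip_simps power2_norm_eq_inner)
  have AuS: "inner ?Au (S w) = - inner (S w) w / 2 - inner (S w1) w1 - n * inner (S w) w - inner u (S w)"
    unfolding Au using w2S by (simp add: ip_simps inner_commute)
  have Auu: "inner ?Au u = inner ?Au w - inner u u"
    using inner_Au_\<psi> by (simp add: w inner_add_right power2_norm_eq_inner)
  have "inner ?Au By = (1 - \<mu>) * inner ?Au w - inner ?Au v - inner u v"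
    unfolding By by (simp add: inner_diff_right A\<phi>)
  also have "inner ?Au v = inner ?Au (S w) - \<mu> * inner ?Au u"
    unfolding v by (simp add: inner_diff_right[of ?Au] p0)
  also have "inner u v = inner u (S w) - \<mu> * inner u u"
    using p_u by (simp add: v ip_simps inner_commute)
  \<comment> \<open>The terms with \<mu> have cancelled, as \<open>y\<close> equals
    \<open>u - S w + p\<close>. The weight 1 - sin appears on both \<open>w1\<close> and
    \<open>w\<close>. The leftover half of \<open><S w, w>\<close>, produced by differentiating the
    weight, is absorbed by \<open><u, w> >= |w|^2\<close>.\<close>
  finally have "inner ?Au By = - ((norm w1)\<^sup>2 - inner (S w1) w1) - n * ((norm w)\<^sup>2 - inner (S w) w)
      + inner (S w) w / 2 - inner u w"
    unfolding Auu AuS Auw by (simp add: algebra_simps)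
  moreover have "inner f By = inner ?Au By" by (simp add: f inner_diff_left[of ?Au] Jv)
  moreover have "inner (S w) w \<le> (norm w)\<^sup>2" using inner_S_le[of w] by linarith
  moreover have "0 \<le> n * ((norm w)\<^sup>2 - inner (S w) w)" using calculation(3) n1 by simp
  moreover have "- inner f By \<le> norm f * norm By" using Cauchy_Schwarz_ineq2[of f By] by linarith
  moreover have "norm f * norm By \<le> norm f * ((1 - \<mu>) * norm u + norm v)"
    using nBy ny by (intro mult_left_mono) auto
  moreover have "0 \<le> (norm w)\<^sup>2" by simp
  ultimately have "(norm w1)\<^sup>2 - inner (S w1) w1 \<le> norm f * ((1 - \<mu>) * norm u + norm v)"
    using w_le(1) by linarith
  then show ?thesis using norm_C_le_gap[of w1] by simp
qed

text \<open>If \<open>v\<close> were just \<open>(sin - \<mu>) w\<close>, the term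
  \<open>- C w1\<close> would give |w|^2 the weight (cos^2 - sin^2 + \<mu> sin)/2. Adding 3/2 sin
  cancels the negative sin^2 and leaves (1 + sin^2)/2 - \<mu> sin. Subtracting \<kappa> adds
  \<kappa> (\<mu> - sin) and, through the nonlocal part, the positive multiple \<kappa> \<mu> of
  |\<psi>'|^2.\<close>

definition multiplier :: "real \<Rightarrow> 'a" where
  "multiplier \<kappa> = (3/2) *\<^sub>R S w - \<kappa> *\<^sub>R w - C w1"

lemma inner_C\<psi>1_w: "inner (C \<psi>1) w = (inner (S \<psi>1) \<psi>1 - (n - 1) * inner (S \<psi>) \<psi>) / 2"
proof -
  have "inner (C \<psi>1) \<psi> = inner (S \<psi>) \<psi> / 2" using ibp_C[OF D\<psi>(1)] C_sym[of \<psi> \<psi>1] by (simp add: inner_commute)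
  moreover have "inner (C \<psi>1) w = inner (C \<psi>1) \<psi>2 - (n - 1) * inner (C \<psi>1) \<psi>"
    by (simp add: w u_eq ip_simps algebra_simps)
  ultimately show ?thesis using ibp_C[OF D\<psi>(2)] by (simp add: field_simps)
qed

text \<open>Substituting \<open>u = w - \<psi>\<close> splits \<open>v\<close> into the local part
  \<open>(S - \<mu>) w\<close> and the corrections \<open>\<mu> \<psi>\<close> and
  \<open>- p\<close>. Every product then integrates by parts to a form without derivatives of
  \<open>w\<close>; \<open>\<psi>2 = w + (n - 1) \<psi>\<close> eliminates the second
  derivative.\<close>

lemma inner_v_multiplier:
  "inner v (multiplier \<kappa>) = (norm w)\<^sup>2 - (norm (C w))\<^sup>2 / 2 - (\<kappa> + \<mu>) * inner (S w) w + \<kappa> * \<mu> * (norm w)\<^sup>2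
     + \<mu> * (\<kappa> * (norm \<psi>1)\<^sup>2 + (n - 1) * (\<kappa> * (norm \<psi>)\<^sup>2 - inner (S \<psi>) \<psi>) - inner (S \<psi>) \<psi> / 4)
     - (norm p)\<^sup>2 / 2"
proof -
  have vw: "v = S w - \<mu> *\<^sub>R w + \<mu> *\<^sub>R \<psi> - p" by (simp add: v w algebra_simps)
  have SC: "inner (S w) (C w1) = ((norm w)\<^sup>2 - 2 * (norm (C w))\<^sup>2) / 2"
    using ibp_S_C[OF Dw] norm_S_C[of w] by simp
  have SS: "inner (S w) (S w) = (norm w)\<^sup>2 - (norm (C w))\<^sup>2"
    using norm_S_C[of w] by (simp add: power2_norm_eq_inner)
  have wC: "inner w (C w1) = inner (S w) w / 2" using ibp_C[OF Dw] C_sym[of w w1] by simp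
  have \<psi>w: "\<psi>2 = w + (n - 1) *\<^sub>R \<psi>" by (simp add: w u_eq algebra_simps)
  have "inner \<psi>2 \<psi> = - (norm \<psi>1)\<^sup>2" using ibp[OF D\<psi>(2) D\<psi>(1)] by (simp add: power2_norm_eq_inner)
  then have \<psi>_w: "inner \<psi> w = - (norm \<psi>1)\<^sup>2 - (n - 1) * (norm \<psi>)\<^sup>2"
    unfolding \<psi>w by (simp add: ip_simps power2_norm_eq_inner inner_commute)
  have "inner (S \<psi>) \<psi>2 = - inner (C \<psi> + S \<psi>1) \<psi>1"
    using ibp[OF D_S[OF D\<psi>(1)] D\<psi>(2)] by simp
  then have "inner (S \<psi>) \<psi>2 = - inner (S \<psi>) \<psi> / 2 - inner (S \<psi>1) \<psi>1"
    using ibp_C[OF D\<psi>(1)] by (simp add: ip_simps)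
  then have S\<psi>w: "inner (S \<psi>) w = - inner (S \<psi>) \<psi> / 2 - inner (S \<psi>1) \<psi>1 - (n - 1) * inner (S \<psi>) \<psi>"
    unfolding \<psi>w by (simp add: ip_simps)
  have "inner (C \<psi>1 - S \<psi>) w = - inner (C \<psi>) w1" by (rule ibp[OF D_C[OF D\<psi>(1)] Dw])
  then have \<psi>C: "inner \<psi> (C w1) = inner (S \<psi>) w - inner (C \<psi>1) w" using C_sym[of \<psi> w1] by (simp add: ip_simps)
  have pC: "inner p (C w1) = (norm p)\<^sup>2"
    using ibp[OF D_C[OF Dw] Dp] p_S by (simp add: ip_simps inner_commute power2_norm_eq_inner)
  have pS: "inner p (S w) = (norm p)\<^sup>2" by (simp add: p_S power2_norm_eq_inner)
  have pw: "inner p w = 0" using p_u by (simp add: w ip_simps)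
  have "inner w w = (norm w)\<^sup>2" by (simp add: power2_norm_eq_inner)
  moreover have "inner \<psi> (S w) = inner (S \<psi>) w" "inner w (S w) = inner (S w) w" by (simp_all add: S_sym)
  ultimately show ?thesis
    unfolding multiplier_def vw
    by (simp add: ip_simps SC SS wC \<psi>C pC pS pw \<psi>_w S\<psi>w inner_C\<psi>1_w) (simp add: field_simps)
qed

text \<open>As \<open>p\<close> is constant and sin^2 has mean 1/2, |S p|^2 = |p|^2 / 2. The first
  bound expands the square of \<open>w - 2 S p\<close>; the second is \<open>I - S >= 0\<close>
  applied to \<open>w + p\<close>.\<close>

lemma mean_bounds: "2 * (norm p)\<^sup>2 \<le> (norm w)\<^sup>2" "(norm p)\<^sup>2 \<le> (norm w)\<^sup>2 - inner (S w) w"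
proof -
  have "inner (C p) (C p) = inner (S p) (S p)"
    using ibp[OF D_S[OF Dp] D_C[OF Dp]] by (simp add: linear_0[OF linear_S] linear_0[OF linear_C])
  then have Sp: "(norm (S p))\<^sup>2 = (norm p)\<^sup>2 / 2"
    using norm_S_C[of p] by (simp add: power2_norm_eq_inner)
  have "inner w (S p) = (norm p)\<^sup>2" using p_S S_sym[of w p] by (simp add: inner_commute power2_norm_eq_inner)
  then have "(norm (w - 2 *\<^sub>R S p))\<^sup>2 = (norm w)\<^sup>2 - 2 * (norm p)\<^sup>2"
    using Sp by (simp add: power2_norm_eq_inner ip_simps inner_commute)
  then show "2 * (norm p)\<^sup>2 \<le> (norm w)\<^sup>2" using zero_le_power2[of "norm (w - 2 *\<^sub>R S p)"] by linarith
  have "inner (S p) p = 0" using ibp_C[OF Dp] by simp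
  moreover have "inner p w = 0" using p_u by (simp add: w ip_simps)
  moreover have "inner (S w) p = (norm p)\<^sup>2" "inner (S p) w = (norm p)\<^sup>2"
    using p_S S_sym[of p w] by (simp_all add: inner_commute power2_norm_eq_inner)
  ultimately have "(norm (w + p))\<^sup>2 - inner (S (w + p)) (w + p) = (norm w)\<^sup>2 - inner (S w) w - (norm p)\<^sup>2"
    by (simp add: S_simps ip_simps power2_norm_eq_inner inner_commute)
  then show "(norm p)\<^sup>2 \<le> (norm w)\<^sup>2 - inner (S w) w" using inner_S_le[of "w + p"] by linarith
qed

definition layer_energy :: real where
  "layer_energy = (1 - \<mu>) * (norm w)\<^sup>2 + (norm (C w))\<^sup>2 + (norm \<psi>1)\<^sup>2"

text \<open>For \<open>\<mu> = 0\<close> the weight of \<open>\<bar>w\<bar>\<^sup>2\<close> in \<open>inner_v_multiplier\<close> is \<open>(sin - \<kappa>)\<^sup>2/2 + (1 - \<kappa>\<^sup>2)/2\<close>, for \<open>\<mu> = 1\<close>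
  it is \<open>(1 - sin)\<^sup>2/2 + \<kappa> (1 - sin)\<close>, and it is affine in \<open>\<mu>\<close>.\<close>

lemma multiplier_coercive:
  assumes \<mu>: "0 \<le> \<mu>" "\<mu> \<le> 1"
  obtains \<kappa> where "0 \<le> \<kappa>" "\<kappa> \<le> 9/10" "layer_energy \<le> 80 * inner v (multiplier \<kappa>)"
proof -
  let ?a = "(norm w)\<^sup>2" and ?s = "inner (S w) w" and ?c = "(norm (C w))\<^sup>2" and ?d = "(norm \<psi>1)\<^sup>2"
    and ?q = "(n - 1) * (norm \<psi>)\<^sup>2" and ?r = "(n - 1) * inner (S \<psi>) \<psi>" and ?P = "(norm p)\<^sup>2"
  define E0 where "E0 \<kappa> = ?a - ?c / 2 - \<kappa> * ?s - ?P / 2" for \<kappa>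
  define E1 where "E1 \<kappa> = ?a - ?c / 2 - (\<kappa> + 1) * ?s + \<kappa> * ?a + \<kappa> * ?d + \<kappa> * ?q - ?r - inner (S \<psi>) \<psi> / 4 - ?P / 2" for \<kappa>
  have split: "inner v (multiplier \<kappa>) = (1 - \<mu>) * E0 \<kappa> + \<mu> * E1 \<kappa>" for \<kappa>
    unfolding inner_v_multiplier E0_def E1_def
    by (simp add: algebra_simps add_divide_distrib diff_divide_distrib)
  have sq: "0 \<le> ?a - ?c - 2 * \<kappa> * ?s + \<kappa>\<^sup>2 * ?a" for \<kappa>
  proof -
    have "(norm (S w - \<kappa> *\<^sub>R w))\<^sup>2 = ?a - ?c - 2 * \<kappa> * ?s + \<kappa>\<^sup>2 * ?a"
      using norm_S_C[of w] by (simp add: power2_norm_eq_inner ip_simps inner_commute power2_eq_square[of \<kappa>])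
    then show ?thesis by (metis zero_le_power2)
  qed
  have gap: "?c \<le> 2 * (?a - ?s)" by (rule norm_C_le_gap)
  have c: "0 \<le> ?c" "0 \<le> ?d" "0 \<le> ?a" "0 \<le> ?P" by simp_all
  have S\<psi>: "inner (S \<psi>) \<psi> \<le> (norm \<psi>)\<^sup>2" using inner_S_le[of \<psi>] by linarith
  \<comment> \<open>At \<mu> = 0 the weight leaves (1 - \<kappa>^2)/2 of |w|^2. For n >= 4 a large
    \<kappa> is wanted to absorb the nonlocal terms, and 9/10 leaves 19/200. For n = 1 the factor n
    - 1 removes most nonlocal terms, but the mean costs up to 1/4, and 3/5 leaves 8/25 - 1/4 =
    7/100.\<close>
  obtain \<kappa> where \<kappa>: "0 \<le> \<kappa>" "\<kappa> \<le> 9/10" "?a / 20 \<le> E0 \<kappa>" "(?c + ?d) / 20 \<le> E1 \<kappa>"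
  proof (cases "4 \<le> n")
    case True
    then have P: "?P = 0" using n by auto
    \<comment> \<open>The bound \<open>?r <= ?q\<close> alone is too weak for \<kappa> < 1. This
      identity bounds \<open>?r\<close> by \<open>\<psi>1\<close> and \<open>C w\<close> with
      constants independent of n.\<close>
    have "?r = inner (S \<psi>1) \<psi>1 - 2 * inner \<psi>1 (C w)"
      using inner_C\<psi>1_w C_sym[of \<psi>1 w] by simp
    moreover have "inner (S \<psi>1) \<psi>1 \<le> ?d" using inner_S_le[of \<psi>1] by linarith
    moreover have "- 2 * inner \<psi>1 (C w) \<le> ?d + ?c"
      using zero_le_power2[of "norm (\<psi>1 + C w)"] by (simp add: power2_norm_eq_inner ip_simps inner_commute)
    ultimately have r: "?r \<le> 2 * ?d + ?c" by linarith
    have "3 * (norm \<psi>)\<^sup>2 \<le> ?q" using True by (intro mult_right_mono) auto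
    moreover have "?r \<le> ?q" using True S\<psi> by (intro mult_left_mono) auto
    moreover have E1: "E1 (9/10) = (?a - ?c - 2 * ?s + ?a) / 2 + 9/10 * (?a - ?s) + 9/10 * ?d + 9/10 * ?q - ?r
        - inner (S \<psi>) \<psi> / 4" unfolding E1_def by (simp add: P field_simps)
    moreover have "0 \<le> ?a - ?c - 2 * ?s + ?a" using sq[of 1] by simp
    \<comment> \<open>Mix the two bounds for \<open>r\<close>: weight 9/10 - 1/12 on
      \<open>r <= q\<close> uses up all of \<open>q\<close> left after paying \<open>t / 4\<close>,
      and the remaining weight on \<open>r <= 2 d + c\<close> is small enough for the
      \<open>c\<close> and \<open>d\<close> terms.\<close>
    moreover have "(c + d) / 20 \<le> (a - c - 2 * s + a) / 2 + 9/10 * (a - s) + 9/10 * d + 9/10 * q - r - t / 4"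
      if "3 * e \<le> q" "r \<le> q" "r \<le> 2 * d + c" "t \<le> e" "0 \<le> a - c - 2 * s + a" "c \<le> 2 * (a - s)" "0 \<le> c" "0 \<le> d"
      for a c d q r s t e :: real
      using that by argo
    ultimately have "(?c + ?d) / 20 \<le> E1 (9/10)"
      using r S\<psi> gap c(1,2) by presburger
    moreover have "?a / 20 \<le> E0 (9/10)"
    proof -
      have "0 \<le> ?a - ?c - 9/5 * ?s + 81/100 * ?a"
        using sq[of "9/10"] unfolding power2_eq_square[of "9/10"] by simp
      then show ?thesis using c P unfolding E0_def by argo
    qed
    ultimately show thesis by (intro that[of "9/10"]) auto
  next
    case False
    then have "n = 1" "norm \<psi> \<le> norm \<psi>1" using n by auto
    then have q: "?q = 0" "?r = 0" "(norm \<psi>)\<^sup>2 \<le> ?d" by (auto intro: power_mono)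
    have "E1 (3/5) = (?a - ?c - 2 * ?s + ?a) / 2 + 3/5 * (?a - ?s) + 3/5 * ?d
        - inner (S \<psi>) \<psi> / 4 - ?P / 2" unfolding E1_def q by (simp add: field_simps)
    moreover have "0 \<le> ?a - ?c - 2 * ?s + ?a" using sq[of 1] by simp
    ultimately have "(?c + ?d) / 20 \<le> E1 (3/5)"
      using q(3) S\<psi> gap c(1,2) mean_bounds(2) by argo
    moreover have "?a / 20 \<le> E0 (3/5)"
    proof -
      have "0 \<le> ?a - ?c - 6/5 * ?s + 9/25 * ?a"
        using sq[of "3/5"] unfolding power2_eq_square[of "3/5"] by simp
      then show ?thesis using c mean_bounds(1) unfolding E0_def by argo
    qed
    ultimately show thesis by (intro that[of "3/5"]) auto
  qed
  \<comment> \<open>This turns the bound by \<open>?a\<close> at \<mu> = 0 into one by the whole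
    energy: 80 times \<open>?a / 20\<close> is 4 \<open>?a\<close>, which is the origin of the
    factor 80.\<close>
  have cd: "?c + ?d \<le> 3 * ?a"
  proof -
    have "?c \<le> ?a" using norm_S_C[of w] zero_le_power2[of "norm (S w)"] by linarith
    moreover have "0 \<le> n * (norm \<psi>)\<^sup>2" using n1 by simp
    moreover have "(norm u)\<^sup>2 \<le> 4 * (norm w)\<^sup>2"
      using power_mono[OF w_gap(3) norm_ge_zero, of 2] by (simp add: power_mult_distrib)
    ultimately show ?thesis using w_gap(1) by linarith
  qed
  have E0: "?a + (?c + ?d) \<le> 80 * E0 \<kappa>" and E1: "?c + ?d \<le> 80 * E1 \<kappa>"
    using \<kappa>(3,4) cd c by argo+
  have "layer_energy = (1 - \<mu>) * (?a + (?c + ?d)) + \<mu> * (?c + ?d)" by (simp add: layer_energy_def algebra_simps)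
  also have "\<dots> \<le> (1 - \<mu>) * (80 * E0 \<kappa>) + \<mu> * (80 * E1 \<kappa>)"
    using \<mu> E0 E1 by (intro add_mono mult_left_mono) auto
  also have "\<dots> = 80 * inner v (multiplier \<kappa>)" by (simp add: split algebra_simps)
  finally show thesis using that \<kappa> by blast
qed

text \<open>The equation gives \<open>b v = J (f - A u)\<close>, so the coercive form is paid for by
  Cauchy-Schwarz. This is where \<open>u''\<close> and \<open>cos w'\<close> enter as errors. The 3
  covers 3/2 + 9/10 from the other two terms of the multiplier.\<close>

lemma layer_energy_bound:
  assumes \<mu>: "0 \<le> \<mu>" "\<mu> \<le> 1"
  shows "\<bar>b\<bar> * layer_energy \<le> 80 * ((norm f + norm u2 + n * norm u) * (norm (C w1) + 3 * norm u))"
proof -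
  obtain \<kappa> where \<kappa>: "0 \<le> \<kappa>" "\<kappa> \<le> 9/10" "layer_energy \<le> 80 * inner v (multiplier \<kappa>)"
    by (rule multiplier_coercive[OF \<mu>])
  let ?Z = "multiplier \<kappa>"
  have "norm ?Z \<le> norm ((3/2) *\<^sub>R S w) + norm (\<kappa> *\<^sub>R w) + norm (C w1)"
    unfolding multiplier_def
    using norm_triangle_ineq4[of "(3/2) *\<^sub>R S w - \<kappa> *\<^sub>R w" "C w1"] norm_triangle_ineq4[of "(3/2) *\<^sub>R S w" "\<kappa> *\<^sub>R w"]
    by linarith
  moreover have "norm (\<kappa> *\<^sub>R w) \<le> 9/10 * norm w" "norm ((3/2) *\<^sub>R S w) \<le> 3/2 * norm w"
    using \<kappa>(1,2) norm_S_le[of w] mult_right_mono[OF \<kappa>(2) norm_ge_zero[of w]] by simp_all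
  ultimately have Z: "norm ?Z \<le> norm (C w1) + 3 * norm u"
    using w_le(3) norm_ge_zero[of w] by linarith
  have "b *\<^sub>R v = J (f - (u2 - n *\<^sub>R u))" by (simp add: f linear_neg[OF linear_J] J_simps J_J)
  then have "b * inner v ?Z = inner (J (f - (u2 - n *\<^sub>R u))) ?Z" by (metis inner_scaleR_left)
  also have "\<bar>\<dots>\<bar> \<le> norm (f - (u2 - n *\<^sub>R u)) * norm ?Z"
    using Cauchy_Schwarz_ineq2 by (metis norm_J)
  also have "\<dots> \<le> (norm f + norm u2 + n * norm u) * (norm (C w1) + 3 * norm u)"
    using norm_triangle_ineq4[of f "u2 - n *\<^sub>R u"] norm_triangle_ineq4[of u2 "n *\<^sub>R u"] n1
    by (intro mult_mono Z) auto
  finally have "\<bar>b * inner v ?Z\<bar> \<le> (norm f + norm u2 + n * norm u) * (norm (C w1) + 3 * norm u)" .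
  moreover have "0 \<le> inner v ?Z"
    using \<kappa>(3) \<mu> unfolding layer_energy_def by (smt (verit) mult_nonneg_nonneg zero_le_power2)
  moreover have "\<bar>b\<bar> * layer_energy \<le> \<bar>b\<bar> * (80 * inner v ?Z)" by (intro mult_left_mono \<kappa>(3)) auto
  ultimately show ?thesis by (simp add: abs_mult)
qed

text \<open>The cosine vanishes where the layer sits, so \<open>C w\<close> alone does not control
  \<open>w\<close>. One integration by parts against sin cos recovers \<open>w\<close> at the cost
  of a derivative.\<close>

lemma norm_w_interpolation: "(norm w)\<^sup>2 \<le> 2 * (norm (C w))\<^sup>2 + 2 * norm (C w) * norm w1"
proof -
  have "inner (S w) (C w1) = inner (S (C w)) w1" by (simp add: S_C C_sym)
  also have "\<dots> \<le> norm (C w) * norm w1"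
    using Cauchy_Schwarz_ineq2[of "S (C w)" w1] mult_right_mono[OF norm_S_le[of "C w"] norm_ge_zero[of w1]] by linarith
  finally show ?thesis using ibp_S_C[OF Dw] norm_S_C[of w] by simp
qed

text \<open>The width \<open>\<epsilon>\<close> of the critical layer balances the dissipation \<open>\<epsilon>\<^sup>-\<^sup>2\<close> against the shear \<open>\<bar>b\<bar> \<delta> \<epsilon>\<close>.\<close>

lemma subcritical_bound:
  assumes h\<phi>: "helmholtz n v \<phi> \<phi>1 \<phi>2" and \<mu>: "0 \<le> \<mu>" "\<mu> \<le> 1"
    and \<epsilon>: "0 < \<epsilon>" "\<epsilon> \<le> \<delta>" "\<delta> \<le> 1" and b: "\<bar>b\<bar> * (\<epsilon>^3 * \<delta>) = 1"
    and \<delta>: "1 - \<mu> = \<delta>\<^sup>2 \<or> \<delta> = \<epsilon> \<and> 1 - \<mu> \<le> \<delta>\<^sup>2"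
  shows "norm u \<le> 10^24 * \<epsilon>\<^sup>2 * norm f"
proof (cases "norm u = 0")
  case True
  then show ?thesis by simp
next
  case False
  let ?N = "norm u" and ?F = "norm f" and ?T = "sqrt layer_energy"
  have X: "0 \<le> layer_energy" using \<mu> by (simp add: layer_energy_def)
  have mw: "0 \<le> (1 - \<mu>) * (norm w)\<^sup>2" using \<mu> by simp
  have Cw: "norm (C w) \<le> ?T" "norm \<psi>1 \<le> ?T"
    using mw by (auto intro!: real_le_rsqrt simp: layer_energy_def)
  have G: "?F + norm u2 + n * ?N \<le> 3 * ?F + norm u2" using energy_bound(2) by linarith
  show ?thesis
  proof (rule absorption[OF _ _ _ _ _ _ _ \<epsilon> b])
    show "0 < ?N" using False by simp
    show "1 - \<mu> \<le> \<delta>\<^sup>2" using \<delta> by auto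
    show "(norm u1)\<^sup>2 \<le> ?F * ?N" by (rule energy_bound)
    have "\<bar>b\<bar> * (norm (C w) + norm \<psi>1) * norm u1 \<le> \<bar>b\<bar> * (2 * ?T) * norm u1"
      using Cw by (intro mult_right_mono mult_left_mono) auto
    then show "(norm u2)\<^sup>2 \<le> ?F * norm u2 + \<bar>b\<bar> * (2 * ?T) * norm u1"
      using elliptic_bound by linarith
    show "(norm (C w1))\<^sup>2 \<le> 2 * ?F * ((1 - \<mu>) * ?N + norm v)"
      by (rule weighted_dissipation[OF h\<phi> \<mu>(2)])
    show "\<bar>b\<bar> * norm v \<le> 3 * ?F + norm u2" using v_bound G by linarith
    have "(?F + norm u2 + n * ?N) * (norm (C w1) + 3 * ?N) \<le> (3 * ?F + norm u2) * (norm (C w1) + 3 * ?N)"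
      by (intro mult_right_mono G) simp
    then show "\<bar>b\<bar> * ?T\<^sup>2 \<le> 80 * ((3 * ?F + norm u2) * (norm (C w1) + 3 * ?N))"
      using layer_energy_bound[OF \<mu>] X by simp
    have Nw: "?N\<^sup>2 \<le> 4 * (norm w)\<^sup>2"
      using power_mono[OF w_gap(3) norm_ge_zero, of 2] by (simp add: power_mult_distrib)
    \<comment> \<open>A lower bound of the layer energy in terms of \<open>u\<close>. Away from the
      critical value the weight 1 - \<mu> = \<delta>^2 provides it; in the merged layer this weight
      may vanish and interpolation takes over. The factors 1/2 and 1/4 stem from
      \<open>|u| <= 2 |w|\<close>.\<close>
    show "?N * \<delta> / 2 \<le> ?T \<or> \<delta> = \<epsilon> \<and> ?N\<^sup>2 / 4 \<le> 2 * ?T\<^sup>2 + 2 * ?T * (norm u1 + ?N)"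
      using \<delta>
    proof
      assume d: "1 - \<mu> = \<delta>\<^sup>2"
      have "(?N * \<delta> / 2)\<^sup>2 = \<delta>\<^sup>2 * (?N\<^sup>2 / 4)" by (simp add: power_divide power_mult_distrib)
      also have "\<dots> \<le> \<delta>\<^sup>2 * (norm w)\<^sup>2" using Nw by (intro mult_left_mono) auto
      also have "\<dots> \<le> layer_energy" by (simp add: layer_energy_def d)
      finally show ?thesis by (intro disjI1 real_le_rsqrt)
    next
      assume d: "\<delta> = \<epsilon> \<and> 1 - \<mu> \<le> \<delta>\<^sup>2"
      have "norm w1 \<le> norm u1 + ?N" unfolding w1 using norm_triangle_ineq[of u1 \<psi>1] w_gap(5) by linarith
      then have "norm (C w) * norm w1 \<le> ?T * (norm u1 + ?N)"
        using Cw X by (intro mult_mono) auto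
      moreover have "(norm (C w))\<^sup>2 \<le> ?T\<^sup>2" using Cw by (intro power_mono) auto
      ultimately have "(norm w)\<^sup>2 \<le> 2 * ?T\<^sup>2 + 2 * ?T * (norm u1 + ?N)"
        using norm_w_interpolation by linarith
      moreover have "?N\<^sup>2 / 4 \<le> (norm w)\<^sup>2" using Nw by simp
      ultimately show ?thesis using d order_trans by blast
    qed
  qed (use X in auto)
qed

end

section \<open>The operators of the Kolmogorov flow\<close>

lemma fourier_coeff_uminus: "fourier_coeff (- f) k = - fourier_coeff f k"
  using fourier_coeff_diff[of 0 f k] by (simp add: fourier_coeff_zero)

lemma norm_scaleC: "norm (scaleC c f) = cmod c * norm f"
proof -
  have "of_real ((norm (scaleC c f))\<^sup>2) = c * cnj c * cinner f f"
    unfolding cinner_self[symmetric] cinner_scaleC_left cinner_scaleC_right by simp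
  also have "\<dots> = of_real ((cmod c * norm f)\<^sup>2)"
    unfolding cinner_self power_mult_distrib of_real_mult complex_norm_square ..
  finally have "(norm (scaleC c f))\<^sup>2 = (cmod c * norm f)\<^sup>2" by (simp only: of_real_eq_iff)
  then show ?thesis by (rule power2_eq_imp_eq) simp_all
qed

text \<open>Changing the sign of sine and cosine together is a translation by half a period, which
  is why both signs satisfy the same identities.\<close>

lemma shear_calculus_l2:
  assumes \<sigma>: "\<sigma> = 1 \<or> \<sigma> = (- 1 :: real)"
  shows "shear_calculus (\<lambda>x. \<sigma> *\<^sub>R sin_op x) (\<lambda>x. \<sigma> *\<^sub>R cos_op x) (scaleC \<i>) has_weak_deriv"
proof -
  note fc = fourier_coeff_scaleC fourier_coeff_scaleR fourier_coeff_add fourier_coeff_diff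
    fourier_coeff_sin_op fourier_coeff_cos_op fourier_coeff_uminus
  have \<sigma>2: "\<sigma> * \<sigma> = 1" using \<sigma> by auto
  have lin: "linear (\<lambda>x. \<sigma> *\<^sub>R sin_op x)" "linear (\<lambda>x. \<sigma> *\<^sub>R cos_op x)" "linear (scaleC \<i>)"
    by (auto intro!: linearI fourier_coeff_eqI simp: fc field_simps)
  note sinl = linear_scale[OF lin(1)] and cosl = linear_scale[OF lin(2)]
  show ?thesis
  proof (rule shear_calculus.intro)
    fix x y f g f' g' h k :: l2 and r :: real
    show "linear (\<lambda>x. \<sigma> *\<^sub>R sin_op x)" "linear (\<lambda>x. \<sigma> *\<^sub>R cos_op x)" "linear (scaleC \<i>)" by (rule lin)+
    have "inner (sin_op x) y = inner x (sin_op y)"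
      by (simp add: inner_l2_def cinner_mult_op[OF bounded_multiplier_sin])
    then show "inner (\<sigma> *\<^sub>R sin_op x) y = inner x (\<sigma> *\<^sub>R sin_op y)" by simp
    have "inner (cos_op x) y = inner x (cos_op y)"
      by (simp add: inner_l2_def cinner_mult_op[OF bounded_multiplier_cos])
    then show "inner (\<sigma> *\<^sub>R cos_op x) y = inner x (\<sigma> *\<^sub>R cos_op y)" by simp
    show "inner (scaleC \<i> x) y = - inner x (scaleC \<i> y)"
      by (simp add: inner_l2_def cinner_scaleC_left cinner_scaleC_right)
    show "scaleC \<i> (scaleC \<i> x) = - x" by (rule fourier_coeff_eqI) (simp add: fc)
    show "scaleC \<i> (\<sigma> *\<^sub>R sin_op x) = \<sigma> *\<^sub>R sin_op (scaleC \<i> x)"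
      by (rule fourier_coeff_eqI) (simp add: fc algebra_simps)
    have 1: "\<sigma> *\<^sub>R sin_op (\<sigma> *\<^sub>R z) = sin_op z" "\<sigma> *\<^sub>R cos_op (\<sigma> *\<^sub>R z) = cos_op z" for z
      using sinl[of \<sigma> z] cosl[of \<sigma> z] \<sigma>2 by simp_all
    show "\<sigma> *\<^sub>R sin_op (\<sigma> *\<^sub>R cos_op x) = \<sigma> *\<^sub>R cos_op (\<sigma> *\<^sub>R sin_op x)"
      unfolding 1 by (rule sin_cos_op)
    show "\<sigma> *\<^sub>R sin_op (\<sigma> *\<^sub>R sin_op x) + \<sigma> *\<^sub>R cos_op (\<sigma> *\<^sub>R cos_op x) = x"
      unfolding 1 by (rule sin_cos_op)
    show "has_weak_deriv f g \<Longrightarrow> has_weak_deriv f' g' \<Longrightarrow> has_weak_deriv (f + f') (g + g')"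
      by (rule has_weak_deriv_add)
    show "has_weak_deriv f g \<Longrightarrow> has_weak_deriv (r *\<^sub>R f) (r *\<^sub>R g)" by (rule has_weak_deriv_scaleR)
    show "has_weak_deriv f g \<Longrightarrow> has_weak_deriv (scaleC \<i> f) (scaleC \<i> g)" by (rule has_weak_deriv_scaleC)
    show "has_weak_deriv (\<sigma> *\<^sub>R sin_op f) (\<sigma> *\<^sub>R cos_op f + \<sigma> *\<^sub>R sin_op g)" if "has_weak_deriv f g"
      using has_weak_deriv_scaleR[OF has_weak_deriv_sin_op[OF that], of \<sigma>] by (simp add: scaleR_add_right)
    show "has_weak_deriv (\<sigma> *\<^sub>R cos_op f) (\<sigma> *\<^sub>R cos_op g - \<sigma> *\<^sub>R sin_op f)" if "has_weak_deriv f g"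
      using has_weak_deriv_scaleR[OF has_weak_deriv_cos_op[OF that], of \<sigma>] by (simp add: scaleR_diff_right)
    show "has_weak_deriv f g \<Longrightarrow> has_weak_deriv h k \<Longrightarrow> inner g h = - inner f k" by (rule has_weak_deriv_ibp)
  qed
qed

section \<open>The inverse of A_l, the mean projection and the resolvent operator\<close>

definition A_inv :: "int \<Rightarrow> l2 \<Rightarrow> l2" where "A_inv l = inv_into W22 (A_op l)"

lemma A_inv:
  assumes "l \<noteq> 0"
  shows "A_inv l f \<in> W22" and "A_op l (A_inv l f) = f"
    and "fourier_coeff f k = - ((of_int k)\<^sup>2 + (of_int l)\<^sup>2) * fourier_coeff (A_inv l f) k"
proof -
  have "f \<in> A_op l ` W22" using A_op_bij[OF assms] by (simp add: bij_betw_def)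
  then show 1: "A_inv l f \<in> W22" and 2: "A_op l (A_inv l f) = f"
    unfolding A_inv_def by (auto intro: inv_into_into f_inv_into_f)
  show "fourier_coeff f k = - ((of_int k)\<^sup>2 + (of_int l)\<^sup>2) * fourier_coeff (A_inv l f) k"
    using fourier_coeff_A_op[OF 1, of l k] by (simp add: 2)
qed

lemma A_inv_eqI: "l \<noteq> 0 \<Longrightarrow> u \<in> W22 \<Longrightarrow> A_op l u = f \<Longrightarrow> A_inv l f = u"
  unfolding A_inv_def using A_op_bij[of l] by (auto simp: bij_betw_def)

lemma W22_diff: "f \<in> W22 \<Longrightarrow> g \<in> W22 \<Longrightarrow> f - g \<in> W22"
proof -
  assume "f \<in> W22" "g \<in> W22"
  then obtain f1 f2 g1 g2 where
      "has_weak_deriv f f1" "has_weak_deriv f1 f2" "has_weak_deriv g g1" "has_weak_deriv g1 g2"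
    unfolding W22_def by blast
  then have "has_weak_deriv (f - g) (f1 - g1)" "has_weak_deriv (f1 - g1) (f2 - g2)"
    by (simp_all add: has_weak_deriv_iff fourier_coeff_diff right_diff_distrib)
  then show "f - g \<in> W22" unfolding W22_def by blast
qed

lemma A_op_diff: "f \<in> W22 \<Longrightarrow> g \<in> W22 \<Longrightarrow> A_op l (f - g) = A_op l f - A_op l g"
  by (rule fourier_coeff_eqI) (simp add: W22_diff fourier_coeff_A_op fourier_coeff_diff algebra_simps)

lemma A_inv_diff: "l \<noteq> 0 \<Longrightarrow> A_inv l (f - g) = A_inv l f - A_inv l g"
  by (rule A_inv_eqI) (simp_all add: A_inv W22_diff A_op_diff)

definition mean_proj :: "int \<Rightarrow> l2 \<Rightarrow> l2" where
  "mean_proj l f = (if \<bar>l\<bar> = 1 then scaleC (fourier_coeff f 0) (fourier_basis 0) else 0)"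

lemma fourier_coeff_mean_proj:
  "fourier_coeff (mean_proj l f) k = (if \<bar>l\<bar> = 1 \<and> k = 0 then fourier_coeff f 0 else 0)"
  by (simp add: mean_proj_def fourier_coeff_scaleC fourier_coeff_basis fourier_coeff_zero)

lemma Q_proj_mean: "Q_proj l f = f - mean_proj l f"
  by (simp add: mean_proj_def Q_proj_eq Q_proj_eq_self)

lemma cinner_mean_proj: "cinner (mean_proj l f) g = (if \<bar>l\<bar> = 1 then fourier_coeff f 0 * cnj (fourier_coeff g 0) else 0)"
  by (simp add: mean_proj_def cinner_scaleC_left fourier_coeff_def cinner_commute[of g])

lemma norm_Q_proj_le: "norm (Q_proj l f) \<le> norm f"
proof -
  have "inner (mean_proj l f) f = inner (mean_proj l f) (mean_proj l f)"
    by (simp add: inner_l2_def cinner_mean_proj fourier_coeff_mean_proj)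
  then have "(norm f)\<^sup>2 - (norm (Q_proj l f))\<^sup>2 = (norm (mean_proj l f))\<^sup>2"
    by (simp add: Q_proj_mean power2_norm_eq_inner inner_diff_left inner_diff_right inner_commute)
  then have "(norm (Q_proj l f))\<^sup>2 \<le> (norm f)\<^sup>2" using zero_le_power2[of "norm (mean_proj l f)"] by linarith
  then show ?thesis by (rule power2_le_imp_le) simp
qed

definition resolvent_op :: "int \<Rightarrow> real \<Rightarrow> real \<Rightarrow> l2 \<Rightarrow> l2" where
  "resolvent_op l \<alpha> lam u = scaleC (\<i> * complex_of_real lam) u + Q_proj l (L_op \<alpha> l u)"

text \<open>The bounded part of the operator. It is homogeneous in (\<alpha>, \<lambda>), so that A
  plus \<open>t\<close> times it is again an operator of the same family.\<close>

definition transport_op :: "int \<Rightarrow> real \<Rightarrow> real \<Rightarrow> l2 \<Rightarrow> l2" where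
  "transport_op l \<alpha> lam u = scaleC (\<i> * of_real lam) u
     - scaleC (\<i> * of_real (\<alpha> * of_int l)) (Q_proj l (sin_op (u + A_inv l u)))"

lemma A_op_Y_space: "u \<in> W22 \<Longrightarrow> u \<in> Y_space l \<Longrightarrow> A_op l u \<in> Y_space l"
  by (simp add: Y_space_iff fourier_coeff_A_op)

lemma Q_proj_Y_space: "Q_proj l f \<in> Y_space l"
  by (simp add: Y_space_iff Q_proj_mean fourier_coeff_diff fourier_coeff_mean_proj)

lemma resolvent_op_eq:
  assumes "u \<in> W22" "u \<in> Y_space l"
  shows "resolvent_op l \<alpha> lam u = A_op l u + transport_op l \<alpha> lam u"
proof (rule fourier_coeff_eqI)
  fix k
  have "\<bar>l\<bar> = 1 \<Longrightarrow> fourier_coeff (A_op l u) 0 = 0"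
    using A_op_Y_space[OF assms] by (simp add: Y_space_iff)
  then show "fourier_coeff (resolvent_op l \<alpha> lam u) k = fourier_coeff (A_op l u + transport_op l \<alpha> lam u) k"
    by (simp add: resolvent_op_def transport_op_def L_op_def Lambda_op_def A_inv_def[symmetric] Q_proj_mean
        fourier_coeff_add fourier_coeff_diff fourier_coeff_scaleC fourier_coeff_mean_proj algebra_simps)
qed

text \<open>A negative spectral parameter is reduced to a nonnegative one by \<open>sin \<mapsto> - sin\<close>.\<close>

lemma resolvent_equation_l2:
  assumes l: "l \<noteq> 0" and u: "u \<in> W22" "u \<in> Y_space l"
    and \<sigma>: "\<sigma> = 1 \<or> \<sigma> = (- 1 :: real)" and b: "b * \<sigma> = \<alpha> * of_int l" "b * \<mu> = lam"
  shows "\<exists>u1 u2 \<psi> \<psi>1 \<psi>2 p w w1 v \<phi> \<phi>1 \<phi>2.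
    resolvent_equation (\<lambda>x. \<sigma> *\<^sub>R sin_op x) (\<lambda>x. \<sigma> *\<^sub>R cos_op x) (scaleC \<i>) has_weak_deriv
      u u1 u2 \<psi> \<psi>1 \<psi>2 p w w1 v (resolvent_op l \<alpha> lam u) ((of_int l)\<^sup>2) b \<mu> \<and>
    shear_calculus.helmholtz has_weak_deriv ((of_int l)\<^sup>2) v \<phi> \<phi>1 \<phi>2"
proof -
  interpret shear_calculus "\<lambda>x. \<sigma> *\<^sub>R sin_op x" "\<lambda>x. \<sigma> *\<^sub>R cos_op x" "scaleC \<i>" has_weak_deriv
    by (rule shear_calculus_l2[OF \<sigma>])
  have helm: "\<exists>\<phi> \<phi>1 \<phi>2. helmholtz ((of_int l)\<^sup>2) x \<phi> \<phi>1 \<phi>2 \<and> \<phi> = A_inv l x" for x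
  proof -
    obtain g h where "has_weak_deriv (A_inv l x) g" "has_weak_deriv g h"
        "A_op l (A_inv l x) = h - (of_int l)\<^sup>2 *\<^sub>R A_inv l x"
      by (rule W22E[OF A_inv(1)[OF l]])
    then show ?thesis unfolding helmholtz_def A_inv(2)[OF l] by blast
  qed
  obtain u1 u2 where u12: "has_weak_deriv u u1" "has_weak_deriv u1 u2" "A_op l u = u2 - (of_int l)\<^sup>2 *\<^sub>R u"
    by (rule W22E[OF u(1)])
  obtain \<psi> \<psi>1 \<psi>2 where \<psi>: "helmholtz ((of_int l)\<^sup>2) u \<psi> \<psi>1 \<psi>2" "\<psi> = A_inv l u"
    using helm[of u] by blast
  define w where "w = u + \<psi>"
  define p where "p = mean_proj l (\<sigma> *\<^sub>R sin_op w)"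
  define v where "v = \<sigma> *\<^sub>R sin_op w - p - \<mu> *\<^sub>R u"
  have u0: "fourier_coeff u 0 = 0" "fourier_coeff \<psi> 0 = 0" if "\<bar>l\<bar> = 1"
  proof -
    show "fourier_coeff u 0 = 0" using u(2) that by (simp add: Y_space_iff)
    then show "fourier_coeff \<psi> 0 = 0" using A_inv(3)[OF l, of u 0] l by (simp add: \<psi>(2))
  qed
  have n: "4 \<le> (real_of_int l)\<^sup>2 \<and> p = 0 \<or> (real_of_int l)\<^sup>2 = 1 \<and> norm \<psi> \<le> norm \<psi>1 \<and> norm u \<le> norm u1"
  proof (cases "\<bar>l\<bar> = 1")
    case True
    then have "(real_of_int l)\<^sup>2 = 1" by (auto simp: abs_if split: if_splits)
    then show ?thesis
      using poincare[OF _ u0(2)[OF True]] poincare[OF u12(1) u0(1)[OF True]] \<psi>(1)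
      by (auto simp: helmholtz_def)
  next
    case False
    then have "2 \<le> \<bar>l\<bar>" using l by linarith
    then have "2 \<le> \<bar>real_of_int l\<bar>" by linarith
    then have "2\<^sup>2 \<le> \<bar>real_of_int l\<bar>\<^sup>2" by (rule power_mono) simp
    then show ?thesis using False by (simp add: p_def mean_proj_def)
  qed
  have f: "resolvent_op l \<alpha> lam u = u2 - (of_int l)\<^sup>2 *\<^sub>R u - b *\<^sub>R scaleC \<i> v"
  proof (rule fourier_coeff_eqI)
    fix k
    have c: "complex_of_real b * complex_of_real \<sigma> = of_real \<alpha> * of_int l"
        "complex_of_real b * complex_of_real \<mu> = of_real lam"
      using b by (metis of_real_mult of_real_of_int_eq)+
    have "fourier_coeff (b *\<^sub>R scaleC \<i> v) k
        = \<i> * (of_real b * of_real \<sigma>) * (fourier_coeff (sin_op w) k - fourier_coeff (mean_proj l (sin_op w)) k)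
          - \<i> * (of_real b * of_real \<mu>) * fourier_coeff u k"
      unfolding v_def p_def fourier_coeff_scaleC fourier_coeff_scaleR fourier_coeff_diff fourier_coeff_mean_proj
      by (simp add: algebra_simps)
    then show "fourier_coeff (resolvent_op l \<alpha> lam u) k = fourier_coeff (u2 - (of_int l)\<^sup>2 *\<^sub>R u - b *\<^sub>R scaleC \<i> v) k"
      unfolding resolvent_op_eq[OF u] transport_op_def u12(3)[symmetric] \<psi>(2)[symmetric] w_def[symmetric] c
      by (simp add: fourier_coeff_diff fourier_coeff_add fourier_coeff_scaleC Q_proj_mean algebra_simps)
  qed
  have J: "scaleC \<i> p = mean_proj l (scaleC \<i> (\<sigma> *\<^sub>R sin_op w))"
    by (rule fourier_coeff_eqI) (simp add: p_def fourier_coeff_mean_proj fourier_coeff_scaleC)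
  have "resolvent_equation (\<lambda>x. \<sigma> *\<^sub>R sin_op x) (\<lambda>x. \<sigma> *\<^sub>R cos_op x) (scaleC \<i>) has_weak_deriv
      u u1 u2 \<psi> \<psi>1 \<psi>2 p w (u1 + \<psi>1) v (resolvent_op l \<alpha> lam u) ((of_int l)\<^sup>2) b \<mu>"
  proof
    show "has_weak_deriv p 0"
      by (simp add: has_weak_deriv_iff p_def fourier_coeff_mean_proj fourier_coeff_zero)
    show "inner p (\<sigma> *\<^sub>R sin_op w) = inner p p"
      unfolding p_def inner_l2_def cinner_mean_proj fourier_coeff_mean_proj by simp
    show "inner p u = 0" "inner p \<psi> = 0"
      unfolding p_def inner_l2_def cinner_mean_proj using u0 by simp_all
    show "inner (scaleC \<i> p) u = 0" "inner (scaleC \<i> p) \<psi> = 0"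
      unfolding J inner_l2_def cinner_mean_proj using u0 by simp_all
  qed (use u12 \<psi> n f in \<open>auto simp: w_def v_def\<close>)
  then show ?thesis using helm[of v] by blast
qed

lemma obtain_sign:
  fixes \<alpha> lam :: real
  assumes "\<beta> \<noteq> (0::real)"
  obtains \<sigma> b where "\<sigma> = 1 \<or> \<sigma> = - 1" "b * \<sigma> = \<beta>" "b * \<bar>lam / \<beta>\<bar> = lam" "\<bar>b\<bar> = \<bar>\<beta>\<bar>"
proof (cases "0 \<le> lam / \<beta>")
  case True
  show ?thesis
    by (rule that[of 1 \<beta>]) (use assms in \<open>simp_all add: abs_of_nonneg[OF True] del: abs_divide\<close>)
next
  case False
  then have "\<bar>lam / \<beta>\<bar> = - (lam / \<beta>)" by (simp del: abs_divide)
  note neg = this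
  show ?thesis
    by (rule that[of "-1" "- \<beta>"]) (use assms in \<open>simp_all add: neg del: abs_divide\<close>)
qed

text \<open>Scaling both parameters by \<open>t\<close> keeps \<mu> and multiplies \<open>b\<close>
  by \<open>t\<close>. The energy bound involves neither, so it is uniform along the path used for
  invertibility.\<close>

lemma resolvent_dissipative:
  assumes l: "l \<noteq> 0" and u: "u \<in> W22" "u \<in> Y_space l" and \<alpha>: "\<alpha> \<noteq> 0"
  shows "norm u \<le> 2 * norm (resolvent_op l (t * \<alpha>) (t * lam) u)"
proof -
  obtain \<sigma> b where s: "\<sigma> = 1 \<or> \<sigma> = - 1" "b * \<sigma> = \<alpha> * of_int l" "b * \<bar>lam / (\<alpha> * of_int l)\<bar> = lam"
    by (rule obtain_sign[of "\<alpha> * of_int l" lam]) (use l \<alpha> in simp_all)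
  show ?thesis
    using resolvent_equation_l2[OF l u s(1), of "t * b" "t * \<alpha>" "\<bar>lam / (\<alpha> * of_int l)\<bar>" "t * lam"] s
      resolvent_equation.norm_u_le by (simp only: mult.assoc) blast
qed

lemma resolvent_supercritical:
  assumes l: "l \<noteq> 0" and u: "u \<in> W22" "u \<in> Y_space l" and \<alpha>: "\<alpha> \<noteq> 0"
    and r: "1 \<le> \<bar>lam / (\<alpha> * of_int l)\<bar>"
  shows "\<bar>\<alpha> * of_int l\<bar> * (\<bar>lam / (\<alpha> * of_int l)\<bar> - 1) * norm u \<le> 2 * norm (resolvent_op l \<alpha> lam u)"
proof -
  obtain \<sigma> b where s: "\<sigma> = 1 \<or> \<sigma> = - 1" "b * \<sigma> = \<alpha> * of_int l" "b * \<bar>lam / (\<alpha> * of_int l)\<bar> = lam"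
      "\<bar>b\<bar> = \<bar>\<alpha> * of_int l\<bar>"
    by (rule obtain_sign[of "\<alpha> * of_int l" lam]) (use l \<alpha> in simp_all)
  show ?thesis
    using resolvent_equation_l2[OF l u s(1-3)] resolvent_equation.supercritical_bound[OF _ r] s(4) by metis
qed

lemma resolvent_subcritical:
  assumes l: "l \<noteq> 0" and u: "u \<in> W22" "u \<in> Y_space l" and \<alpha>: "\<alpha> \<noteq> 0"
    and r: "\<bar>lam / (\<alpha> * of_int l)\<bar> \<le> 1"
    and \<epsilon>: "0 < \<epsilon>" "\<epsilon> \<le> \<delta>" "\<delta> \<le> 1" and b: "\<bar>\<alpha> * of_int l\<bar> * (\<epsilon>^3 * \<delta>) = 1"
    and \<delta>: "1 - \<bar>lam / (\<alpha> * of_int l)\<bar> = \<delta>\<^sup>2 \<or> \<delta> = \<epsilon> \<and> 1 - \<bar>lam / (\<alpha> * of_int l)\<bar> \<le> \<delta>\<^sup>2"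
  shows "norm u \<le> 10^24 * \<epsilon>\<^sup>2 * norm (resolvent_op l \<alpha> lam u)"
proof -
  obtain \<sigma> b where s: "\<sigma> = 1 \<or> \<sigma> = - 1" "b * \<sigma> = \<alpha> * of_int l" "b * \<bar>lam / (\<alpha> * of_int l)\<bar> = lam"
      "\<bar>b\<bar> = \<bar>\<alpha> * of_int l\<bar>"
    by (rule obtain_sign[of "\<alpha> * of_int l" lam]) (use l \<alpha> in simp_all)
  show ?thesis
    using resolvent_equation_l2[OF l u s(1-3)]
      resolvent_equation.subcritical_bound[OF _ _ abs_ge_zero r \<epsilon> _ \<delta>] b s(4) by metis
qed

lemma resolvent_apriori:
  assumes l: "l \<noteq> 0" and u: "u \<in> W22" "u \<in> Y_space l" and \<alpha>: "1 \<le> \<bar>\<alpha>\<bar>"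
    and a: "a = \<bar>\<alpha> * real_of_int l\<bar>" and r: "r = \<bar>lam / (\<alpha> * real_of_int l)\<bar>"
  shows "norm u \<le> (if r > 1 + 1 / a powr (1/2) then 4 * 10^24 / (a * (r - 1))
             else if r > 1 - 1 / a powr (1/2) then 4 * 10^24 / a powr (1/2)
             else 4 * 10^24 / (a powr (2/3) * (1 - r) powr (1/3))) * norm (resolvent_op l \<alpha> lam u)"
proof -
  let ?F = "norm (resolvent_op l \<alpha> lam u)" and ?N = "norm u"
  have \<alpha>0: "\<alpha> \<noteq> 0" using \<alpha> by auto
  have "1 \<le> \<bar>real_of_int l\<bar>" using l by linarith
  then have "1 * 1 \<le> \<bar>\<alpha>\<bar> * \<bar>real_of_int l\<bar>" using \<alpha> by (intro mult_mono) auto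
  then have a1: "1 \<le> a" by (simp add: a abs_mult)
  define s where "s = a powr (1/2)"
  have s1: "1 \<le> s" unfolding s_def using a1 by (simp add: ge_one_powr_ge_zero)
  have ss: "a = s * s" unfolding s_def using a1 by (simp add: powr_add[symmetric])
  have super: "a * (r - 1) * ?N \<le> 2 * ?F" if "1 \<le> r"
    using resolvent_supercritical[OF l u \<alpha>0] that unfolding a r by blast
  have layer: "?N \<le> 10^24 / s * norm (resolvent_op l \<alpha> lam' u)"
    if lam': "\<bar>lam' / (\<alpha> * real_of_int l)\<bar> \<le> 1" "1 - \<bar>lam' / (\<alpha> * real_of_int l)\<bar> \<le> 1 / s" for lam'
  proof -
    \<comment> \<open>With \<delta> = \<epsilon> the balance a \<epsilon>^3 \<delta> = 1 forces
      \<epsilon> = a^(-1/4).\<close>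
    define \<epsilon> where "\<epsilon> = 1 / sqrt s"
    have \<epsilon>2: "\<epsilon>\<^sup>2 = 1 / s" using s1 by (simp add: \<epsilon>_def power_divide)
    have "a * (\<epsilon>^3 * \<epsilon>) = s * s * (\<epsilon>\<^sup>2 * \<epsilon>\<^sup>2)" by (simp add: ss eval_nat_numeral)
    then have "a * (\<epsilon>^3 * \<epsilon>) = 1" using s1 by (simp add: \<epsilon>2)
    moreover have "0 < \<epsilon>" "\<epsilon> \<le> 1" using s1 by (simp_all add: \<epsilon>_def)
    ultimately have "?N \<le> 10^24 * \<epsilon>\<^sup>2 * norm (resolvent_op l \<alpha> lam' u)"
      using resolvent_subcritical[OF l u \<alpha>0 lam'(1), of \<epsilon> \<epsilon>] lam'(2) by (simp only: a \<epsilon>2) simp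
    then show ?thesis by (simp add: \<epsilon>2)
  qed
  consider "r > 1 + 1 / s" | "1 < r" "r \<le> 1 + 1 / s" | "1 - 1 / s < r" "r \<le> 1" | "r \<le> 1 - 1 / s"
    by linarith
  then show ?thesis
  proof cases
    case 1
    then have r1: "1 < r" using s1 by (smt (verit) divide_nonneg_nonneg)
    then have p: "0 < a * (r - 1)" using a1 by simp
    have "a * (r - 1) * ?N \<le> 2 * ?F" using super r1 by simp
    also have "\<dots> \<le> 4 * 10^24 * ?F" by (intro mult_right_mono) auto
    finally have "?N \<le> 4 * 10^24 / (a * (r - 1)) * ?F" using p by (simp add: field_simps)
    then show ?thesis using 1 by (simp add: s_def)
  next
    case 2
    text \<open>The estimate at \<open>r = 1\<close> extends to a neighbourhood of size \<open>1/s\<close> by perturbation.\<close>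
    have "?N \<le> 4 * 10^24 / s * ?F"
    proof (cases "2 * 10^24 * (s * (r - 1)) \<le> 1")
      \<comment> \<open>The threshold makes the shift of \<open>lam\<close> to
        \<open>lam / r\<close>, which costs \<open>a (r - 1) |u|\<close>, at most
        \<open>|u| / 2\<close> after multiplication by \<open>10^24 / s\<close>. Beyond it the
        supercritical bound already suffices; that case yields the constant 4 * 10^24.\<close>
      case True
      define lam' where "lam' = lam / r"
      have "\<bar>lam' / (\<alpha> * real_of_int l)\<bar> = \<bar>lam / (\<alpha> * real_of_int l)\<bar> / r"
        unfolding lam'_def abs_divide using 2(1) by (simp add: mult.commute)
      then have r': "\<bar>lam' / (\<alpha> * real_of_int l)\<bar> = 1"
        using 2(1) by (simp only: r[symmetric]) simp
      have "\<bar>lam\<bar> = a * r" using l \<alpha>0 by (simp add: r a abs_mult)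
      moreover have "lam' - lam = - (lam * ((r - 1) / r))" using 2 by (simp add: lam'_def field_simps)
      ultimately have d: "\<bar>lam' - lam\<bar> = a * (r - 1)" using 2 by (simp add: abs_mult)
      have "resolvent_op l \<alpha> lam' u = resolvent_op l \<alpha> lam u + scaleC (\<i> * of_real (lam' - lam)) u"
        by (rule fourier_coeff_eqI)
          (simp add: resolvent_op_def fourier_coeff_add fourier_coeff_scaleC algebra_simps)
      then have "norm (resolvent_op l \<alpha> lam' u) \<le> ?F + norm (scaleC (\<i> * of_real (lam' - lam)) u)"
        using norm_triangle_ineq by simp
      also have "norm (scaleC (\<i> * of_real (lam' - lam)) u) = a * (r - 1) * ?N"
        unfolding norm_scaleC norm_mult norm_of_real d by simp
      finally have "?N \<le> 10^24 / s * (?F + a * (r - 1) * ?N)"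
        using layer[of lam'] r' s1 by (intro order_trans[OF layer mult_left_mono]) auto
      also have "\<dots> = 10^24 / s * ?F + (10^24 * (s * (r - 1))) * ?N"
        using s1 by (simp add: ss field_simps)
      also have "\<dots> \<le> 10^24 / s * ?F + 1/2 * ?N"
        using True by (intro add_left_mono mult_right_mono) auto
      finally have "?N \<le> 2 * (10^24 / s * ?F)" by simp
      also have "\<dots> \<le> 4 * 10^24 / s * ?F" using s1 by (simp add: divide_right_mono)
      finally show ?thesis .
    next
      case False
      then have "1 \<le> 2 * 10^24 * (s * (r - 1))" by simp
      then have "s * ?N * 1 \<le> s * ?N * (2 * 10^24 * (s * (r - 1)))"
        using s1 by (intro mult_left_mono) auto
      also have "\<dots> = 2 * 10^24 * (a * (r - 1) * ?N)" by (simp add: ss)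
      also have "\<dots> \<le> 2 * 10^24 * (2 * ?F)" using 2 by (intro mult_left_mono super) auto
      finally show ?thesis using s1 by (simp add: field_simps)
    qed
    then show ?thesis using 2 s1 by (simp add: s_def not_less)
  next
    case 3
    have "?N \<le> 10^24 / s * ?F" by (rule layer) (use 3 in \<open>simp_all add: r\<close>)
    also have "\<dots> \<le> 4 * 10^24 / s * ?F" using s1 by (simp add: divide_right_mono)
    finally show ?thesis using 3 s1 by (simp add: s_def not_less)
  next
    case 4
    define m where "m = 1 - r"
    have "0 < 1 / s" "0 \<le> r" using s1 by (simp_all add: r)
    then have m: "1 / s \<le> m" "m \<le> 1" "0 < m" using 4 unfolding m_def by linarith+
    \<comment> \<open>The solution of a \<epsilon>^3 \<delta> = 1 for \<delta> = sqrt m; its square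
      is the claimed rate.\<close>
    define \<epsilon> where "\<epsilon> = 1 / (a powr (1/3) * m powr (1/6))"
    define \<delta> where "\<delta> = m powr (1/2)"
    have \<delta>2: "\<delta>\<^sup>2 = m" using m by (simp add: \<delta>_def power2_eq_square powr_add[symmetric])
    have \<epsilon>2: "\<epsilon>\<^sup>2 = 1 / (a powr (2/3) * m powr (1/3))"
      using m a1 by (simp add: \<epsilon>_def power_divide power_mult_distrib powr_power)
    have "\<epsilon>^3 = 1 / (a powr 1 * m powr (1/2))"
      using m a1 by (simp add: \<epsilon>_def power_divide power_mult_distrib powr_power)
    then have b: "a * (\<epsilon>^3 * \<delta>) = 1" using m a1 by (simp add: \<delta>_def)
    have \<epsilon>0: "0 < \<epsilon>" using a1 m by (simp add: \<epsilon>_def)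
    \<comment> \<open>Equivalent to s m >= 1, which is exactly the boundary of this regime.\<close>
    have \<epsilon>\<delta>: "\<epsilon> \<le> \<delta>"
    proof -
      have "1 \<le> s * m" using m(1) s1 by (simp add: field_simps)
      then have "1 \<le> (s * m) powr (2/3)" by (rule ge_one_powr_ge_zero) simp
      also have "\<dots> = a powr (1/3) * m powr (2/3)"
        using s1 m a1 by (simp add: powr_mult s_def powr_powr)
      also have "m powr (2/3) = m powr (1/6) * m powr (1/2)" by (simp add: powr_add[symmetric])
      finally show ?thesis using a1 m by (simp add: \<epsilon>_def \<delta>_def field_simps)
    qed
    have "\<delta> \<le> 1" using m by (simp add: \<delta>_def powr_le1)
    then have "?N \<le> 10^24 * \<epsilon>\<^sup>2 * ?F"
      using m(3) \<delta>2 b by (intro resolvent_subcritical[OF l u \<alpha>0 _ \<epsilon>0 \<epsilon>\<delta>]) (auto simp: r a m_def)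
    also have "\<dots> \<le> 4 * 10^24 * \<epsilon>\<^sup>2 * ?F" by (intro mult_right_mono) auto
    finally have "?N \<le> 4 * 10^24 / (a powr (2/3) * (1 - r) powr (1/3)) * ?F" by (simp add: \<epsilon>2 m_def)
    moreover have "\<not> r > 1 + 1 / s" "\<not> r > 1 - 1 / s" using 4 \<open>0 < 1 / s\<close> by linarith+
    ultimately show ?thesis by (simp add: s_def)
  qed
qed

text \<open>Advance in steps of length 1/m. A solution at the next parameter is a fixed point of the
  map that solves at the current parameter with right-hand side \<open>f - (1/m) K x\<close>, a
  contraction with factor \<open>c M / m\<close>. The a priori constant is the same for all
  parameters, so one \<open>m\<close> serves all steps.\<close>

lemma method_of_continuity:
  fixes A K :: "'a::banach \<Rightarrow> 'a"
  assumes Y: "subspace Y" "closed Y" and D: "D \<subseteq> Y" "\<And>u v. u \<in> D \<Longrightarrow> v \<in> D \<Longrightarrow> u - v \<in> D"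
    and A_diff: "\<And>u v. u \<in> D \<Longrightarrow> v \<in> D \<Longrightarrow> A (u - v) = A u - A v"
    and K_Y: "\<And>x. x \<in> Y \<Longrightarrow> K x \<in> Y"
    and K_diff: "\<And>x y. x \<in> Y \<Longrightarrow> y \<in> Y \<Longrightarrow> K (x - y) = K x - K y"
    and K_bound: "\<And>x. x \<in> Y \<Longrightarrow> norm (K x) \<le> M * norm x"
    and apriori: "\<And>t u. u \<in> D \<Longrightarrow> norm u \<le> c * norm (A u + t *\<^sub>R K u)" and c: "0 \<le> c" "0 \<le> M"
    and base: "\<And>f. f \<in> Y \<Longrightarrow> \<exists>u\<in>D. A u = f"
  shows "f \<in> Y \<Longrightarrow> \<exists>u\<in>D. A u + K u = f"
proof -
  obtain m :: nat where m: "c * M < real m" using reals_Archimedean2 by blast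
  then have m0: "0 < real m" using c by (meson le_less_trans mult_nonneg_nonneg)
  have "\<forall>f\<in>Y. \<exists>u\<in>D. A u + (real j / real m) *\<^sub>R K u = f" if "j \<le> m" for j
    using that
  proof (induction j)
    case 0
    then show ?case using base by simp
  next
    case (Suc j)
    then have IH: "\<forall>f\<in>Y. \<exists>u\<in>D. A u + (real j / real m) *\<^sub>R K u = f" by simp
    show ?case
    proof
      fix f assume f: "f \<in> Y"
      have rhs: "f - (1 / real m) *\<^sub>R K x \<in> Y" if "x \<in> Y" for x
        using Y(1) f K_Y[OF that] by (intro subspace_diff subspace_scale)
      have "\<forall>x\<in>Y. \<exists>u. u \<in> D \<and> A u + (real j / real m) *\<^sub>R K u = f - (1 / real m) *\<^sub>R K x"
        using IH rhs by blast
      then obtain \<Phi> where \<Phi>: "\<And>x. x \<in> Y \<Longrightarrow> \<Phi> x \<in> D"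
          "\<And>x. x \<in> Y \<Longrightarrow> A (\<Phi> x) + (real j / real m) *\<^sub>R K (\<Phi> x) = f - (1 / real m) *\<^sub>R K x"
        by metis
      have "\<exists>!x\<in>Y. \<Phi> x = x"
      proof (rule Banach_fix)
        show "complete Y" using Y(2) by (simp add: complete_eq_closed)
        show "Y \<noteq> {}" using f by blast
        show "0 \<le> c * M / real m" "c * M / real m < 1" using c m m0 by auto
        show "\<Phi> ` Y \<subseteq> Y" using \<Phi>(1) D(1) by blast
        fix x y assume xy: "x \<in> Y" "y \<in> Y"
        note D\<Phi> = \<Phi>(1)[OF xy(1)] \<Phi>(1)[OF xy(2)]
        have "A (\<Phi> x - \<Phi> y) + (real j / real m) *\<^sub>R K (\<Phi> x - \<Phi> y) =
            (A (\<Phi> x) + (real j / real m) *\<^sub>R K (\<Phi> x)) - (A (\<Phi> y) + (real j / real m) *\<^sub>R K (\<Phi> y))"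
          using D\<Phi> D(1) by (simp add: A_diff K_diff subset_iff scaleR_diff_right)
        also have "\<dots> = - ((1 / real m) *\<^sub>R K (x - y))"
          unfolding \<Phi>(2)[OF xy(1)] \<Phi>(2)[OF xy(2)] K_diff[OF xy] by (simp add: scaleR_diff_right)
        finally have "norm (\<Phi> x - \<Phi> y) \<le> c * norm (- ((1 / real m) *\<^sub>R K (x - y)))"
          using apriori[OF D(2)[OF D\<Phi>]] by metis
        also have "\<dots> \<le> c * (1 / real m * (M * norm (x - y)))"
          using K_bound[OF subspace_diff[OF Y(1) xy]] c m0 by (intro mult_left_mono) (simp_all add: divide_right_mono)
        finally show "dist (\<Phi> x) (\<Phi> y) \<le> c * M / real m * dist x y" by (simp add: dist_norm)
      qed
      then obtain x where x: "x \<in> Y" "\<Phi> x = x" by blast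
      have "A x + (real j / real m) *\<^sub>R K x + (1 / real m) *\<^sub>R K x = f" using \<Phi>(2)[OF x(1)] x(2) by simp
      moreover have "real (Suc j) / real m = real j / real m + 1 / real m" by (simp add: add_divide_distrib)
      ultimately have "A x + (real (Suc j) / real m) *\<^sub>R K x = f"
        by (simp only: scaleR_add_left add.assoc)
      then show "\<exists>u\<in>D. A u + (real (Suc j) / real m) *\<^sub>R K u = f"
        using \<Phi>(1)[OF x(1)] x(2) by metis
    qed
  qed
  from this[of m] m0 show "f \<in> Y \<Longrightarrow> \<exists>u\<in>D. A u + K u = f" by simp
qed

section \<open>Invertibility on Y_l\<close>

lemma subspace_Y_space: "subspace (Y_space l)"
  by (simp add: subspace_def Y_space_iff fourier_coeff_zero fourier_coeff_add fourier_coeff_scaleR)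

lemma closed_Y_space: "closed (Y_space l)"
  unfolding closed_sequential_limits
proof (intro allI impI)
  fix X f assume X: "(\<forall>n. X n \<in> Y_space l) \<and> X \<longlonglongrightarrow> f"
  have "(\<lambda>n. fourier_coeff (X n) 0) \<longlonglongrightarrow> fourier_coeff f 0"
    unfolding fourier_coeff_def using X by (intro tendsto_cinner_left) simp
  moreover have "\<bar>l\<bar> = 1 \<Longrightarrow> (\<lambda>n. fourier_coeff (X n) 0) = (\<lambda>n. 0)" using X by (simp add: Y_space_iff)
  ultimately show "f \<in> Y_space l" by (auto simp: Y_space_iff LIMSEQ_const_iff)
qed

lemma transport_op_scale: "transport_op l (t * \<alpha>) (t * lam) u = t *\<^sub>R transport_op l \<alpha> lam u"
  by (rule fourier_coeff_eqI)
    (simp add: transport_op_def fourier_coeff_diff fourier_coeff_scaleC fourier_coeff_scaleR algebra_simps)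

lemma transport_op_diff: "l \<noteq> 0 \<Longrightarrow> transport_op l \<alpha> lam (x - y) = transport_op l \<alpha> lam x - transport_op l \<alpha> lam y"
  by (rule fourier_coeff_eqI)
    (simp add: transport_op_def A_inv_diff fourier_coeff_diff fourier_coeff_add fourier_coeff_scaleC
      Q_proj_mean fourier_coeff_mean_proj fourier_coeff_sin_op field_simps)

lemma transport_op_Y_space: "x \<in> Y_space l \<Longrightarrow> transport_op l \<alpha> lam x \<in> Y_space l"
  using Q_proj_Y_space[of l "sin_op (x + A_inv l x)"]
  by (simp add: Y_space_iff transport_op_def fourier_coeff_diff fourier_coeff_scaleC)

lemma norm_transport_op_le:
  assumes l: "l \<noteq> 0"
  shows "norm (transport_op l \<alpha> lam x) \<le> (\<bar>lam\<bar> + \<bar>\<alpha> * of_int l\<bar>) * norm x"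
proof -
  interpret shear_calculus "\<lambda>x. 1 *\<^sub>R sin_op x" "\<lambda>x. 1 *\<^sub>R cos_op x" "scaleC \<i>" has_weak_deriv
    by (rule shear_calculus_l2) simp
  obtain g h where "has_weak_deriv (A_inv l x) g" "has_weak_deriv g h"
      "A_op l (A_inv l x) = h - (of_int l)\<^sup>2 *\<^sub>R A_inv l x"
    by (rule W22E[OF A_inv(1)[OF l]])
  then have "helmholtz ((of_int l)\<^sup>2) x (A_inv l x) g h" unfolding helmholtz_def A_inv(2)[OF l] by blast
  moreover have "1 \<le> (real_of_int l)\<^sup>2" using symbol_ge(1)[OF l, of 0] by simp
  ultimately have "norm (x + A_inv l x) \<le> norm x" by (rule helmholtz_le(3))
  then have "norm (Q_proj l (sin_op (x + A_inv l x))) \<le> norm x"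
    using norm_Q_proj_le[of l "sin_op (x + A_inv l x)"] norm_S_le[of "x + A_inv l x"] by simp
  then have "\<bar>\<alpha> * of_int l\<bar> * norm (Q_proj l (sin_op (x + A_inv l x))) \<le> \<bar>\<alpha> * of_int l\<bar> * norm x"
    by (rule mult_left_mono) simp
  moreover have "norm (transport_op l \<alpha> lam x) \<le> norm (scaleC (\<i> * of_real lam) x)
      + norm (scaleC (\<i> * of_real (\<alpha> * of_int l)) (Q_proj l (sin_op (x + A_inv l x))))"
    unfolding transport_op_def by (rule norm_triangle_ineq4)
  ultimately show ?thesis by (simp add: norm_scaleC norm_mult abs_mult distrib_right)
qed

text \<open>The path starts at A_l, which is onto Y_l from the domain, and ends at the resolvent
  operator. Injectivity is the a priori bound at the end point.\<close>

lemma resolvent_bij: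
  assumes l: "l \<noteq> 0" and \<alpha>: "\<alpha> \<noteq> 0"
  shows "bij_betw (resolvent_op l \<alpha> lam) (W22 \<inter> Y_space l) (Y_space l)"
proof -
  let ?D = "W22 \<inter> Y_space l" and ?Y = "Y_space l" and ?K = "transport_op l \<alpha> lam"
  have D_diff: "u - v \<in> ?D" if "u \<in> ?D" "v \<in> ?D" for u v
    using that subspace_diff[OF subspace_Y_space] W22_diff by blast
  have eq: "resolvent_op l (t * \<alpha>) (t * lam) u = A_op l u + t *\<^sub>R ?K u" if "u \<in> ?D" for u t
    using that by (simp add: resolvent_op_eq transport_op_scale)
  have apriori: "norm u \<le> 2 * norm (A_op l u + t *\<^sub>R ?K u)" if "u \<in> ?D" for u t
    using resolvent_dissipative[OF l _ _ \<alpha>, of u t lam] that by (simp add: eq)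
  have surj: "\<exists>u\<in>?D. A_op l u + ?K u = f" if "f \<in> ?Y" for f
  proof (rule method_of_continuity[OF subspace_Y_space closed_Y_space _ D_diff _ _ _ _ apriori _ _ _ that])
    show "norm (?K x) \<le> (\<bar>lam\<bar> + \<bar>\<alpha> * of_int l\<bar>) * norm x" for x by (rule norm_transport_op_le[OF l])
    show "\<exists>u\<in>?D. A_op l u = g" if "g \<in> ?Y" for g
    proof
      show "A_op l (A_inv l g) = g" by (rule A_inv(2)[OF l])
      show "A_inv l g \<in> ?D" using A_inv(1)[OF l] A_inv(3)[OF l, of g 0] that l by (auto simp: Y_space_iff)
    qed
  qed (use l in \<open>auto simp: A_op_diff transport_op_diff transport_op_Y_space\<close>)
  have "inj_on (resolvent_op l \<alpha> lam) ?D"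
  proof (rule inj_onI)
    fix u v assume uv: "u \<in> ?D" "v \<in> ?D" "resolvent_op l \<alpha> lam u = resolvent_op l \<alpha> lam v"
    have "A_op l (u - v) + 1 *\<^sub>R ?K (u - v) = (A_op l u + 1 *\<^sub>R ?K u) - (A_op l v + 1 *\<^sub>R ?K v)"
      using uv(1,2) by (simp add: A_op_diff transport_op_diff[OF l] algebra_simps)
    also have "\<dots> = 0" using uv(3) eq[OF uv(1), of 1] eq[OF uv(2), of 1] by simp
    finally have "A_op l (u - v) + 1 *\<^sub>R ?K (u - v) = 0" .
    then show "u = v" using apriori[OF D_diff[OF uv(1,2)], of 1] by simp
  qed
  moreover have "resolvent_op l \<alpha> lam ` ?D = ?Y"
  proof (intro equalityI subsetI)
    fix f assume "f \<in> resolvent_op l \<alpha> lam ` ?D"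
    then show "f \<in> ?Y"
      using eq[of _ 1] subspace_add[OF subspace_Y_space] A_op_Y_space transport_op_Y_space by auto
  next
    fix f assume "f \<in> ?Y"
    then show "f \<in> resolvent_op l \<alpha> lam ` ?D" using surj[of f] eq[of _ 1] by (auto simp: image_iff)
  qed
  ultimately show ?thesis by (simp add: bij_betw_def)
qed

section \<open>From the a priori bound to the norm of the inverse\<close>

lemma inverse_norm_bound:
  assumes T: "bij_betw T D Y" and Y: "Y \<noteq> {}" and c: "0 \<le> c" and b: "\<And>u. u \<in> D \<Longrightarrow> norm u \<le> c * norm (T u)"
  shows "invertible_in Y D T" and "onorm_on Y (inv_into D T) \<le> c"
proof -
  have inv: "norm (inv_into D T f) \<le> c * norm f" if "f \<in> Y" for f
    using b[of "inv_into D T f"] T that by (simp add: bij_betw_def inv_into_into f_inv_into_f)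
  then show "invertible_in Y D T" using T by (auto simp: invertible_in_def bounded_on_def)
  show "onorm_on Y (inv_into D T) \<le> c"
    unfolding onorm_on_def
  proof (rule cSUP_least[OF Y])
    fix f assume "f \<in> Y"
    \<comment> \<open>At \<open>f = 0\<close> the quotient is 0 by the convention for division, so
      \<open>c\<close> has to be nonnegative.\<close>
    then show "norm (inv_into D T f) / norm f \<le> c"
      using inv[of f] c by (cases "norm f = 0") (auto simp: divide_le_eq)
  qed
qed

theorem theorem1p3:
  shows "\<exists>C \<alpha>0 :: real. C > 0 \<and> \<alpha>0 > 0 \<and>
    (\<forall>\<alpha> :: real. \<bar>\<alpha>\<bar> \<ge> \<alpha>0 \<longrightarrow> (\<forall>(lam :: real) (l :: int). l \<noteq> 0 \<longrightarrow>
      (let Y = Y_space l;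
           D = W22 \<inter> Y;
           T = (\<lambda>u. scaleC (\<i> * complex_of_real lam) u + Q_proj l (L_op \<alpha> l u));
           a = \<bar>\<alpha> * real_of_int l\<bar>;
           r = \<bar>lam / (\<alpha> * real_of_int l)\<bar>
       in invertible_in Y D T \<and>
          onorm_on Y (inv_into D T) \<le>
            (if r > 1 + 1 / a powr (1/2) then C / (a * (r - 1))
             else if r > 1 - 1 / a powr (1/2) then C / a powr (1/2)
             else C / (a powr (2/3) * (1 - r) powr (1/3))))))"
proof (rule exI[of _ "4 * 10^24"], rule exI[of _ 1], intro conjI allI impI)
  fix \<alpha> lam :: real and l :: int
  \<comment> \<open>With 1 as the lower bound for |\<alpha>|, |\<alpha> l| >= 1 as well, which keeps
    the layer width at most 1.\<close>
  assume \<alpha>: "1 \<le> \<bar>\<alpha>\<bar>" and l: "l \<noteq> 0"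
  define a r where "a = \<bar>\<alpha> * real_of_int l\<bar>" and "r = \<bar>lam / (\<alpha> * real_of_int l)\<bar>"
  define c where "c = (if r > 1 + 1 / a powr (1/2) then 4 * 10^24 / (a * (r - 1))
             else if r > 1 - 1 / a powr (1/2) then 4 * 10^24 / a powr (1/2)
             else 4 * 10^24 / (a powr (2/3) * (1 - r) powr (1/3)))"
  have T: "(\<lambda>u. scaleC (\<i> * complex_of_real lam) u + Q_proj l (L_op \<alpha> l u)) = resolvent_op l \<alpha> lam"
    by (simp add: fun_eq_iff resolvent_op_def)
  have nn: "0 \<le> 1 / a powr (1/2)" "0 \<le> a" by (simp_all add: a_def)
  have "0 \<le> 4 * 10^24 / (a * (r - 1))" if "r > 1 + 1 / a powr (1/2)"
  proof -
    have "0 \<le> r - 1" using that nn(1) by linarith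
    then show ?thesis using nn(2) by simp
  qed
  then have c: "0 \<le> c" by (simp add: c_def)
  have bij: "bij_betw (resolvent_op l \<alpha> lam) (W22 \<inter> Y_space l) (Y_space l)"
    using resolvent_bij[OF l] \<alpha> by fastforce
  have bound: "norm u \<le> c * norm (resolvent_op l \<alpha> lam u)" if "u \<in> W22 \<inter> Y_space l" for u
    unfolding c_def using resolvent_apriori[OF l _ _ \<alpha> a_def r_def] that by blast
  have "Y_space l \<noteq> {}" using subspace_0[OF subspace_Y_space] by blast
  note inverse_norm_bound[OF bij this c bound]
  then show "let Y = Y_space l;
           D = W22 \<inter> Y;
           T = (\<lambda>u. scaleC (\<i> * complex_of_real lam) u + Q_proj l (L_op \<alpha> l u));
           a = \<bar>\<alpha> * real_of_int l\<bar>;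
           r = \<bar>lam / (\<alpha> * real_of_int l)\<bar>
       in invertible_in Y D T \<and>
          onorm_on Y (inv_into D T) \<le>
            (if r > 1 + 1 / a powr (1/2) then 4 * 10^24 / (a * (r - 1))
             else if r > 1 - 1 / a powr (1/2) then 4 * 10^24 / a powr (1/2)
             else 4 * 10^24 / (a powr (2/3) * (1 - r) powr (1/3)))"
    unfolding Let_def T a_def[symmetric] r_def[symmetric] c_def[symmetric] by blast
qed simp_all

end
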